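(* Let $X$ be an irreducible nondegenerate curve in $\mathbb{P}^N$ over an algebraically closed field of characteristic zero. Let $g$ be the generic rank and $m$ the maximal rank with respect to $X$. Then $m \leq 2g-1$. Moreover, if in addition the secant variety $\sigma_{g-1}(X)$ is a hypersurface, then $m \le 2g-2$.
   Context: The rank of a point $p\in\mathbb{P}^N$ with respect to $X$ is the least $r$ such that $p$ lies in the linear span of some $r$ distinct points of $X$. The generic rank $g$ is the rank attained on a dense open subset of $\mathbb{P}^N$; $m$ is the maximum value of the rank. $\sigma_{k}(X)$ is the Zariski closure of the set of points of rank at most $k$. *)

theory Defs
  imports "HOL-Computational_Algebra.Polynomial"
begin

text \<open>Projective space P^N over a field k. A vector of k^(N+1) is a function
  nat => k vanishing outside {0..N}; a point of P^N is the set of nonzero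
  scalar multiples of a nonzero such vector (a punctured line).\<close>

definition alg_closed_field :: "'k::field itself \<Rightarrow> bool" where
  "alg_closed_field _ \<longleftrightarrow> (\<forall>p::'k poly. degree p \<ge> 1 \<longrightarrow> (\<exists>x. poly p x = 0))"

definition vecs :: "nat \<Rightarrow> (nat \<Rightarrow> 'k::field) set" where
  "vecs N = {v. \<forall>i>N. v i = 0}"

definition pt :: "(nat \<Rightarrow> 'k::field) \<Rightarrow> (nat \<Rightarrow> 'k) set" where
  "pt v = {(\<lambda>i. c * v i) | c. c \<noteq> 0}"

definition PN :: "nat \<Rightarrow> (nat \<Rightarrow> 'k::field) set set" where
  "PN N = {pt v | v. v \<in> vecs N \<and> v \<noteq> (\<lambda>_. 0)}"

text \<open>Homogeneous polynomials of degree d in the variables x_0..x_N, given by a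
  finitely supported coefficient function on exponent vectors.\<close>

definition hpoly :: "nat \<Rightarrow> nat \<Rightarrow> ((nat \<Rightarrow> nat) \<Rightarrow> 'k::field) \<Rightarrow> bool" where
  "hpoly N d c \<longleftrightarrow> finite {\<alpha>. c \<alpha> \<noteq> 0} \<and>
     (\<forall>\<alpha>. c \<alpha> \<noteq> 0 \<longrightarrow> (\<forall>i>N. \<alpha> i = 0) \<and> (\<Sum>i\<le>N. \<alpha> i) = d)"

definition peval :: "nat \<Rightarrow> ((nat \<Rightarrow> nat) \<Rightarrow> 'k::field) \<Rightarrow> (nat \<Rightarrow> 'k) \<Rightarrow> 'k" where
  "peval N c v = (\<Sum>\<alpha>\<in>{\<alpha>. c \<alpha> \<noteq> 0}. c \<alpha> * (\<Prod>i\<le>N. v i ^ \<alpha> i))"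

definition zero_set :: "nat \<Rightarrow> ((nat \<Rightarrow> nat) \<Rightarrow> 'k::field) set \<Rightarrow> (nat \<Rightarrow> 'k) set set" where
  "zero_set N F = {p \<in> PN N. \<forall>c\<in>F. \<forall>v\<in>p. peval N c v = 0}"

definition zclosed :: "nat \<Rightarrow> (nat \<Rightarrow> 'k::field) set set \<Rightarrow> bool" where
  "zclosed N S \<longleftrightarrow> (\<exists>F. (\<forall>c\<in>F. \<exists>d. hpoly N d c) \<and> S = zero_set N F)"

definition zopen :: "nat \<Rightarrow> (nat \<Rightarrow> 'k::field) set set \<Rightarrow> bool" where
  "zopen N U \<longleftrightarrow> U \<subseteq> PN N \<and> zclosed N (PN N - U)"

definition zclosure :: "nat \<Rightarrow> (nat \<Rightarrow> 'k::field) set set \<Rightarrow> (nat \<Rightarrow> 'k) set set" where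
  "zclosure N S = \<Inter>{C. zclosed N C \<and> S \<subseteq> C}"

definition zirred :: "nat \<Rightarrow> (nat \<Rightarrow> 'k::field) set set \<Rightarrow> bool" where
  "zirred N S \<longleftrightarrow> S \<noteq> {} \<and>
     (\<forall>C1 C2. zclosed N C1 \<longrightarrow> zclosed N C2 \<longrightarrow> S \<subseteq> C1 \<union> C2 \<longrightarrow> S \<subseteq> C1 \<or> S \<subseteq> C2)"

definition zdim_ge :: "nat \<Rightarrow> (nat \<Rightarrow> 'k::field) set set \<Rightarrow> nat \<Rightarrow> bool" where
  "zdim_ge N X n \<longleftrightarrow> (\<exists>Y::nat \<Rightarrow> (nat \<Rightarrow> 'k) set set.
     (\<forall>i\<le>n. zclosed N (Y i) \<and> zirred N (Y i)) \<and> (\<forall>i<n. Y i \<subset> Y (Suc i)) \<and> Y n \<subseteq> X)"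

definition proj_curve :: "nat \<Rightarrow> (nat \<Rightarrow> 'k::field) set set \<Rightarrow> bool" where
  "proj_curve N X \<longleftrightarrow> zclosed N X \<and> zirred N X \<and> zdim_ge N X 1 \<and> \<not> zdim_ge N X 2"

definition nondegenerate :: "nat \<Rightarrow> (nat \<Rightarrow> 'k::field) set set \<Rightarrow> bool" where
  "nondegenerate N X \<longleftrightarrow>
     (\<forall>c. hpoly N 1 c \<and> c \<noteq> (\<lambda>_. 0) \<longrightarrow> \<not> X \<subseteq> zero_set N {c})"

definition pspan :: "(nat \<Rightarrow> 'k::field) set set \<Rightarrow> (nat \<Rightarrow> 'k) set set" where
  "pspan P = {p. \<exists>w a. (\<forall>q\<in>P. w q \<in> q) \<and> (\<lambda>i. \<Sum>q\<in>P. a q * w q i) \<in> p}"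

definition rank :: "nat \<Rightarrow> (nat \<Rightarrow> 'k::field) set set \<Rightarrow> (nat \<Rightarrow> 'k) set \<Rightarrow> nat" where
  "rank N X p = (LEAST r. \<exists>P. P \<subseteq> X \<and> finite P \<and> card P = r \<and> p \<in> pspan P)"

definition is_generic_rank :: "nat \<Rightarrow> (nat \<Rightarrow> 'k::field) set set \<Rightarrow> nat \<Rightarrow> bool" where
  "is_generic_rank N X g \<longleftrightarrow>
     (\<exists>U. zopen N U \<and> zclosure N U = PN N \<and> (\<forall>p\<in>U. rank N X p = g))"

definition is_max_rank :: "nat \<Rightarrow> (nat \<Rightarrow> 'k::field) set set \<Rightarrow> nat \<Rightarrow> bool" where
  "is_max_rank N X m \<longleftrightarrow>
     (\<exists>p\<in>PN N. rank N X p = m) \<and> (\<forall>p\<in>PN N. rank N X p \<le> m)"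

definition sigma :: "nat \<Rightarrow> (nat \<Rightarrow> 'k::field) set set \<Rightarrow> nat \<Rightarrow> (nat \<Rightarrow> 'k) set set" where
  "sigma N X k = zclosure N {p \<in> PN N. rank N X p \<le> k}"

definition is_hypersurface :: "nat \<Rightarrow> (nat \<Rightarrow> 'k::field) set set \<Rightarrow> bool" where
  "is_hypersurface N S \<longleftrightarrow>
     (\<exists>d c. d \<ge> 1 \<and> hpoly N d c \<and> c \<noteq> (\<lambda>_. 0) \<and> S = zero_set N {c})"

end

theory Submission
  imports Defs "HOL-Library.Function_Algebras"
begin

text \<open>
  For a curve X in P^N everything reduces to two estimates: m \<le> N, and the secant variety
  \<sigma>_k(X) has dimension at most 2k - 1. The second one gives N + 1 \<le> 2g because \<sigma>_g(X) fills
  P^N, and N - 1 \<le> 2(g - 1) - 1 if \<sigma>_(g-1)(X) is a hypersurface; together with m \<le> N these are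
  the two claims.

  Dimension: forms of degree d restricted to the cone over X span a space of dimension O(d),
  so polynomials of degree at most d span O(d^2). Pulling polynomials in n variables back along the
  sum of k points of the cone, the (e + 1)^n monomials with exponents at most e land in a space
  of dimension O(e^(2k)), so for n > 2k some nonzero form vanishes on \<sigma>_k(X). For a hypersurface one
  applies this to the n = N coordinates of a projection from a point off the hypersurface.

  Maximal rank: for p not in X choose linear forms a, b vanishing at p without common zero on X.
  In characteristic zero a generic hyperplane a = \<tau> b cuts X in D distinct points, where D is the
  degree of the function field of X over k(a/b). The dimension of the space L_d of forms of degree d
  on X grows at most like D d, so for some large d the forms in L_(d+1) vanishing on these D points
  are exactly (a - \<tau> b) L_d. Hence a linear form l vanishing on them satisfies
  l L_d \<subseteq> (a - \<tau> b) L_d, and an eigenvalue of the finite-dimensional operator l/(a - \<tau> b) shows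
  that l is a multiple of a - \<tau> b. So the D points span the hyperplane, which contains p, and N of them
  suffice.
\<close>

section \<open>Subrings and minimal polynomials\<close>

text \<open>All algebra takes place inside rings of functions: a domain is a subring
  \<open>R\<close> with a prime \<open>Z\<close>, and equality in R/Z is membership of a difference
  in \<open>Z\<close>. Neither quotients nor fraction fields are formed, so statements about
  fractions appear with denominators cleared by an element outside \<open>Z\<close>. The number D is
  never treated as a field degree. It is the size of an index set \<open>K\<close> obtained from a
  tower of simple extensions; \<open>K\<close> indexes both a spanning family of the coordinate ring
  over k(a) on the chart b = 1 and the points of one fibre. Only the equality of these two counts is
  used. Likewise no Hilbert polynomial occurs: a linear upper bound on dim L_d yields by pigeonhole
  one degree where the dimension grows by at most D, and one such degree is enough. The forms a and
  b without common zero on X exist because a hyperplane meets X in finitely many points. As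
  dimension is defined by chains of irreducible closed sets, an infinite section has to be converted
  into an irreducible closed set strictly between a point and X.\<close>

definition subring :: "'r::comm_ring_1 set \<Rightarrow> bool" where
  "subring A \<longleftrightarrow> 1 \<in> A \<and> (\<forall>x\<in>A. \<forall>y\<in>A. x - y \<in> A \<and> x * y \<in> A)"

definition prime_of :: "'r::comm_ring_1 set \<Rightarrow> 'r set \<Rightarrow> bool" where
  "prime_of R Z \<longleftrightarrow> Z \<subseteq> R \<and> 0 \<in> Z \<and> 1 \<notin> Z \<and> (\<forall>x\<in>Z. \<forall>y\<in>Z. x + y \<in> Z) \<and>
     (\<forall>r\<in>R. \<forall>z\<in>Z. r * z \<in> Z) \<and> (\<forall>x\<in>R. \<forall>y\<in>R. x * y \<in> Z \<longrightarrow> x \<in> Z \<or> y \<in> Z)"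

text \<open>Also applied to the ideal \<open>Z\<close> in place of a subring:
  \<open>cpoly Z p\<close> says that p is zero modulo \<open>Z\<close>.\<close>

definition cpoly :: "'r::comm_ring_1 set \<Rightarrow> 'r poly \<Rightarrow> bool" where
  "cpoly A p \<longleftrightarrow> (\<forall>i. coeff p i \<in> A)"

definition adj :: "'r::comm_ring_1 set \<Rightarrow> 'r \<Rightarrow> 'r set" where
  "adj A y = {poly p y | p. cpoly A p}"

fun adjs :: "'r::comm_ring_1 set \<Rightarrow> 'r list \<Rightarrow> 'r set" where
  "adjs A [] = A"
| "adjs A (y # ys) = adjs (adj A y) ys"

lemma subringD:
  assumes "subring A"
  shows "1 \<in> A" "0 \<in> A" "\<And>x y. x \<in> A \<Longrightarrow> y \<in> A \<Longrightarrow> x - y \<in> A"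
    "\<And>x y. x \<in> A \<Longrightarrow> y \<in> A \<Longrightarrow> x * y \<in> A" "\<And>x. x \<in> A \<Longrightarrow> - x \<in> A"
    "\<And>x y. x \<in> A \<Longrightarrow> y \<in> A \<Longrightarrow> x + y \<in> A"
proof -
  show 1: "1 \<in> A" and 3: "\<And>x y. x \<in> A \<Longrightarrow> y \<in> A \<Longrightarrow> x - y \<in> A"
    and "\<And>x y. x \<in> A \<Longrightarrow> y \<in> A \<Longrightarrow> x * y \<in> A"
    using assms by (auto simp: subring_def)
  show 0: "0 \<in> A" using 3[OF 1 1] by simp
  show m: "- x \<in> A" if "x \<in> A" for x using 3[OF 0 that] by simp
  show "x + y \<in> A" if "x \<in> A" "y \<in> A" for x y using 3[OF that(1) m[OF that(2)]] by simp
qed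

lemma subring_sum:
  assumes "subring A" "\<And>i. i \<in> I \<Longrightarrow> f i \<in> A"
  shows "sum f I \<in> A"
  using assms(2) by (induction I rule: infinite_finite_induct) (auto intro: subringD[OF assms(1)])

lemma subring_power:
  assumes "subring A" "x \<in> A"
  shows "x ^ n \<in> A"
  by (induction n) (auto intro: subringD[OF assms(1)] assms(2))

lemma cpolyD: "cpoly A p \<Longrightarrow> coeff p i \<in> A"
  by (simp add: cpoly_def)

context
  fixes A :: "'r::comm_ring_1 set"
  assumes A: "subring A"
begin

lemma cpoly_arith:
  shows "cpoly A 0" "cpoly A 1"
    "\<And>p q. cpoly A p \<Longrightarrow> cpoly A q \<Longrightarrow> cpoly A (p + q)"
    "\<And>p q. cpoly A p \<Longrightarrow> cpoly A q \<Longrightarrow> cpoly A (p - q)"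
    "\<And>p q. cpoly A p \<Longrightarrow> cpoly A q \<Longrightarrow> cpoly A (p * q)"
    "\<And>c p. c \<in> A \<Longrightarrow> cpoly A p \<Longrightarrow> cpoly A (smult c p)"
    "\<And>c n. c \<in> A \<Longrightarrow> cpoly A (monom c n)"
    "\<And>c p. c \<in> A \<Longrightarrow> cpoly A p \<Longrightarrow> cpoly A (pCons c p)"
  by (auto simp: cpoly_def coeff_mult coeff_pCons intro!: subringD[OF A] subring_sum[OF A] split: nat.splits)

lemma adj_subring: "subring (adj A y)"
  unfolding subring_def adj_def
proof (safe)
  show "\<exists>p. 1 = poly p y \<and> cpoly A p"
    by (rule exI[of _ 1]) (auto intro: cpoly_arith)
  fix p q assume "cpoly A p" "cpoly A q"
  then show "\<exists>r. poly p y - poly q y = poly r y \<and> cpoly A r"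
    "\<exists>r. poly p y * poly q y = poly r y \<and> cpoly A r"
    by (metis poly_diff poly_mult cpoly_arith(4,5))+
qed

lemma adj_incl: "A \<subseteq> adj A y"
proof
  fix x assume "x \<in> A"
  then have "cpoly A [:x:]" by (auto intro!: cpoly_arith)
  then show "x \<in> adj A y" unfolding adj_def by force
qed

lemma adj_gen: "y \<in> adj A y"
proof -
  have "cpoly A [:0,1:]" by (auto intro!: cpoly_arith subringD[OF A])
  then show ?thesis unfolding adj_def by force
qed

lemma adj_least:
  assumes "subring B" "A \<subseteq> B" "y \<in> B"
  shows "adj A y \<subseteq> B"
proof
  fix x assume "x \<in> adj A y"
  then obtain p where p: "cpoly A p" "x = poly p y" by (auto simp: adj_def)
  then have "\<And>i. coeff p i \<in> B" using assms(2) by (auto simp: cpoly_def)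
  then show "x \<in> B" unfolding p(2) poly_altdef
    by (intro subring_sum subringD(4) subring_power assms)
qed

end

lemma adjs_subring: "subring A \<Longrightarrow> subring (adjs A ys)"
  by (induction ys arbitrary: A) (auto intro: adj_subring)

lemma adjs_incl: "subring A \<Longrightarrow> A \<subseteq> adjs A ys"
proof (induction ys arbitrary: A)
  case (Cons y ys)
  from Cons.IH[OF adj_subring[OF Cons.prems]] show ?case
    using adj_incl[OF Cons.prems, of y] by auto
qed simp

lemma adjs_gen: "subring A \<Longrightarrow> set ys \<subseteq> adjs A ys"
proof (induction ys arbitrary: A)
  case (Cons y ys)
  note S = adj_subring[OF Cons.prems, of y]
  have "y \<in> adjs (adj A y) ys"
    using adjs_incl[OF S] adj_gen[OF Cons.prems] by blast
  then show ?case using Cons.IH[OF S] by simp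
qed simp

lemma adjs_least: "subring A \<Longrightarrow> subring B \<Longrightarrow> A \<subseteq> B \<Longrightarrow> set ys \<subseteq> B \<Longrightarrow> adjs A ys \<subseteq> B"
proof (induction ys arbitrary: A)
  case (Cons y ys)
  then show ?case using adj_subring[of A y] adj_least[of A B y] by simp
qed simp

lemma cpoly_mono: "A \<subseteq> B \<Longrightarrow> cpoly A p \<Longrightarrow> cpoly B p"
  by (auto simp: cpoly_def)

text \<open>Each round cancels the top coefficient of g at the cost of a factor
  \<open>coeff p n\<close>, which need not be invertible in \<open>A\<close>. The remainder is
  bounded by vanishing coefficients from n on, so that n = 0 correctly means r = 0. The last clause
  bounds the degree of q by deg g - n; it later makes minimality applicable to the quotient.\<close>

lemma pseudo_division:
  assumes A: "subring A" and p: "cpoly A p" and g: "cpoly A g"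
  shows "\<exists>m q r. smult (coeff p n ^ m) g = p * q + r \<and> cpoly A q \<and> cpoly A r \<and>
    (degree p \<le> n \<longrightarrow> (\<forall>i\<ge>n. coeff r i = 0)) \<and> (\<forall>i. degree g < i + n \<longrightarrow> coeff q i = 0)"
  using g
proof (induction "degree g" arbitrary: g rule: less_induct)
  case less
  show ?case
  proof (cases "degree g < n")
    case True
    have "\<forall>i\<ge>n. coeff g i = 0" using True by (auto intro: coeff_eq_0)
    moreover have "smult (coeff p n ^ 0) g = p * 0 + g" by simp
    ultimately show ?thesis using less.prems cpoly_arith(1)[OF A] by (metis coeff_0)
  next
    case False
    define d where "d = degree g"
    have dn: "n \<le> d" using False by (simp add: d_def)
    define q0 where "q0 = monom (coeff g d) (d - n)"
    define g' where "g' = smult (coeff p n) g - p * q0"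
    have q0: "cpoly A q0" unfolding q0_def by (intro cpoly_arith A cpolyD less.prems)
    have g': "cpoly A g'" unfolding g'_def by (intro cpoly_arith A cpolyD less.prems p q0)
    show ?thesis
    proof (cases "degree p \<le> n")
      case True
      have q0i: "coeff q0 i = 0" if "d < i + n" for i
        using that dn by (auto simp: q0_def)
      have cg: "coeff g' i = 0" if "i \<ge> d" for i
      proof -
        have "coeff (p * q0) i = coeff g d * coeff p (i - (d - n))"
          unfolding q0_def using that by (subst mult.commute) (simp add: coeff_monom_mult)
        moreover have "i = d \<or> (i > d \<and> coeff p (i - (d-n)) = 0 \<and> coeff g i = 0)"
          using that True dn by (auto intro!: coeff_eq_0 simp: d_def)
        ultimately show ?thesis using dn by (auto simp: g'_def)
      qed
      show ?thesis
      proof (cases "d = 0")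
        case True
        have "g' = 0" using cg True by (intro poly_eqI) simp
        then have "smult (coeff p n ^ 1) g = p * q0 + 0" by (simp add: g'_def)
        moreover have "\<forall>i. degree g < i + n \<longrightarrow> coeff q0 i = 0" using q0i d_def by auto
        ultimately show ?thesis using q0 cpoly_arith(1)[OF A] by (metis coeff_0)
      next
        case False
        have lt: "degree g' < d"
          using False cg by (metis degree_0 leading_coeff_0_iff not_le not_gr0)
        from less.hyps[OF lt[unfolded d_def] g'] obtain m q r where
          *: "smult (coeff p n ^ m) g' = p * q + r" "cpoly A q" "cpoly A r"
          "\<forall>i\<ge>n. coeff r i = 0" "\<forall>i. degree g' < i + n \<longrightarrow> coeff q i = 0" using True by blast
        have "smult (coeff p n ^ Suc m) g = p * (q + smult (coeff p n ^ m) q0) + r"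
          using *(1) by (simp add: g'_def algebra_simps smult_diff_right)
        moreover have "cpoly A (q + smult (coeff p n ^ m) q0)"
          by (intro cpoly_arith A * q0 subring_power cpolyD p)
        moreover have "\<forall>i. degree g < i + n \<longrightarrow> coeff (q + smult (coeff p n ^ m) q0) i = 0"
          using *(5) q0i lt d_def by auto
        ultimately show ?thesis using *(3,4) by metis
      qed
    next
      case False
      have "smult (coeff p n ^ 0) g = p * 0 + g" by simp
      then show ?thesis using False less.prems cpoly_arith(1)[OF A] by (metis coeff_0)
    qed
  qed
qed

locale prime_ideal =
  fixes R Z :: "'r::comm_ring_1 set"
  assumes R: "subring R" and Z: "prime_of R Z"
begin

lemma Z0: "0 \<in> Z" and Z1: "1 \<notin> Z"
  and Z_add: "x \<in> Z \<Longrightarrow> y \<in> Z \<Longrightarrow> x + y \<in> Z"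
  and Z_mult: "r \<in> R \<Longrightarrow> x \<in> Z \<Longrightarrow> r * x \<in> Z"
  and Z_mult': "r \<in> R \<Longrightarrow> x \<in> Z \<Longrightarrow> x * r \<in> Z"
  and Z_prime: "x \<in> R \<Longrightarrow> y \<in> R \<Longrightarrow> x * y \<in> Z \<Longrightarrow> x \<in> Z \<or> y \<in> Z"
  using Z by (auto simp: prime_of_def mult.commute)

lemma Z_minus: "x \<in> Z \<Longrightarrow> - x \<in> Z"
  using Z_mult[of "-1" x] subringD[OF R] by auto

lemma Z_diff: "x \<in> Z \<Longrightarrow> y \<in> Z \<Longrightarrow> x - y \<in> Z"
  using Z_add[OF _ Z_minus, of x y] by simp

lemma Z_sum: "(\<And>i. i \<in> I \<Longrightarrow> f i \<in> Z) \<Longrightarrow> sum f I \<in> Z"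
  by (induction I rule: infinite_finite_induct) (auto intro: Z0 Z_add)

lemma Z_power: "x \<in> R \<Longrightarrow> x ^ n \<in> Z \<Longrightarrow> x \<in> Z"
  by (induction n) (use Z1 Z_prime subring_power[OF R] in auto)

lemma Z_iff: "x - y \<in> Z \<Longrightarrow> x \<in> Z \<longleftrightarrow> y \<in> Z"
  using Z_diff[of x "x - y"] Z_add[of "x - y" y] by auto

definition algebraic :: "'r set \<Rightarrow> 'r \<Rightarrow> bool" where
  "algebraic A y \<longleftrightarrow> (\<exists>p. cpoly A p \<and> poly p y \<in> Z \<and> \<not> cpoly Z p)"

lemma algebraic_mono: "algebraic A y \<Longrightarrow> A \<subseteq> B \<Longrightarrow> algebraic B y"
  unfolding algebraic_def using cpoly_mono by blast

lemma poly_Z: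
  assumes "cpoly Z p" "y \<in> R"
  shows "poly p y \<in> Z"
  unfolding poly_altdef by (intro Z_sum Z_mult' subring_power R assms(2) cpolyD assms(1))

lemma poly_R:
  assumes "cpoly R p" "y \<in> R"
  shows "poly p y \<in> R"
  unfolding poly_altdef by (intro subring_sum subringD(4) subring_power R assms(2) cpolyD assms(1))

text \<open>A minimal polynomial over the fraction field, cleared of denominators.\<close>

definition minpol :: "'r set \<Rightarrow> 'r \<Rightarrow> nat \<Rightarrow> 'r poly \<Rightarrow> bool" where
  "minpol A y n P \<longleftrightarrow> n \<ge> 1 \<and> cpoly A P \<and> degree P \<le> n \<and> coeff P n \<notin> Z \<and> poly P y \<in> Z \<and>
     (\<forall>q. cpoly A q \<longrightarrow> (\<forall>i\<ge>n. coeff q i = 0) \<longrightarrow> poly q y \<in> Z \<longrightarrow> cpoly Z q)"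

context
  fixes A :: "'r set" and y :: 'r
  assumes A: "subring A" and AR: "A \<subseteq> R" and y: "y \<in> R"
begin

text \<open>Take the least degree bound n of a relation that is nontrivial modulo \<open>Z\<close>.
  Its coefficient at n is outside \<open>Z\<close>, since otherwise dropping that term would leave a
  nontrivial relation with a smaller bound.\<close>

lemma minpol_exists:
  assumes "algebraic A y"
  obtains n P where "minpol A y n P"
proof -
  define Q where "Q n \<longleftrightarrow> (\<exists>p. cpoly A p \<and> poly p y \<in> Z \<and> \<not> cpoly Z p \<and> degree p \<le> n)" for n
  have "\<exists>n. Q n" using assms unfolding Q_def algebraic_def by blast
  then obtain n where n: "Q n" "\<And>m. m < n \<Longrightarrow> \<not> Q m" by (meson exists_least_iff)
  then obtain P where P: "cpoly A P" "poly P y \<in> Z" "\<not> cpoly Z P" "degree P \<le> n"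
    by (auto simp: Q_def)
  have min: "cpoly Z q" if q: "cpoly A q" "\<forall>i\<ge>n. coeff q i = 0" "poly q y \<in> Z" for q
  proof (cases "n = 0")
    case True
    then have "q = 0" using q by (intro poly_eqI) auto
    then show ?thesis using Z0 by (auto simp: cpoly_def)
  next
    case False
    then have "degree q < n" using q(2) by (metis degree_0 leading_coeff_0_iff not_le not_gr0)
    then show ?thesis using n(2) q unfolding Q_def by blast
  qed
  have c: "coeff P n \<notin> Z"
  proof
    assume cZ: "coeff P n \<in> Z"
    define q where "q = P - monom (coeff P n) n"
    have "cpoly A q" unfolding q_def by (intro cpoly_arith A P cpolyD)
    moreover have "\<forall>i\<ge>n. coeff q i = 0" using P(4) by (auto simp: q_def coeff_eq_0)
    moreover have "poly q y \<in> Z" unfolding q_def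
      by (auto simp: poly_monom intro!: Z_diff P Z_mult' cZ subring_power[OF R] y)
    ultimately have "cpoly Z q" by (rule min)
    then have "coeff P i \<in> Z" for i
      using cZ by (cases "i = n") (auto simp: cpoly_def q_def dest: spec[of _ i])
    then show False using P(3) by (auto simp: cpoly_def)
  qed
  have "n \<noteq> 0"
  proof
    assume "n = 0"
    then have "poly P y = coeff P n" using P(4) by (simp add: poly_altdef)
    then show False using c P(2) by simp
  qed
  then show ?thesis using that[of n P] P min c unfolding minpol_def by auto
qed

context
  fixes n P
  assumes P: "minpol A y n P"
begin

lemma P': "n \<ge> 1" "cpoly A P" "degree P \<le> n" "coeff P n \<notin> Z" "poly P y \<in> Z"
    "\<And>q. cpoly A q \<Longrightarrow> (\<And>i. i \<ge> n \<Longrightarrow> coeff q i = 0) \<Longrightarrow> poly q y \<in> Z \<Longrightarrow> cpoly Z q"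
  "coeff P n \<in> A"
  using P unfolding minpol_def by (auto simp: cpolyD)

text \<open>Up to a power of the leading coefficient, g(y) is a combination of 1, y, ..., y^(n-1)
  modulo \<open>Z\<close>, as in a simple field extension of degree n.\<close>

lemma minpol_reduce:
  assumes g: "cpoly A g"
  shows "\<exists>m q r. smult (coeff P n ^ m) g = P * q + r \<and> cpoly A q \<and> cpoly A r \<and>
     (\<forall>i\<ge>n. coeff r i = 0) \<and> coeff P n ^ m * poly g y - poly r y \<in> Z"
proof -
  obtain m q r where *: "smult (coeff P n ^ m) g = P * q + r" "cpoly A q" "cpoly A r"
     "\<forall>i\<ge>n. coeff r i = 0"
    using pseudo_division[OF A P'(2) g, of n] P'(3) by blast
  have "coeff P n ^ m * poly g y = poly P y * poly q y + poly r y"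
    by (metis "*"(1) poly_add poly_mult poly_smult)
  then have "coeff P n ^ m * poly g y - poly r y = poly P y * poly q y" by simp
  also have "\<dots> \<in> Z" by (intro Z_mult' P' poly_R y cpoly_mono[OF AR] *)
  finally show ?thesis using * by blast
qed

text \<open>The element h plays the role of the norm of f.\<close>

lemma minpol_norm:
  assumes f: "f \<in> adj A y" "f \<notin> Z"
  shows "\<exists>u\<in>adj A y. \<exists>h\<in>A. h \<notin> Z \<and> f * u - h \<in> Z"
proof -
  note S = adj_subring[OF A, of y]
  \<comment> \<open>Polynomials whose value at y is, modulo \<open>Z\<close>, a nonzero multiple of
    f. A member of least degree will turn out to be constant, and that constant is h.\<close>
  define G where "G r \<longleftrightarrow> cpoly A r \<and> poly r y \<notin> Z \<and> (\<exists>u\<in>adj A y. f * u - poly r y \<in> Z)" for r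
  have adjp: "cpoly A r \<Longrightarrow> poly r y \<in> adj A y" for r by (auto simp: adj_def)
  obtain g where g: "cpoly A g" "f = poly g y" using f by (auto simp: adj_def)
  have "G g" unfolding G_def using g f subringD(1)[OF S] Z0 by (auto intro!: bexI[of _ 1])
  then obtain r where r: "G r" "\<And>r'. degree r' < degree r \<Longrightarrow> \<not> G r'"
    using ex_has_least_nat[of G g degree] by (meson not_le)
  obtain u where u: "u \<in> adj A y" "f * u - poly r y \<in> Z" and rA: "cpoly A r" and rZ: "poly r y \<notin> Z"
    using r(1) by (auto simp: G_def)
  define d where "d = degree r"
  show ?thesis
  proof (cases "d = 0")
    case True
    then have "poly r y = coeff r 0" by (simp add: d_def poly_altdef)
    then show ?thesis using u rA rZ by (metis cpolyD)
  next
    case False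
    have low: "poly s y \<in> Z" if "cpoly A s" "\<forall>i\<ge>d. coeff s i = 0" "w \<in> adj A y" "f * w - poly s y \<in> Z"
      for s w
    proof -
      have "degree s < degree r" using False that(2)
        by (metis d_def degree_0 leading_coeff_0_iff not_le not_gr0)
      then show ?thesis using r(2) that unfolding G_def by blast
    qed
    \<comment> \<open>Otherwise reduction by P gives a multiple of f of degree below d. By
      minimality it lies in \<open>Z\<close>, and then so does r(y), because the leading coefficient
      of P is outside \<open>Z\<close>.\<close>
    have dn: "d < n"
    proof (rule ccontr)
      assume "\<not> d < n"
      obtain m q r' where *: "smult (coeff P n ^ m) r = P * q + r'" "cpoly A r'"
        "\<forall>i\<ge>n. coeff r' i = 0" "coeff P n ^ m * poly r y - poly r' y \<in> Z"
        using minpol_reduce[OF rA] by blast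
      have cm: "coeff P n ^ m \<in> A" by (intro subring_power A P')
      have "coeff P n ^ m * poly r y \<in> Z"
      proof -
        have "f * (coeff P n ^ m * u) - poly r' y
          = coeff P n ^ m * (f * u - poly r y) + (coeff P n ^ m * poly r y - poly r' y)"
          by (simp add: algebra_simps)
        also have "\<dots> \<in> Z" using cm AR by (intro Z_add Z_mult * u) auto
        finally have "poly r' y \<in> Z"
          using * \<open>\<not> d < n\<close> cm adj_incl[OF A] u
          by (intro low[of r' "coeff P n ^ m * u"] subringD[OF S]) auto
        then show ?thesis using Z_iff[OF *(4)] by simp
      qed
      then have "coeff P n ^ m \<in> Z" using rZ cm AR rA y
        by (meson Z_prime poly_R cpoly_mono subsetD)
      then show False using Z_power P' AR by blast
    qed
    have lZ: "coeff r d \<notin> Z"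
    proof
      assume lZ: "coeff r d \<in> Z"
      define s where "s = r - monom (coeff r d) d"
      have sA: "cpoly A s" unfolding s_def by (intro cpoly_arith A rA cpolyD)
      have m: "poly (monom (coeff r d) d) y \<in> Z"
        by (auto simp: poly_monom intro!: Z_mult' lZ subring_power[OF R] y)
      have "f * u - poly s y = (f * u - poly r y) + poly (monom (coeff r d) d) y"
        by (simp add: s_def)
      also have "\<dots> \<in> Z" by (intro Z_add u m)
      finally have "poly s y \<in> Z"
        using u sA by (intro low[of s u]) (auto simp: s_def d_def coeff_eq_0)
      then have "poly r y \<in> Z" using Z_add[OF _ m, of "poly s y"] by (simp add: s_def)
      then show False using rZ by simp
    qed
    \<comment> \<open>Irreducibility of P enters here. The remainder of P modulo r is again a
      multiple of f modulo \<open>Z\<close>, hence in \<open>Z\<close> at y, and so q(y) is in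
      \<open>Z\<close>. As q has degree below n, minimality of P puts its coefficients in
      \<open>Z\<close>; comparing coefficients at n then contradicts that both leading coefficients
      are outside \<open>Z\<close>.\<close>
    obtain m q s where *: "smult (coeff r d ^ m) P = r * q + s" "cpoly A q" "cpoly A s"
      "\<forall>i\<ge>d. coeff s i = 0" "\<forall>i. degree P < i + d \<longrightarrow> coeff q i = 0"
      using pseudo_division[OF A rA P'(2), of d] d_def by blast
    have e: "coeff r d ^ m * poly P y = poly r y * poly q y + poly s y"
      by (metis "*"(1) poly_add poly_mult poly_smult)
    have lm: "coeff r d ^ m \<in> R" using AR by (intro subring_power R) (use cpolyD[OF rA] in blast)
    have qR: "poly q y \<in> R" and rR: "poly r y \<in> R" by (intro poly_R y cpoly_mono[OF AR] * rA)+
    have "f * (- u * poly q y) - poly s y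
        = (- poly q y) * (f * u - poly r y) - coeff r d ^ m * poly P y"
      unfolding e by (simp add: algebra_simps)
    also have "\<dots> \<in> Z" by (intro Z_diff Z_mult u P' lm subringD(5)[OF R] qR)
    finally have sZ: "poly s y \<in> Z"
      using * u adjp by (intro low[of s "- u * poly q y"] subringD(4,5)[OF S]) auto
    have "poly r y * poly q y = coeff r d ^ m * poly P y - poly s y" using e by simp
    also have "\<dots> \<in> Z" by (intro Z_diff sZ Z_mult P' lm)
    finally have "poly q y \<in> Z" using rZ Z_prime[OF rR qR] by blast
    then have "cpoly Z q" using * P'(3) False by (intro P'(6)) auto
    then have "coeff (r * q + s) n \<in> Z" using *(4) dn cpoly_mono[OF AR rA]
      by (auto simp: coeff_mult cpoly_def intro!: Z_add Z_sum Z_mult Z0)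
    then have "coeff r d ^ m * coeff P n \<in> Z" by (metis *(1) coeff_smult)
    then have "coeff r d ^ m \<in> Z" using P' AR lm Z_prime by blast
    then show ?thesis using lZ Z_power cpolyD[OF rA] AR by blast
  qed
qed

end

end

end

section \<open>Extension of homomorphisms\<close>

text \<open>Vanishing on \<open>Z \<inter> A\<close> makes \<phi> a homomorphism on the image of
  \<open>A\<close> modulo \<open>Z\<close>.\<close>

definition ring_hom_on :: "'r::comm_ring_1 set \<Rightarrow> 'r set \<Rightarrow> ('r \<Rightarrow> 'k::field) \<Rightarrow> bool" where
  "ring_hom_on A Z \<phi> \<longleftrightarrow> \<phi> 1 = 1 \<and> (\<forall>x\<in>A. \<forall>y\<in>A. \<phi> (x + y) = \<phi> x + \<phi> y \<and> \<phi> (x * y) = \<phi> x * \<phi> y) \<and>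
     (\<forall>z\<in>Z \<inter> A. \<phi> z = 0)"

text \<open>The formal derivative, given by its coefficients because rings of functions have zero
  divisors.\<close>

definition dpoly :: "'r::comm_ring_1 poly \<Rightarrow> 'r poly" where
  "dpoly P = Poly (map (\<lambda>i. of_nat (Suc i) * coeff P (Suc i)) [0..<degree P])"

lemma coeff_dpoly: "coeff (dpoly P) i = of_nat (Suc i) * coeff P (Suc i)"
  by (cases "i < degree P")
    (auto simp: dpoly_def nth_default_def coeff_eq_0 simp del: of_nat_Suc)

lemma subring_of_nat: "subring A \<Longrightarrow> of_nat n \<in> A"
  by (induction n) (auto intro: subringD)

lemma cpoly_dpoly: "subring A \<Longrightarrow> cpoly A P \<Longrightarrow> cpoly A (dpoly P)"
  by (auto simp: cpoly_def coeff_dpoly simp del: of_nat_Suc intro!: subringD(4) subring_of_nat)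

text \<open>After a root a is split off, simplicity keeps a from being a root of the cofactor, so
  every step of the induction adds a new root.\<close>

lemma card_simple_roots:
  fixes p :: "'k::field poly"
  assumes "alg_closed_field TYPE('k)" "p \<noteq> 0"
    and "\<And>x. poly p x = 0 \<Longrightarrow> poly (pderiv p) x \<noteq> 0"
  shows "card {x. poly p x = 0} = degree p"
  using assms(2,3)
proof (induction "degree p" arbitrary: p)
  case 0
  then show ?case by (auto elim!: degree_eq_zeroE)
next
  case (Suc n)
  then obtain a where a: "poly p a = 0" using assms(1) unfolding alg_closed_field_def
    by (metis Suc_leI zero_less_Suc One_nat_def)
  then obtain q where p: "p = [:-a, 1:] * q" by (meson dvd_def poly_eq_0_iff_dvd)
  have q0: "q \<noteq> 0" using Suc.prems p by auto
  have der: "pderiv p = [:-a,1:] * pderiv q + q"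
    unfolding p by (subst pderiv_mult) (simp add: pderiv_pCons)
  have dq: "degree p = Suc (degree q)" unfolding p using q0 by (subst degree_mult_eq) auto
  have "poly q a \<noteq> 0" using Suc.prems(2)[OF a] der by simp
  moreover have "poly (pderiv q) x \<noteq> 0" if "poly q x = 0" for x
    using Suc.prems(2)[of x] that p der by auto
  ultimately have "card {x. poly q x = 0} = degree q" "poly q a \<noteq> 0"
    using Suc.hyps(1)[of q] Suc.hyps(2) q0 dq by auto
  moreover have "{x. poly p x = 0} = insert a {x. poly q x = 0}" unfolding p by auto
  ultimately show ?case using dq poly_roots_finite[OF q0] by simp
qed

lemma ring_hom_onD:
  assumes "subring A" "ring_hom_on A Z \<phi>"
  shows "\<phi> 1 = 1" "\<phi> 0 = 0" "\<And>x y. x \<in> A \<Longrightarrow> y \<in> A \<Longrightarrow> \<phi> (x + y) = \<phi> x + \<phi> y"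
    "\<And>x y. x \<in> A \<Longrightarrow> y \<in> A \<Longrightarrow> \<phi> (x * y) = \<phi> x * \<phi> y"
    "\<And>x y. x \<in> A \<Longrightarrow> y \<in> A \<Longrightarrow> \<phi> (x - y) = \<phi> x - \<phi> y"
    "\<And>z. z \<in> Z \<Longrightarrow> z \<in> A \<Longrightarrow> \<phi> z = 0"
    "\<And>n x. x \<in> A \<Longrightarrow> \<phi> (x ^ n) = \<phi> x ^ n"
    "\<And>n. \<phi> (of_nat n) = of_nat n"
    "\<And>I f. (\<And>i. i \<in> I \<Longrightarrow> f i \<in> A) \<Longrightarrow> \<phi> (sum f I) = (\<Sum>i\<in>I. \<phi> (f i))"
proof -
  note S = subringD[OF assms(1)]
  show 1: "\<phi> 1 = 1" and add: "\<And>x y. x \<in> A \<Longrightarrow> y \<in> A \<Longrightarrow> \<phi> (x + y) = \<phi> x + \<phi> y"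
    and mult: "\<And>x y. x \<in> A \<Longrightarrow> y \<in> A \<Longrightarrow> \<phi> (x * y) = \<phi> x * \<phi> y"
    and "\<And>z. z \<in> Z \<Longrightarrow> z \<in> A \<Longrightarrow> \<phi> z = 0"
    using assms(2) by (auto simp: ring_hom_on_def)
  show 0: "\<phi> 0 = 0" using add[OF S(2) S(2)]
    by (metis add_cancel_right_right)
  show "\<phi> (x - y) = \<phi> x - \<phi> y" if "x \<in> A" "y \<in> A" for x y
    using add[OF S(3)[OF that] that(2)] by simp
  show "\<phi> (x ^ n) = \<phi> x ^ n" if "x \<in> A" for n x
    by (induction n) (auto simp: 1 mult that subring_power[OF assms(1) that])
  show "\<phi> (of_nat n) = of_nat n" for n
    by (induction n) (auto simp: 0 1 add S subring_of_nat[OF assms(1)])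
  show "\<phi> (sum f I) = (\<Sum>i\<in>I. \<phi> (f i))" if "\<And>i. i \<in> I \<Longrightarrow> f i \<in> A" for I and f :: "_ \<Rightarrow> 'a"
    using that by (induction I rule: infinite_finite_induct)
      (auto simp: 0 add subring_sum[OF assms(1)])
qed

lemma map_poly_hom:
  assumes "subring A" "ring_hom_on A Z \<phi>" "cpoly A p" "cpoly A q"
  shows "map_poly \<phi> (p + q) = map_poly \<phi> p + map_poly \<phi> q"
    "map_poly \<phi> (p - q) = map_poly \<phi> p - map_poly \<phi> q"
    "map_poly \<phi> (p * q) = map_poly \<phi> p * map_poly \<phi> q"
    "c \<in> A \<Longrightarrow> map_poly \<phi> (smult c p) = smult (\<phi> c) (map_poly \<phi> p)"
    "map_poly \<phi> (dpoly p) = pderiv (map_poly \<phi> p)"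
  by (intro poly_eqI; simp add: coeff_map_poly coeff_mult coeff_dpoly coeff_pderiv
        ring_hom_onD[OF assms(1,2)] cpolyD[OF assms(3)] cpolyD[OF assms(4)] subringD[OF assms(1)]
        subring_of_nat[OF assms(1)] del: of_nat_Suc)+

text \<open>Two polynomials representing the same element of A[y] differ by a relation of y. The
  hypothesis says that \<xi> satisfies the image of every such relation, so evaluation at \<xi> is
  well defined on A[y].\<close>

lemma hom_extension:
  assumes A: "subring A" and \<phi>: "ring_hom_on A Z \<phi>"
    and \<xi>: "\<And>g. cpoly A g \<Longrightarrow> poly g y \<in> Z \<Longrightarrow> poly (map_poly \<phi> g) \<xi> = 0" and Z0: "0 \<in> Z"
  shows "\<exists>\<phi>'. ring_hom_on (adj A y) Z \<phi>' \<and> (\<forall>x\<in>A. \<phi>' x = \<phi> x) \<and>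
    (\<forall>g. cpoly A g \<longrightarrow> \<phi>' (poly g y) = poly (map_poly \<phi> g) \<xi>)"
proof -
  define \<phi>' where "\<phi>' x = poly (map_poly \<phi> (SOME p. cpoly A p \<and> x = poly p y)) \<xi>" for x
  have eq: "\<phi>' (poly g y) = poly (map_poly \<phi> g) \<xi>" if g: "cpoly A g" for g
  proof -
    let ?p = "SOME p. cpoly A p \<and> poly g y = poly p y"
    have p: "cpoly A ?p \<and> poly g y = poly ?p y" by (rule someI) (use g in auto)
    then have "poly (map_poly \<phi> (g - ?p)) \<xi> = 0"
      by (intro \<xi> cpoly_arith A g) (auto simp: Z0)
    then show ?thesis unfolding \<phi>'_def using p g by (simp add: map_poly_hom[OF A \<phi>])
  qed
  have "\<phi>' x = \<phi> x" if "x \<in> A" for x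
  proof -
    have "cpoly A [:x:]" by (intro cpoly_arith A that)
    from eq[OF this] show ?thesis by (simp add: map_poly_pCons ring_hom_onD[OF A \<phi>])
  qed
  moreover have "ring_hom_on (adj A y) Z \<phi>'"
    unfolding ring_hom_on_def
  proof (intro conjI ballI)
    show "\<phi>' 1 = 1" using eq[of 1] A \<phi> by (simp add: cpoly_arith ring_hom_onD)
    fix x x' assume "x \<in> adj A y" "x' \<in> adj A y"
    then obtain p q where p: "cpoly A p" "x = poly p y" and q: "cpoly A q" "x' = poly q y"
      by (auto simp: adj_def)
    show "\<phi>' (x + x') = \<phi>' x + \<phi>' x'" "\<phi>' (x * x') = \<phi>' x * \<phi>' x'"
      using eq[OF cpoly_arith(3)[OF A p(1) q(1)]] eq[OF cpoly_arith(5)[OF A p(1) q(1)]]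
      by (simp_all add: p q eq map_poly_hom[OF A \<phi> p(1) q(1)])
  next
    fix z assume "z \<in> Z \<inter> adj A y"
    then show "\<phi>' z = 0" using \<xi> eq by (auto simp: adj_def)
  qed
  ultimately show ?thesis using eq by blast
qed

context prime_ideal
begin

lemma extend_transcendental:
  assumes A: "subring A" and y: "\<not> algebraic A y" and \<phi>: "ring_hom_on A Z \<phi>"
  shows "\<exists>\<phi>'. ring_hom_on (adj A y) Z \<phi>' \<and> (\<forall>x\<in>A. \<phi>' x = \<phi> x) \<and>
    (\<forall>g. cpoly A g \<longrightarrow> \<phi>' (poly g y) = poly (map_poly \<phi> g) \<xi>)"
proof (rule hom_extension[OF A \<phi> _ Z0])
  fix g assume g: "cpoly A g" "poly g y \<in> Z"
  then have "cpoly Z g" using y by (auto simp: algebraic_def)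
  then have "map_poly \<phi> g = 0"
    using g ring_hom_onD[OF A \<phi>] by (intro poly_eqI) (auto simp: coeff_map_poly cpoly_def)
  then show "poly (map_poly \<phi> g) \<xi> = 0" by simp
qed

text \<open>Every relation g of y is, up to a power of the leading coefficient, a multiple of P plus
  a remainder whose coefficients are in \<open>Z\<close> and are killed by \<phi>. Hence a root of
  the image of P is a root of the image of g, once \<phi> does not kill that leading
  coefficient.\<close>

lemma extend_algebraic:
  fixes \<phi> :: "'r \<Rightarrow> 'k::field"
  assumes A: "subring A" "A \<subseteq> R" and y: "y \<in> R" and P: "minpol A y n P" and \<phi>: "ring_hom_on A Z \<phi>"
    and c: "\<phi> (coeff P n) \<noteq> 0" and \<xi>: "poly (map_poly \<phi> P) \<xi> = 0"
  shows "\<exists>\<phi>'. ring_hom_on (adj A y) Z \<phi>' \<and> (\<forall>x\<in>A. \<phi>' x = \<phi> x) \<and>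
    (\<forall>g. cpoly A g \<longrightarrow> \<phi>' (poly g y) = poly (map_poly \<phi> g) \<xi>)"
proof (rule hom_extension[OF A(1) \<phi> _ Z0])
  fix g assume g: "cpoly A g" "poly g y \<in> Z"
  note P' = P'[OF A y P]
  obtain m q r where *: "smult (coeff P n ^ m) g = P * q + r" "cpoly A q" "cpoly A r"
     "\<forall>i\<ge>n. coeff r i = 0" "coeff P n ^ m * poly g y - poly r y \<in> Z"
    using minpol_reduce[OF A y P g(1)] by blast
  have cm: "coeff P n ^ m \<in> A" by (intro subring_power A P')
  have "poly r y \<in> Z" using Z_iff[OF *(5)] Z_mult[OF _ g(2)] cm A by blast
  then have "cpoly Z r" using * P' by blast
  then have r0: "map_poly \<phi> r = 0"
    using * ring_hom_onD[OF A(1) \<phi>] by (intro poly_eqI) (auto simp: coeff_map_poly cpoly_def)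
  have "smult (\<phi> (coeff P n) ^ m) (map_poly \<phi> g) = map_poly \<phi> (P * q + r)"
    unfolding *(1)[symmetric] by (simp add: map_poly_hom(4)[OF A(1) \<phi> g(1) g(1) cm] ring_hom_onD[OF A(1) \<phi>] P')
  also have "\<dots> = map_poly \<phi> P * map_poly \<phi> q"
    using r0 by (simp add: map_poly_hom[OF A(1) \<phi>] * P' cpoly_arith[OF A(1)])
  finally have "poly (smult (\<phi> (coeff P n) ^ m) (map_poly \<phi> g)) \<xi> = 0" using \<xi> by simp
  then show "poly (map_poly \<phi> g) \<xi> = 0" using c by simp
qed

text \<open>Take h as the leading coefficient of P times the norm of f P'(y). If \<phi> h is
  nonzero, the image of P keeps degree n, and at each of its roots neither the derivative nor f
  vanishes. So there are n distinct roots, each giving an extension that is nonzero at f.\<close>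

lemma extend_step:
  assumes ac: "alg_closed_field TYPE('k::field_char_0)"
    and A: "subring A" "A \<subseteq> R" and y: "y \<in> R" and P: "minpol A y n P"
    and char: "\<And>k. k > 0 \<Longrightarrow> of_nat k \<notin> Z"
    and f: "f \<in> adj A y" "f \<notin> Z"
  shows "\<exists>h\<in>A. h \<notin> Z \<and> (\<forall>\<phi>::'r \<Rightarrow> 'k. ring_hom_on A Z \<phi> \<and> \<phi> h \<noteq> 0 \<longrightarrow>
    (\<exists>\<Xi>::nat \<Rightarrow> 'k. inj_on \<Xi> {..<n} \<and> (\<forall>i<n. \<exists>\<phi>'. ring_hom_on (adj A y) Z \<phi>' \<and>
       (\<forall>x\<in>A. \<phi>' x = \<phi> x) \<and> \<phi>' y = \<Xi> i \<and> \<phi>' f \<noteq> 0)))"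
proof -
  note P' = P'[OF A y P]
  note S = adj_subring[OF A(1), of y]
  have SR: "adj A y \<subseteq> R" by (rule adj_least[OF A(1) R A(2) y])
  let ?c = "coeff P n"
  have d: "cpoly A (dpoly P)" by (intro cpoly_dpoly A P')
  \<comment> \<open>Separability: P' has degree below n, so by minimality its value lies in
    \<open>Z\<close> only if n times the leading coefficient does, which characteristic zero
    excludes.\<close>
  have dZ: "poly (dpoly P) y \<notin> Z"
  proof
    assume "poly (dpoly P) y \<in> Z"
    then have "cpoly Z (dpoly P)"
      using d P'(3) by (intro P'(6)) (auto simp: coeff_dpoly coeff_eq_0 simp del: of_nat_Suc)
    then have "of_nat n * ?c \<in> Z" using P'(1) by (auto simp: cpoly_def coeff_dpoly dest!: spec[of _ "n - 1"])
    then show False using char[of n] P' Z_prime[OF subring_of_nat[OF R], of ?c n] A by auto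
  qed
  have dA: "poly (dpoly P) y \<in> adj A y" using d by (auto simp: adj_def)
  define f1 where "f1 = f * poly (dpoly P) y"
  have f1: "f1 \<in> adj A y" "f1 \<notin> Z"
    unfolding f1_def using f dZ dA SR subringD(4)[OF S] Z_prime by blast+
  obtain u h0 where u: "u \<in> adj A y" and h0: "h0 \<in> A" "h0 \<notin> Z" "f1 * u - h0 \<in> Z"
    using minpol_norm[OF A y P f1] by blast
  define h where "h = h0 * ?c"
  have h: "h \<in> A" "h \<notin> Z" unfolding h_def using h0 P' A Z_prime subringD(4)[OF A(1)] by blast+
  show ?thesis
  proof (intro bexI[of _ h] conjI h allI impI, elim conjE)
    fix \<phi> :: "'r \<Rightarrow> 'k" assume \<phi>: "ring_hom_on A Z \<phi>" "\<phi> h \<noteq> 0"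
    note H = ring_hom_onD[OF A(1) \<phi>(1)]
    have c: "\<phi> ?c \<noteq> 0" and h0': "\<phi> h0 \<noteq> 0" using \<phi>(2) H h0 P' unfolding h_def by auto
    let ?p = "map_poly \<phi> P"
    have degp: "degree ?p = n"
    proof (rule antisym)
      show "degree ?p \<le> n" by (rule degree_le) (use P'(3) H in \<open>auto simp: coeff_map_poly coeff_eq_0\<close>)
      show "n \<le> degree ?p" by (rule le_degree) (simp add: coeff_map_poly H c)
    qed
    have ext: "\<exists>\<phi>'. ring_hom_on (adj A y) Z \<phi>' \<and> (\<forall>x\<in>A. \<phi>' x = \<phi> x) \<and> \<phi>' y = \<xi> \<and> \<phi>' f \<noteq> 0
      \<and> poly (pderiv ?p) \<xi> \<noteq> 0"
      if \<xi>: "poly ?p \<xi> = 0" for \<xi>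
    proof -
      obtain \<phi>' where \<phi>': "ring_hom_on (adj A y) Z \<phi>'" "\<And>x. x \<in> A \<Longrightarrow> \<phi>' x = \<phi> x"
        "\<And>g. cpoly A g \<Longrightarrow> \<phi>' (poly g y) = poly (map_poly \<phi> g) \<xi>"
        using extend_algebraic[OF A y P \<phi>(1) c \<xi>] by blast
      note H' = ring_hom_onD[OF S \<phi>'(1)]
      have "\<phi>' (f1 * u - h0) = 0" using h0 adj_incl[OF A(1)] by (intro H' subringD[OF S] f1 u) auto
      moreover have "\<phi>' (f1 * u - h0) = \<phi>' f1 * \<phi>' u - \<phi> h0"
        using h0 adj_incl[OF A(1), of y] \<phi>'(2)[OF h0(1)]
        by (subst H') (auto intro!: subringD[OF S] f1 u simp: H'(4)[OF f1(1) u])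
      ultimately have "\<phi>' f1 \<noteq> 0" using h0' by auto
      then have "\<phi>' f \<noteq> 0" "\<phi>' (poly (dpoly P) y) \<noteq> 0" unfolding f1_def using H'(4)[OF f(1) dA] by auto
      moreover have "\<phi>' y = \<xi>"
      proof -
        have "cpoly A [:0,1:]" by (intro cpoly_arith subringD A)
        from \<phi>'(3)[OF this] show ?thesis by (simp add: map_poly_pCons H)
      qed
      ultimately show ?thesis using \<phi>' d map_poly_hom(5)[OF A(1) \<phi>(1) P'(2) P'(2)] by metis
    qed
    have "?p \<noteq> 0" using degp P'(1) by auto
    then have "card {x. poly ?p x = 0} = n" "finite {x. poly ?p x = 0}"
      using card_simple_roots[OF ac, of ?p] degp ext poly_roots_finite by blast+
    then obtain \<Xi> where \<Xi>: "bij_betw \<Xi> {..<n} {x. poly ?p x = 0}"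
      using ex_bij_betw_nat_finite[of "{x. poly ?p x = 0}"] by (auto simp: atLeast0LessThan)
    then have "poly ?p (\<Xi> i) = 0" if "i < n" for i using that bij_betwE by fastforce
    then show "\<exists>\<Xi>::nat \<Rightarrow> 'k. inj_on \<Xi> {..<n} \<and> (\<forall>i<n. \<exists>\<phi>'. ring_hom_on (adj A y) Z \<phi>' \<and>
       (\<forall>x\<in>A. \<phi>' x = \<phi> x) \<and> \<phi>' y = \<Xi> i \<and> \<phi>' f \<noteq> 0)"
      using \<Xi> ext by (intro exI[of _ \<Xi>] conjI) (auto simp: bij_betw_def, metis)
  qed
qed

text \<open>Induction over the generators; the obstruction h found for the upper layer becomes the
  element to be kept nonzero in the layer below. At an algebraic y \<open>extend_step\<close>
  applies. At a transcendental y write this element as g(y): if \<phi> keeps one coefficient of g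
  nonzero, the image of g is a nonzero polynomial and y may be sent to a non-root.\<close>

lemma extension_theorem:
  assumes ac: "alg_closed_field TYPE('k::field_char_0)"
    and char: "\<And>k. k > 0 \<Longrightarrow> of_nat k \<notin> Z"
  shows "subring A \<Longrightarrow> A \<subseteq> R \<Longrightarrow> set ys \<subseteq> R \<Longrightarrow> f \<in> adjs A ys \<Longrightarrow> f \<notin> Z \<Longrightarrow>
    \<exists>h\<in>A. h \<notin> Z \<and> (\<forall>\<phi>::'r \<Rightarrow> 'k. ring_hom_on A Z \<phi> \<and> \<phi> h \<noteq> 0 \<longrightarrow>
    (\<exists>\<phi>'. ring_hom_on (adjs A ys) Z \<phi>' \<and> (\<forall>x\<in>A. \<phi>' x = \<phi> x) \<and> \<phi>' f \<noteq> 0))"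
proof (induction ys arbitrary: A)
  case Nil
  then show ?case by auto
next
  case (Cons y ys)
  note A = Cons.prems(1,2)
  have y: "y \<in> R" using Cons.prems by auto
  note S = adj_subring[OF A(1), of y]
  have SR: "adj A y \<subseteq> R" by (rule adj_least[OF A(1) R A(2) y])
  obtain h1 where h1: "h1 \<in> adj A y" "h1 \<notin> Z"
    "\<And>\<phi>::'r \<Rightarrow> 'k. ring_hom_on (adj A y) Z \<phi> \<and> \<phi> h1 \<noteq> 0 \<Longrightarrow>
    (\<exists>\<phi>'. ring_hom_on (adjs A (y # ys)) Z \<phi>' \<and> (\<forall>x\<in>adj A y. \<phi>' x = \<phi> x) \<and> \<phi>' f \<noteq> 0)"
    using Cons.IH[OF S SR] Cons.prems by auto
  have "\<exists>h\<in>A. h \<notin> Z \<and> (\<forall>\<phi>::'r \<Rightarrow> 'k. ring_hom_on A Z \<phi> \<and> \<phi> h \<noteq> 0 \<longrightarrow>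
    (\<exists>\<phi>'. ring_hom_on (adj A y) Z \<phi>' \<and> (\<forall>x\<in>A. \<phi>' x = \<phi> x) \<and> \<phi>' h1 \<noteq> 0))"
  proof (cases "algebraic A y")
    case True
    then obtain n P where P: "minpol A y n P" using minpol_exists[OF A y] by blast
    have n: "0 < n" using P'(1)[OF A y P] by simp
    from extend_step[OF ac A y P char h1(1,2)] show ?thesis using n by blast
  next
    case False
    obtain g where g: "cpoly A g" "h1 = poly g y" using h1(1) by (auto simp: adj_def)
    then obtain i where i: "coeff g i \<notin> Z" using poly_Z[of g y] h1(2) y by (auto simp: cpoly_def)
    show ?thesis
    proof (intro bexI[of _ "coeff g i"] conjI i cpolyD g allI impI, elim conjE)
      fix \<phi> :: "'r \<Rightarrow> 'k" assume \<phi>: "ring_hom_on A Z \<phi>" "\<phi> (coeff g i) \<noteq> 0"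
      have "coeff (map_poly \<phi> g) i \<noteq> 0"
        using \<phi> ring_hom_onD[OF A(1) \<phi>(1)] by (simp add: coeff_map_poly)
      then have "map_poly \<phi> g \<noteq> 0" by auto
      then obtain \<xi> where \<xi>: "poly (map_poly \<phi> g) \<xi> \<noteq> 0"
        using poly_all_0_iff_0 by blast
      show "\<exists>\<phi>'. ring_hom_on (adj A y) Z \<phi>' \<and> (\<forall>x\<in>A. \<phi>' x = \<phi> x) \<and> \<phi>' h1 \<noteq> 0"
        using extend_transcendental[OF A(1) False \<phi>(1), of \<xi>] g \<xi> by metis
    qed
  qed
  then obtain h where h: "h \<in> A" "h \<notin> Z" "\<And>\<phi>::'r \<Rightarrow> 'k. ring_hom_on A Z \<phi> \<and> \<phi> h \<noteq> 0 \<Longrightarrow>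
    (\<exists>\<phi>'. ring_hom_on (adj A y) Z \<phi>' \<and> (\<forall>x\<in>A. \<phi>' x = \<phi> x) \<and> \<phi>' h1 \<noteq> 0)" by blast
  show ?case
  proof (intro bexI[of _ h] conjI h(1,2) allI impI)
    fix \<phi> :: "'r \<Rightarrow> 'k" assume "ring_hom_on A Z \<phi> \<and> \<phi> h \<noteq> 0"
    then obtain \<phi>1 where \<phi>1: "ring_hom_on (adj A y) Z \<phi>1" "\<forall>x\<in>A. \<phi>1 x = \<phi> x" "\<phi>1 h1 \<noteq> 0"
      using h(3) by blast
    then obtain \<phi>' where "ring_hom_on (adjs A (y # ys)) Z \<phi>'" "\<forall>x\<in>adj A y. \<phi>' x = \<phi>1 x" "\<phi>' f \<noteq> 0"
      using h1(3)[of \<phi>1] by blast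
    then show "\<exists>\<phi>'. ring_hom_on (adjs A (y # ys)) Z \<phi>' \<and> (\<forall>x\<in>A. \<phi>' x = \<phi> x) \<and> \<phi>' f \<noteq> 0"
      using \<phi>1(2) adj_incl[OF A(1), of y] by (metis subsetD)
  qed
qed

end

section \<open>Towers of algebraic extensions\<close>

context prime_ideal
begin

text \<open>Every r_k reduces to degree below n in y after multiplication by a power of the leading
  coefficient of P; the product of these powers over the finite set \<open>K\<close> serves all
  k.\<close>

lemma common_denominator:
  assumes A: "subring A" "A \<subseteq> R" and y: "y \<in> R" and P: "minpol A y n P"
    and K: "finite K" "\<And>k. k \<in> K \<Longrightarrow> r k \<in> adj A y"
  shows "\<exists>C\<in>A. C \<notin> Z \<and> (\<exists>s. \<forall>k\<in>K. (\<forall>i<n. s k i \<in> A) \<and> C * r k - (\<Sum>i<n. s k i * y ^ i) \<in> Z)"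
  using K
proof (induction K)
  case empty
  then show ?case using subringD[OF A(1)] Z1 by auto
next
  case (insert k K)
  note P' = P'[OF A y P]
  obtain C s where C: "C \<in> A" "C \<notin> Z"
    "\<And>k. k \<in> K \<Longrightarrow> (\<forall>i<n. s k i \<in> A) \<and> C * r k - (\<Sum>i<n. s k i * y ^ i) \<in> Z"
    using insert by auto blast
  obtain g where g: "cpoly A g" "r k = poly g y" using insert.prems by (auto simp: adj_def)
  obtain m q t where t: "cpoly A t" "\<forall>i\<ge>n. coeff t i = 0" "coeff P n ^ m * poly g y - poly t y \<in> Z"
    using minpol_reduce[OF A y P g(1)] by blast
  define c where "c = coeff P n ^ m"
  have c: "c \<in> A" "c \<notin> Z" unfolding c_def
    using P' A Z_power subring_power[OF A(1)] by blast+
  have ty: "poly t y = (\<Sum>i<n. coeff t i * y ^ i)"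
  proof -
    have "degree t < n" using P'(1) t(2)
      by (metis degree_0 leading_coeff_0_iff not_le One_nat_def less_le_trans zero_less_one)
    then show ?thesis unfolding poly_altdef by (intro sum.mono_neutral_left) (auto simp: coeff_eq_0)
  qed
  define s' where "s' l i = (if l = k then C * coeff t i else c * s l i)" for l i
  have s': "(\<forall>i<n. s' l i \<in> A) \<and> (c * C) * r l - (\<Sum>i<n. s' l i * y ^ i) \<in> Z" if l: "l \<in> insert k K" for l
  proof (cases "l = k")
    case True
    have "(c * C) * r l - (\<Sum>i<n. s' l i * y ^ i) = C * (c * poly g y - poly t y)"
      using True g by (simp add: s'_def ty sum_distrib_left algebra_simps)
    also have "\<dots> \<in> Z" using C t A by (intro Z_mult) (auto simp: c_def)
    finally show ?thesis using True C cpolyD[OF t(1)] subringD(4)[OF A(1)] by (auto simp: s'_def)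
  next
    case False
    then have *: "(\<forall>i<n. s l i \<in> A) \<and> C * r l - (\<Sum>i<n. s l i * y ^ i) \<in> Z" using C l by auto
    have "(c * C) * r l - (\<Sum>i<n. s' l i * y ^ i) = c * (C * r l - (\<Sum>i<n. s l i * y ^ i))"
      using False by (simp add: s'_def sum_distrib_left algebra_simps)
    also have "\<dots> \<in> Z" using * c A by (intro Z_mult) auto
    finally show ?thesis using False * c subringD(4)[OF A(1)] by (auto simp: s'_def)
  qed
  have cC: "c * C \<in> A" "c * C \<notin> Z"
    using c C(1,2) A Z_prime[of c C] subringD(4)[OF A(1), of c C] by blast+
  show ?case
  proof (rule bexI[of _ "c * C"], intro conjI)
    show "\<exists>s. \<forall>k\<in>insert k K. (\<forall>i<n. s k i \<in> A) \<and> (c * C) * r k - (\<Sum>i<n. s k i * y ^ i) \<in> Z"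
    proof (rule exI[of _ s'], rule ballI)
      fix l assume "l \<in> insert k K"
      then show "(\<forall>i<n. s' l i \<in> A) \<and> (c * C) * r l - (\<Sum>i<n. s' l i * y ^ i) \<in> Z" by (rule s')
    qed
  qed (rule cC)+
qed

text \<open>
  An index [i_1, ..., i_r] stands both for the basis element y_1^i_1 ... y_r^i_r of the tower
  A[y_1, ..., y_r] and for the choice of the i_j-th root of the j-th minimal polynomial.
\<close>

definition spans_over :: "'r set \<Rightarrow> 'r set \<Rightarrow> nat list set \<Rightarrow> (nat list \<Rightarrow> 'r) \<Rightarrow> bool" where
  "spans_over A B K e \<longleftrightarrow> (\<forall>f\<in>B. \<exists>H\<in>A. H \<notin> Z \<and>
     (\<exists>r. (\<forall>k\<in>K. r k \<in> A) \<and> H * f - (\<Sum>k\<in>K. r k * e k) \<in> Z))"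

definition extensions :: "'r set \<Rightarrow> 'r set \<Rightarrow> nat list set \<Rightarrow> 'r \<Rightarrow> ('r \<Rightarrow> 'k::field) \<Rightarrow> (nat list \<Rightarrow> 'r \<Rightarrow> 'k) \<Rightarrow> bool" where
  "extensions A B K f \<phi> \<Phi> \<longleftrightarrow>
     (\<forall>k\<in>K. ring_hom_on B Z (\<Phi> k) \<and> (\<forall>x\<in>A. \<Phi> k x = \<phi> x) \<and> \<Phi> k f \<noteq> 0) \<and>
     (\<forall>k\<in>K. \<forall>l\<in>K. (\<forall>x\<in>B. \<Phi> k x = \<Phi> l x) \<longrightarrow> k = l)"

text \<open>One set \<open>K\<close>, made of lists of indices below the successive degrees, counts
  both a spanning family over the fractions of \<open>A\<close> and distinct extensions of a general
  \<phi>. This equality of counts replaces the theorem that a general fibre has as many points as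
  the degree of the function field.\<close>

lemma tower:
  assumes ac: "alg_closed_field TYPE('k::field_char_0)"
    and char: "\<forall>k>0. of_nat k \<notin> Z"
  shows "subring A \<Longrightarrow> A \<subseteq> R \<Longrightarrow> set ys \<subseteq> R \<Longrightarrow> \<forall>y\<in>set ys. algebraic A y \<Longrightarrow>
    \<exists>K e. finite K \<and> (\<forall>k\<in>K. e k \<in> R) \<and> spans_over A (adjs A ys) K e \<and>
      (\<forall>f\<in>adjs A ys. f \<notin> Z \<longrightarrow> (\<exists>h\<in>A. h \<notin> Z \<and> (\<forall>\<phi>::'r \<Rightarrow> 'k. ring_hom_on A Z \<phi> \<and> \<phi> h \<noteq> 0 \<longrightarrow>
        (\<exists>\<Phi>. extensions A (adjs A ys) K f \<phi> \<Phi>))))"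
proof (induction ys arbitrary: A)
  case Nil
  have "spans_over A A {[]} (\<lambda>_. 1)" unfolding spans_over_def
  proof
    fix f assume f: "f \<in> A"
    show "\<exists>H\<in>A. H \<notin> Z \<and> (\<exists>r. (\<forall>k\<in>{[]}. r k \<in> A) \<and> H * f - (\<Sum>k\<in>{[]}. r k * 1) \<in> Z)"
      using f subringD(1)[OF Nil(1)] Z1 Z0 by (intro bexI[of _ 1] conjI exI[of _ "\<lambda>_. f"]) auto
  qed
  moreover have "\<exists>h\<in>A. h \<notin> Z \<and> (\<forall>\<phi>::'r \<Rightarrow> 'k. ring_hom_on A Z \<phi> \<and> \<phi> h \<noteq> 0 \<longrightarrow>
    (\<exists>\<Phi>. extensions A A {[]} f \<phi> \<Phi>))" if "f \<in> A" "f \<notin> Z" for f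
  proof (intro bexI[of _ f] conjI allI impI that)
    fix \<phi> :: "'r \<Rightarrow> 'k" assume "ring_hom_on A Z \<phi> \<and> \<phi> f \<noteq> 0"
    then show "\<exists>\<Phi>. extensions A A {[]} f \<phi> \<Phi>" unfolding extensions_def
      by (intro exI[of _ "\<lambda>_. \<phi>"]) simp
  qed
  ultimately show ?case using subringD(1)[OF R] by (intro exI[of _ "{[]}"] exI[of _ "\<lambda>_. 1"]) simp
next
  case (Cons y ys)
  note A = Cons.prems(1,2)
  have y: "y \<in> R" using Cons.prems by auto
  note S = adj_subring[OF A(1), of y]
  have SR: "adj A y \<subseteq> R" by (rule adj_least[OF A(1) R A(2) y])
  obtain n P where P: "minpol A y n P" using minpol_exists[OF A y] Cons.prems(4) by auto
  have inc: "A \<subseteq> adj A y" by (rule adj_incl[OF A(1)])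
  have alg: "\<forall>z\<in>set ys. algebraic (adj A y) z"
    using Cons.prems(4) inc algebraic_mono by auto
  obtain K e where K: "finite K" "\<And>k. k \<in> K \<Longrightarrow> e k \<in> R"
    and K1: "spans_over (adj A y) (adjs (adj A y) ys) K e"
    and K2: "\<And>f. f \<in> adjs (adj A y) ys \<Longrightarrow> f \<notin> Z \<Longrightarrow> \<exists>h\<in>adj A y. h \<notin> Z \<and>
      (\<forall>\<phi>::'r \<Rightarrow> 'k. ring_hom_on (adj A y) Z \<phi> \<and> \<phi> h \<noteq> 0 \<longrightarrow>
        (\<exists>\<Phi>. extensions (adj A y) (adjs (adj A y) ys) K f \<phi> \<Phi>))"
  proof -
    have "set ys \<subseteq> R" using Cons.prems(3) by auto
    from Cons.IH[OF S SR this alg] show ?thesis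
      by (elim exE conjE) (rule that, assumption, blast, assumption, blast)
  qed
  define K' where "K' = (\<lambda>(i, k). i # k) ` ({..<n} \<times> K)"
  define e' where "e' k = y ^ hd k * e (tl k)" for k
  have sumK': "sum F K' = (\<Sum>k\<in>K. \<Sum>i<n. F (i # k))" for F :: "nat list \<Rightarrow> 'r"
  proof -
    have "sum F K' = (\<Sum>(i, k)\<in>{..<n} \<times> K. F (i # k))"
      unfolding K'_def by (subst sum.reindex) (auto simp: inj_on_def case_prod_unfold)
    also have "\<dots> = (\<Sum>i<n. \<Sum>k\<in>K. F (i # k))" by (rule sum.cartesian_product[symmetric])
    finally show ?thesis by (subst sum.swap)
  qed
  have "finite K'" "\<forall>k\<in>K'. e' k \<in> R"
    unfolding K'_def e'_def using K y by (auto intro!: subringD[OF R] subring_power[OF R])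
  moreover have "spans_over A (adjs (adj A y) ys) K' e'" unfolding spans_over_def
  proof
    fix f assume f: "f \<in> adjs (adj A y) ys"
    obtain H r where H: "H \<in> adj A y" "H \<notin> Z" and r: "\<And>k. k \<in> K \<Longrightarrow> r k \<in> adj A y"
      and Hr: "H * f - (\<Sum>k\<in>K. r k * e k) \<in> Z" using K1 f unfolding spans_over_def by blast
    \<comment> \<open>Denominators descend from A[y] to A in two moves: u turns the denominator
      \<open>H\<close> into its norm h, and \<open>C\<close> reduces the resulting coefficients to
      powers of y below n.\<close>
    obtain u h where u: "u \<in> adj A y" and h: "h \<in> A" "h \<notin> Z" "H * u - h \<in> Z"
      using minpol_norm[OF A y P H] by blast
    obtain C s where C: "C \<in> A" "C \<notin> Z"
      and s: "\<And>k. k \<in> K \<Longrightarrow> (\<forall>i<n. s k i \<in> A) \<and> C * (u * r k) - (\<Sum>i<n. s k i * y ^ i) \<in> Z"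
    proof -
      have "u * r k \<in> adj A y" if "k \<in> K" for k using r[OF that] u subringD(4)[OF S] by blast
      then show ?thesis using common_denominator[OF A y P K(1), of "\<lambda>k. u * r k"] that by blast
    qed
    have fR: "f \<in> R" using f adjs_least[OF A(1) R A(2) Cons.prems(3)] by auto
    have "C * h \<in> A" "C * h \<notin> Z" using C h A Z_prime subringD(4)[OF A(1)] by blast+
    moreover have "\<forall>k\<in>K'. s (tl k) (hd k) \<in> A" using s by (auto simp: K'_def)
    moreover have "C * h * f - (\<Sum>k\<in>K'. s (tl k) (hd k) * e' k) \<in> Z"
    proof -
      have "C * h * f - (\<Sum>k\<in>K'. s (tl k) (hd k) * e' k) =
        (- (C * f)) * (H * u - h) + (C * u) * (H * f - (\<Sum>k\<in>K. r k * e k))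
         + (\<Sum>k\<in>K. e k * (C * (u * r k) - (\<Sum>i<n. s k i * y ^ i)))"
        unfolding sumK' e'_def
        by (simp add: algebra_simps sum_distrib_left sum_subtractf)
      also have "\<dots> \<in> Z" using C h u s A inc SR fR K(2) Hr
        by (intro Z_add Z_mult Z_sum) (blast intro: subringD[OF R])+
      finally show ?thesis .
    qed
    ultimately show "\<exists>H\<in>A. H \<notin> Z \<and> (\<exists>r. (\<forall>k\<in>K'. r k \<in> A) \<and> H * f - (\<Sum>k\<in>K'. r k * e' k) \<in> Z)"
      by (intro bexI[of _ "C * h"] conjI exI[of _ "\<lambda>k. s (tl k) (hd k)"])
  qed
  moreover have "\<exists>h\<in>A. h \<notin> Z \<and> (\<forall>\<phi>::'r \<Rightarrow> 'k. ring_hom_on A Z \<phi> \<and> \<phi> h \<noteq> 0 \<longrightarrow>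
        (\<exists>\<Phi>. extensions A (adjs (adj A y) ys) K' f \<phi> \<Phi>))"
    if f: "f \<in> adjs (adj A y) ys" "f \<notin> Z" for f
  proof -
    obtain h1 where h1: "h1 \<in> adj A y" "h1 \<notin> Z"
      "\<And>\<phi>::'r \<Rightarrow> 'k. ring_hom_on (adj A y) Z \<phi> \<and> \<phi> h1 \<noteq> 0 \<Longrightarrow>
        (\<exists>\<Phi>. extensions (adj A y) (adjs (adj A y) ys) K f \<phi> \<Phi>)"
      using K2[OF f] by blast
    obtain h where h: "h \<in> A" "h \<notin> Z" "\<And>\<phi>::'r \<Rightarrow> 'k. ring_hom_on A Z \<phi> \<and> \<phi> h \<noteq> 0 \<Longrightarrow>
    (\<exists>\<Xi>::nat \<Rightarrow> 'k. inj_on \<Xi> {..<n} \<and> (\<forall>i<n. \<exists>\<phi>'. ring_hom_on (adj A y) Z \<phi>' \<and>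
       (\<forall>x\<in>A. \<phi>' x = \<phi> x) \<and> \<phi>' y = \<Xi> i \<and> \<phi>' h1 \<noteq> 0))"
      using extend_step[OF ac A y P _ h1(1,2)] char by blast
    show ?thesis
    proof (intro bexI[of _ h] conjI h(1,2) allI impI)
      fix \<phi> :: "'r \<Rightarrow> 'k" assume "ring_hom_on A Z \<phi> \<and> \<phi> h \<noteq> 0"
      then obtain \<Xi> :: "nat \<Rightarrow> 'k" where \<Xi>: "inj_on \<Xi> {..<n}" "\<forall>i<n. \<exists>\<phi>'. ring_hom_on (adj A y) Z \<phi>' \<and>
       (\<forall>x\<in>A. \<phi>' x = \<phi> x) \<and> \<phi>' y = \<Xi> i \<and> \<phi>' h1 \<noteq> 0"
        using h(3) by blast
      then obtain \<psi> where \<psi>: "\<And>i. i < n \<Longrightarrow> ring_hom_on (adj A y) Z (\<psi> i)"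
        "\<And>i x. i < n \<Longrightarrow> x \<in> A \<Longrightarrow> \<psi> i x = \<phi> x" "\<And>i. i < n \<Longrightarrow> \<psi> i y = \<Xi> i" "\<And>i. i < n \<Longrightarrow> \<psi> i h1 \<noteq> 0"
        by metis
      then have "\<forall>i<n. \<exists>\<Phi>. extensions (adj A y) (adjs (adj A y) ys) K f (\<psi> i) \<Phi>"
        using h1(3) by blast
      then obtain \<Phi> where ex: "\<And>i. i < n \<Longrightarrow> extensions (adj A y) (adjs (adj A y) ys) K f (\<psi> i) (\<Phi> i)"
        by metis
      have \<Phi>: "\<And>i k. i < n \<Longrightarrow> k \<in> K \<Longrightarrow> ring_hom_on (adjs (adj A y) ys) Z (\<Phi> i k)"
        "\<And>i k x. i < n \<Longrightarrow> k \<in> K \<Longrightarrow> x \<in> adj A y \<Longrightarrow> \<Phi> i k x = \<psi> i x"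
        "\<And>i k. i < n \<Longrightarrow> k \<in> K \<Longrightarrow> \<Phi> i k f \<noteq> 0"
        "\<And>i k l. i < n \<Longrightarrow> k \<in> K \<Longrightarrow> l \<in> K \<Longrightarrow> \<forall>x\<in>adjs (adj A y) ys. \<Phi> i k x = \<Phi> i l x \<Longrightarrow> k = l"
        using ex unfolding extensions_def by blast+
      have yy: "y \<in> adj A y" "adj A y \<subseteq> adjs (adj A y) ys"
        using adj_gen[OF A(1)] adjs_incl[OF S] by auto
      \<comment> \<open>The image of y tells different roots apart; over the same root the inner
        tower separates the homomorphisms.\<close>
      have inj: "i = j \<and> k = l" if "i < n" "j < n" "k \<in> K" "l \<in> K"
        "\<forall>x\<in>adjs (adj A y) ys. \<Phi> i k x = \<Phi> j l x" for i j k l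
      proof -
        have "\<Phi> i k y = \<Phi> j l y" using that yy by blast
        then have "\<Xi> i = \<Xi> j" using that yy \<Phi>(2) \<psi>(3) by metis
        then have "i = j" using \<Xi>(1) that by (auto simp: inj_on_def)
        then show ?thesis using \<Phi>(4) that by blast
      qed
      show "\<exists>\<Phi>. extensions A (adjs (adj A y) ys) K' f \<phi> \<Phi>" unfolding extensions_def
      proof (intro exI[of _ "\<lambda>k. \<Phi> (hd k) (tl k)"] conjI ballI impI)
        fix k l assume k: "k \<in> K'" and l: "l \<in> K'"
        assume "\<forall>x\<in>adjs (adj A y) ys. \<Phi> (hd k) (tl k) x = \<Phi> (hd l) (tl l) x"
        with k l show "k = l" unfolding K'_def using inj by (clarsimp; metis)
      next
        fix k assume k: "k \<in> K'"
        then have k': "hd k < n" "tl k \<in> K" by (auto simp: K'_def)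
        show "ring_hom_on (adjs (adj A y) ys) Z (\<Phi> (hd k) (tl k))" "\<Phi> (hd k) (tl k) f \<noteq> 0"
          using \<Phi> k' by blast+
        fix x assume x: "x \<in> A"
        show "\<Phi> (hd k) (tl k) x = \<phi> x" using \<Phi>(2)[OF k'] \<psi>(2)[OF k'(1) x] x inc by auto
      qed
    qed
  qed
  ultimately show ?case unfolding adjs.simps by (intro exI[of _ K'] exI[of _ e']) blast
qed

end

section \<open>Krull's prime ideals and homogeneous linear systems\<close>

lemma prime_avoiding:
  assumes R: "subring R" and J: "J \<subseteq> R" "0 \<in> J" "\<And>x y. x \<in> J \<Longrightarrow> y \<in> J \<Longrightarrow> x + y \<in> J"
      "\<And>r x. r \<in> R \<Longrightarrow> x \<in> J \<Longrightarrow> r * x \<in> J"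
    and S: "1 \<in> S" "\<And>x y. x \<in> S \<Longrightarrow> y \<in> S \<Longrightarrow> x * y \<in> S" "J \<inter> S = {}"
  shows "\<exists>Z. prime_of R Z \<and> J \<subseteq> Z \<and> Z \<inter> S = {}"
proof -
  define ideal where "ideal I \<longleftrightarrow> J \<subseteq> I \<and> I \<subseteq> R \<and> (\<forall>x\<in>I. \<forall>y\<in>I. x + y \<in> I) \<and> (\<forall>r\<in>R. \<forall>x\<in>I. r * x \<in> I)" for I
  define F where "F = {I. ideal I \<and> I \<inter> S = {}}"
  have "\<exists>M\<in>F. \<forall>X\<in>F. M \<subseteq> X \<longrightarrow> X = M"
  proof (rule subset_Zorn_nonempty)
    have "ideal J" unfolding ideal_def using J by blast
    then show "F \<noteq> {}" using S(3) unfolding F_def by blast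
    fix C assume C: "C \<noteq> {}" "subset.chain F C"
    have CF: "I \<in> C \<Longrightarrow> ideal I \<and> I \<inter> S = {}" for I using C by (auto simp: subset.chain_def F_def)
    have "x + y \<in> \<Union>C" if xy: "x \<in> \<Union>C" "y \<in> \<Union>C" for x y
    proof -
      obtain I I' where I: "I \<in> C" "x \<in> I" "I' \<in> C" "y \<in> I'" using xy by auto
      then have "I \<subseteq> I' \<or> I' \<subseteq> I" using C by (auto simp: subset.chain_def)
      then show ?thesis using I CF unfolding ideal_def by blast
    qed
    moreover have "J \<subseteq> \<Union>C" "\<Union>C \<subseteq> R" "\<Union>C \<inter> S = {}"
      using C(1) CF unfolding ideal_def by blast+
    moreover have "r * x \<in> \<Union>C" if "r \<in> R" "x \<in> \<Union>C" for r x
      using that CF unfolding ideal_def by blast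
    ultimately show "\<Union>C \<in> F" unfolding F_def ideal_def by simp
  qed
  then obtain M where MF: "M \<in> F" and mx: "\<And>X. X \<in> F \<Longrightarrow> M \<subseteq> X \<Longrightarrow> X = M" by blast
  have M: "ideal M" "M \<inter> S = {}" using MF by (simp_all add: F_def)
  have max: "X = M" if "ideal X" "X \<inter> S = {}" "M \<subseteq> X" for X
    using mx[of X] that by (simp add: F_def)
  have M': "J \<subseteq> M" "M \<subseteq> R" "\<And>x y. x \<in> M \<Longrightarrow> y \<in> M \<Longrightarrow> x + y \<in> M" "\<And>r x. r \<in> R \<Longrightarrow> x \<in> M \<Longrightarrow> r * x \<in> M"
    using M(1) by (auto simp: ideal_def)
  \<comment> \<open>By maximality, enlarging M by an x outside it must hit S. If x and y are both
    outside M, the product of two such elements of S lies in M as soon as x y does; hence M is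
    prime.\<close>
  have ext: "\<exists>m\<in>M. \<exists>r\<in>R. m + r * x \<in> S" if x: "x \<in> R" "x \<notin> M" for x
  proof (rule ccontr)
    assume *: "\<not> ?thesis"
    define X where "X = {m + r * x | m r. m \<in> M \<and> r \<in> R}"
    have "M \<subseteq> X" unfolding X_def using subringD(2)[OF R] by force
    moreover have "ideal X" unfolding ideal_def
    proof (intro conjI ballI)
      show "J \<subseteq> X" using \<open>M \<subseteq> X\<close> M' by auto
      show "X \<subseteq> R" using M' x by (auto simp: X_def intro!: subringD[OF R])
      fix p assume "p \<in> X"
      then obtain m r where p: "p = m + r * x" "m \<in> M" "r \<in> R" by (auto simp: X_def)
      { fix q assume "q \<in> X"
        then obtain m' r' where q: "q = m' + r' * x" "m' \<in> M" "r' \<in> R" by (auto simp: X_def)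
        have "p + q = (m + m') + (r + r') * x" by (simp add: p q algebra_simps)
        then show "p + q \<in> X" unfolding X_def using M' p q subringD(6)[OF R] by blast }
      { fix s assume s: "s \<in> R"
        have "s * p = s * m + (s * r) * x" by (simp add: p algebra_simps)
        then show "s * p \<in> X" unfolding X_def using M' p s subringD(4)[OF R] by blast }
    qed
    moreover have "X \<inter> S = {}" using * by (auto simp: X_def)
    ultimately have "X = M" by (intro max) auto
    moreover have "0 + 1 * x \<in> X" unfolding X_def using M' J subringD(1)[OF R] by blast
    ultimately show False using x by simp
  qed
  have "prime_of R M" unfolding prime_of_def
  proof (intro conjI ballI impI)
    show "0 \<in> M" "1 \<notin> M" using M' J S M by auto
    fix x y assume xy: "x \<in> R" "y \<in> R" "x * y \<in> M"
    show "x \<in> M \<or> y \<in> M"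
    proof (rule ccontr)
      assume "\<not> ?thesis"
      then obtain m r m' r' where *: "m \<in> M" "r \<in> R" "m + r * x \<in> S" "m' \<in> M" "r' \<in> R" "m' + r' * y \<in> S"
        using ext[of x] ext[of y] xy by blast
      have "(m + r * x) * (m' + r' * y) = (m' + r' * y) * m + (r * x) * m' + (r * r') * (x * y)"
        by (simp add: algebra_simps)
      also have "\<dots> \<in> M"
      proof -
        have "m' \<in> R" using * M'(2) by blast
        then have "m' + r' * y \<in> R" "r * x \<in> R" "r * r' \<in> R" using * xy by (auto intro!: subringD[OF R])
        then show ?thesis using * xy M'(4) by (intro M'(3)) simp_all
      qed
      finally show False using S(2)[OF *(3,6)] M by auto
    qed
  qed (use M' in auto)
  then show ?thesis using M M' by blast
qed

text \<open>Gaussian elimination: an equation with a nonzero entry at k is solved for the unknown k,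
  which removes one equation and one unknown.\<close>

lemma linear_system_nontrivial:
  fixes M :: "'i \<Rightarrow> 'j \<Rightarrow> 'k::field"
  assumes "finite J" "finite I" "card J < card I"
  shows "\<exists>\<gamma>. (\<exists>i\<in>I. \<gamma> i \<noteq> 0) \<and> (\<forall>j\<in>J. (\<Sum>i\<in>I. \<gamma> i * M i j) = 0)"
  using assms
proof (induction J arbitrary: I M rule: finite_induct)
  case empty
  then show ?case by (intro exI[of _ "\<lambda>_. 1"]) (auto simp: card_gt_0_iff)
next
  case (insert j J)
  show ?case
  proof (cases "\<forall>i\<in>I. M i j = 0")
    case True
    obtain \<gamma> where "\<exists>i\<in>I. \<gamma> i \<noteq> 0" "\<forall>j\<in>J. (\<Sum>i\<in>I. \<gamma> i * M i j) = 0"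
      using insert.IH[of I M] insert.prems insert.hyps by auto
    then show ?thesis using True by (intro exI[of _ \<gamma>]) auto
  next
    case False
    then obtain k where k: "k \<in> I" "M k j \<noteq> 0" by auto
    define M' where "M' i l = M i l - M i j / M k j * M k l" for i l
    have "card J < card (I - {k})" using insert.prems insert.hyps k by auto
    then obtain \<gamma> where \<gamma>: "\<exists>i\<in>I-{k}. \<gamma> i \<noteq> 0" "\<forall>l\<in>J. (\<Sum>i\<in>I-{k}. \<gamma> i * M' i l) = 0"
      using insert.IH[of "I - {k}" M'] insert.prems by auto
    define \<delta> where "\<delta> i = (if i = k then - (\<Sum>i\<in>I-{k}. \<gamma> i * M i j) / M k j else \<gamma> i)" for i
    have s: "(\<Sum>i\<in>I. \<delta> i * M i l) = (\<Sum>i\<in>I-{k}. \<gamma> i * M' i l)" for l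
    proof -
      have "(\<Sum>i\<in>I. \<delta> i * M i l) = \<delta> k * M k l + (\<Sum>i\<in>I-{k}. \<delta> i * M i l)"
        using insert.prems k by (intro sum.remove) auto
      also have "(\<Sum>i\<in>I-{k}. \<delta> i * M i l) = (\<Sum>i\<in>I-{k}. \<gamma> i * M i l)"
        by (intro sum.cong) (auto simp: \<delta>_def)
      also have "\<delta> k * M k l = - (\<Sum>i\<in>I-{k}. \<gamma> i * (M i j / M k j * M k l))"
        by (simp add: \<delta>_def sum_distrib_left sum_divide_distrib sum_negf[symmetric] mult_ac)
      finally show ?thesis unfolding M'_def by (simp add: algebra_simps sum_subtractf)
    qed
    have "M' i j = 0" for i using k by (simp add: M'_def)
    then have "\<forall>l\<in>insert j J. (\<Sum>i\<in>I. \<delta> i * M i l) = 0" using s \<gamma>(2) by auto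
    moreover have "\<exists>i\<in>I. \<delta> i \<noteq> 0" using \<gamma>(1) by (auto simp: \<delta>_def)
    ultimately show ?thesis by blast
  qed
qed

section \<open>Homogeneous polynomial functions\<close>

text \<open>
  Over an infinite field polynomials are determined by their functions. hm N d f says that f is
  the function of a homogeneous polynomial of degree d (possibly 0) in x_0, ..., x_N.
\<close>

inductive hm :: "nat \<Rightarrow> nat \<Rightarrow> ((nat \<Rightarrow> 'k::field) \<Rightarrow> 'k) \<Rightarrow> bool" for N where
  hm_const: "hm N 0 (\<lambda>_. c)"
| hm_Suc: "i \<le> N \<Longrightarrow> hm N d f \<Longrightarrow> hm N (Suc d) (\<lambda>v. v i * f v)"
| hm_add: "hm N d f \<Longrightarrow> hm N d g \<Longrightarrow> hm N d (\<lambda>v. f v + g v)"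

lemma hm_scale: "hm N d f \<Longrightarrow> hm N d (\<lambda>v. c * f v)"
proof (induction rule: hm.induct)
  case (hm_Suc i d f)
  from hm.hm_Suc[OF hm_Suc(1,3)] show ?case by (simp add: mult.left_commute)
next
  case (hm_add d f g)
  from hm.hm_add[OF hm_add(3,4)] show ?case by (simp add: distrib_left)
qed (rule hm_const)

lemma hm_zero: "hm N d (\<lambda>_. 0)"
proof (induction d)
  case (Suc d)
  from hm_Suc[OF _ this, of 0] show ?case by simp
qed (rule hm_const)

lemma hm_diff: "hm N d f \<Longrightarrow> hm N d g \<Longrightarrow> hm N d (\<lambda>v. f v - g v)"
  using hm_add[OF _ hm_scale, of N d f g "-1"] by simp

lemma hm_sum: "(\<And>i. i \<in> I \<Longrightarrow> hm N d (f i)) \<Longrightarrow> hm N d (\<lambda>v. \<Sum>i\<in>I. f i v)"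
  by (induction I rule: infinite_finite_induct) (auto intro: hm_zero hm_add)

lemma hm_mult: "hm N d f \<Longrightarrow> hm N e g \<Longrightarrow> hm N (d + e) (\<lambda>v. f v * g v)"
proof (induction rule: hm.induct)
  case (hm_const c)
  then show ?case by (auto intro: hm_scale)
next
  case (hm_Suc i d f)
  from hm.hm_Suc[OF hm_Suc(1) hm_Suc(3)[OF hm_Suc(4)]] show ?case by (simp add: mult.assoc)
next
  case (hm_add d f f')
  from hm.hm_add[OF hm_add(3,4)[OF hm_add(5)]] show ?case by (simp add: distrib_right)
qed

lemma hm_mult_eq: "hm N d f \<Longrightarrow> hm N e g \<Longrightarrow> d + e = n \<Longrightarrow> hm N n (\<lambda>v. f v * g v)"
  using hm_mult by blast

lemma hm_var: "i \<le> N \<Longrightarrow> hm N (Suc 0) (\<lambda>v. v i)"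
  using hm_Suc[OF _ hm_const, of i N 1] by simp

lemma hm_power: "hm N d f \<Longrightarrow> hm N (n * d) (\<lambda>v. f v ^ n)"
proof (induction n)
  case (Suc n)
  then show ?case using hm_mult[of N d f "n * d" "\<lambda>v. f v ^ n"] by simp
qed (simp add: hm_const)

lemma hm_prod:
  assumes "\<And>i. i \<in> I \<Longrightarrow> hm N (d i) (f i)"
  shows "hm N (\<Sum>i\<in>I. d i) (\<lambda>v. \<Prod>i\<in>I. f i v)"
  using assms
proof (induction I rule: infinite_finite_induct)
  case (insert i I)
  then show ?case using hm_mult[of N "d i" "f i" "sum d I" "\<lambda>v. \<Prod>i\<in>I. f i v"] by simp
qed (simp_all add: hm_const)

lemma hm_homogeneous: "hm N d f \<Longrightarrow> f (\<lambda>i. c * v i) = c ^ d * f v"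
  by (induction rule: hm.induct) (simp_all add: algebra_simps)

lemma hm_cong: "hm N d f \<Longrightarrow> (\<And>i. i \<le> N \<Longrightarrow> v i = w i) \<Longrightarrow> f v = f w"
  by (induction rule: hm.induct) simp_all

lemma hm_0D: "hm N d f \<Longrightarrow> d = 0 \<Longrightarrow> \<exists>c. f = (\<lambda>_. c)"
  by (induction rule: hm.induct) auto

lemma hm_1D: "hm N d f \<Longrightarrow> d = Suc 0 \<Longrightarrow> \<exists>l. f = (\<lambda>v. \<Sum>i\<le>N. l i * v i)"
proof (induction rule: hm.induct)
  case (hm_Suc i d f)
  then obtain c where "f = (\<lambda>_. c)" using hm_0D by fastforce
  moreover have "v i * c = (\<Sum>j\<le>N. (if j = i then c else 0) * v j)" for v :: "nat \<Rightarrow> 'a"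
    using hm_Suc(1) by (subst sum.remove[of _ i]) auto
  ultimately show ?case by (intro exI[of _ "\<lambda>j. if j = i then c else 0"]) auto
next
  case (hm_add d f g)
  then obtain l l' where "f = (\<lambda>v. \<Sum>i\<le>N. l i * v i)" "g = (\<lambda>v. \<Sum>i\<le>N. l' i * v i)" by auto
  then show ?case by (intro exI[of _ "\<lambda>i. l i + l' i"]) (auto simp: algebra_simps sum.distrib)
qed auto

lemma hm_1I: "hm N (Suc 0) (\<lambda>v. \<Sum>i\<le>N. l i * v i)"
  by (intro hm_sum hm_scale hm_var) auto

definition monomial :: "nat \<Rightarrow> (nat \<Rightarrow> nat) \<Rightarrow> (nat \<Rightarrow> 'k::field) \<Rightarrow> 'k" where
  "monomial N \<alpha> v = (\<Prod>i\<le>N. v i ^ \<alpha> i)"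

definition expo :: "nat \<Rightarrow> nat \<Rightarrow> (nat \<Rightarrow> nat) set" where
  "expo N d = {\<alpha>. (\<forall>i>N. \<alpha> i = 0) \<and> (\<Sum>i\<le>N. \<alpha> i) = d}"

text \<open>Bounding the exponents one by one instead of in total makes the number of monomials
  exactly (e + 1)^(card I), which is convenient for dimension counts.\<close>

definition box :: "nat set \<Rightarrow> nat \<Rightarrow> (nat \<Rightarrow> nat) set" where
  "box I e = {\<alpha>. (\<forall>i\<in>I. \<alpha> i \<le> e) \<and> (\<forall>i. i \<notin> I \<longrightarrow> \<alpha> i = 0)}"

lemma box_insert:
  assumes "j \<notin> I"
  shows "bij_betw (\<lambda>(n, \<alpha>). \<alpha>(j := n)) ({..e} \<times> box I e) (box (insert j I) e)"
proof (rule bij_betw_byWitness[of _ "\<lambda>\<alpha>. (\<alpha> j, \<alpha>(j := 0))"])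
  show "(\<lambda>(n, \<alpha>). \<alpha>(j := n)) ` ({..e} \<times> box I e) \<subseteq> box (insert j I) e"
    using assms by (auto simp: box_def)
  show "(\<lambda>\<alpha>. (\<alpha> j, \<alpha>(j := 0))) ` box (insert j I) e \<subseteq> {..e} \<times> box I e"
    by (force simp: box_def)
qed (use assms in \<open>auto simp: box_def fun_eq_iff\<close>)

lemma box_card: "finite I \<Longrightarrow> finite (box I e) \<and> card (box I e) = Suc e ^ card I"
proof (induction I rule: finite_induct)
  case empty
  have "box {} e = {\<lambda>_. 0}" by (auto simp: box_def)
  then show ?case by simp
next
  case (insert j I)
  have "finite (box (insert j I) e)" using bij_betw_finite[OF box_insert[OF insert(2)]] insert by blast
  moreover have "card (box (insert j I) e) = Suc e * card (box I e)"
    using bij_betw_same_card[OF box_insert[OF insert(2), of e]] by (simp add: card_cartesian_product)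
  ultimately show ?case using insert by simp
qed

lemma expo_finite: "finite (expo N d)"
proof (rule finite_subset)
  show "expo N d \<subseteq> box {..N} d"
    unfolding expo_def box_def by (auto intro: member_le_sum)
qed (simp add: box_card)

lemma hm_monomial: "\<alpha> \<in> expo N d \<Longrightarrow> hm N d (monomial N \<alpha>)"
  using hm_prod[of "{..N}" N "\<lambda>i. \<alpha> i * Suc 0" "\<lambda>i v. v i ^ \<alpha> i"] hm_power[OF hm_var]
  by (auto simp: monomial_def[abs_def] expo_def)

lemma hm_expand: "hm N d f \<Longrightarrow> \<exists>\<gamma>. f = (\<lambda>v. \<Sum>\<alpha>\<in>expo N d. \<gamma> \<alpha> * monomial N \<alpha> v)"
proof (induction rule: hm.induct)
  case (hm_const c)
  have "expo N 0 = {\<lambda>_. 0}" by (auto simp: expo_def fun_eq_iff) (metis atMost_iff not_le)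
  then show ?case by (intro exI[of _ "\<lambda>_. c"]) (simp add: monomial_def)
next
  case (hm_Suc i d f)
  then obtain \<gamma> where \<gamma>: "f = (\<lambda>v. \<Sum>\<alpha>\<in>expo N d. \<gamma> \<alpha> * monomial N \<alpha> v)" by blast
  let ?s = "\<lambda>\<alpha>::nat \<Rightarrow> nat. \<alpha>(i := Suc (\<alpha> i))"
  \<comment> \<open>Coefficients of x_i f: those of f moved along the injection that raises the i-th
    exponent, and zero on monomials without x_i.\<close>
  define \<gamma>' where "\<gamma>' \<beta> = (if \<beta> i = 0 then 0 else \<gamma> (\<beta>(i := \<beta> i - 1)))" for \<beta>
  have sub: "?s ` expo N d \<subseteq> expo N (Suc d)"
  proof (safe)
    fix \<alpha> assume \<alpha>: "\<alpha> \<in> expo N d"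
    have "(\<Sum>j\<le>N. ?s \<alpha> j) = (\<Sum>j\<le>N. \<alpha> j + (if j = i then 1 else 0))"
      by (intro sum.cong) auto
    also have "\<dots> = d + 1" using \<alpha> hm_Suc(1) by (simp add: sum.distrib expo_def)
    finally show "?s \<alpha> \<in> expo N (Suc d)" using \<alpha> hm_Suc(1) by (auto simp: expo_def)
  qed
  have mono: "monomial N (?s \<alpha>) v = v i * monomial N \<alpha> v" for \<alpha> and v :: "nat \<Rightarrow> 'a"
  proof -
    have "monomial N (?s \<alpha>) v = (\<Prod>j\<le>N. (if j = i then v i else 1) * v j ^ \<alpha> j)"
      unfolding monomial_def by (intro prod.cong) auto
    then show ?thesis using hm_Suc(1) by (simp add: prod.distrib monomial_def)
  qed
  have "v i * f v = (\<Sum>\<beta>\<in>expo N (Suc d). \<gamma>' \<beta> * monomial N \<beta> v)" for v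
  proof -
    have "(\<Sum>\<beta>\<in>expo N (Suc d). \<gamma>' \<beta> * monomial N \<beta> v) = (\<Sum>\<beta>\<in>?s ` expo N d. \<gamma>' \<beta> * monomial N \<beta> v)"
    proof (rule sum.mono_neutral_right[OF expo_finite sub], safe)
      fix \<beta> assume \<beta>: "\<beta> \<in> expo N (Suc d)" "\<beta> \<notin> ?s ` expo N d"
      have "\<beta> i = 0"
      proof (rule ccontr)
        assume "\<beta> i \<noteq> 0"
        then have e: "\<beta> = ?s (\<beta>(i := \<beta> i - 1))" by auto
        have "(\<Sum>j\<le>N. \<beta> j) = (\<Sum>j\<le>N. (\<beta>(i := \<beta> i - 1)) j + (if j = i then 1 else 0))"
          using \<open>\<beta> i \<noteq> 0\<close> by (intro sum.cong) auto
        also have "\<dots> = (\<Sum>j\<le>N. (\<beta>(i := \<beta> i - 1)) j) + 1" using hm_Suc(1) by (simp add: sum.distrib)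
        finally have "\<beta>(i := \<beta> i - 1) \<in> expo N d" using \<beta>(1) hm_Suc(1) by (auto simp: expo_def)
        then show False using \<beta>(2) e by blast
      qed
      then show "\<gamma>' \<beta> * monomial N \<beta> v = 0" by (simp add: \<gamma>'_def)
    qed
    also have "\<dots> = (\<Sum>\<alpha>\<in>expo N d. \<gamma>' (?s \<alpha>) * monomial N (?s \<alpha>) v)"
    proof (subst sum.reindex)
      show "inj_on ?s (expo N d)"
      proof (rule inj_onI)
        fix \<alpha> \<beta> :: "nat \<Rightarrow> nat" assume "?s \<alpha> = ?s \<beta>"
        then have e: "(?s \<alpha>) j = (?s \<beta>) j" for j by simp
        have "\<alpha> j = \<beta> j" for j using e[of j] by (cases "j = i") auto
        then show "\<alpha> = \<beta>" by auto
      qed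
    qed simp
    also have "\<dots> = v i * f v" by (simp add: \<gamma>'_def mono \<gamma> sum_distrib_left mult_ac)
    finally show ?thesis by simp
  qed
  then show ?case by blast
next
  case (hm_add d f g)
  then obtain \<gamma> \<gamma>' where "f = (\<lambda>v. \<Sum>\<alpha>\<in>expo N d. \<gamma> \<alpha> * monomial N \<alpha> v)"
    "g = (\<lambda>v. \<Sum>\<alpha>\<in>expo N d. \<gamma>' \<alpha> * monomial N \<alpha> v)" by blast
  then show ?case
    by (intro exI[of _ "\<lambda>\<alpha>. \<gamma> \<alpha> + \<gamma>' \<alpha>"]) (simp add: distrib_right sum.distrib)
qed

lemma hpoly_hm: "hpoly N d c \<Longrightarrow> hm N d (peval N c)"
  unfolding peval_def[abs_def] monomial_def[symmetric]
  by (intro hm_sum hm_scale hm_monomial) (auto simp: hpoly_def expo_def)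

lemma hm_hpoly:
  assumes "hm N d f"
  shows "\<exists>c. hpoly N d c \<and> peval N c = f"
proof -
  obtain \<gamma> where \<gamma>: "f = (\<lambda>v. \<Sum>\<alpha>\<in>expo N d. \<gamma> \<alpha> * monomial N \<alpha> v)" using hm_expand[OF assms] by blast
  define c where "c \<alpha> = (if \<alpha> \<in> expo N d then \<gamma> \<alpha> else 0)" for \<alpha>
  have sub: "{\<alpha>. c \<alpha> \<noteq> 0} \<subseteq> expo N d" by (auto simp: c_def)
  have "hpoly N d c" unfolding hpoly_def
    using sub finite_subset[OF sub expo_finite] by (auto simp: expo_def)
  moreover have "peval N c v = f v" for v
    unfolding peval_def monomial_def[symmetric] \<gamma>
    by (rule sum.mono_neutral_cong_left[OF expo_finite sub]) (auto simp: c_def)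
  ultimately show ?thesis by blast
qed

text \<open>This separates homogeneous components: an identity on a cone, applied to x v for all
  scalars x, splits into one identity for each degree.\<close>

lemma power_sum_eq_0:
  fixes a :: "nat \<Rightarrow> 'k::field_char_0"
  assumes "\<And>x. (\<Sum>n\<le>e. a n * x ^ n) = 0" "n \<le> e"
  shows "a n = 0"
proof -
  define p where "p = (\<Sum>n\<le>e. monom (a n) n)"
  have "poly p x = 0" for x using assms(1)[of x] by (simp add: p_def poly_sum poly_monom)
  then have "p = 0" using poly_all_0_iff_0 by blast
  moreover have "coeff p n = a n" using assms(2) by (simp add: p_def coeff_sum)
  ultimately show ?thesis by simp
qed

text \<open>Monomials are independent as functions. With the other variables fixed, the sum is a
  polynomial in the variable j that vanishes everywhere, so its coefficients vanish and the
  induction goes on with one variable less.\<close>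

lemma box_independent:
  fixes \<gamma> :: "(nat \<Rightarrow> nat) \<Rightarrow> 'k::field_char_0"
  assumes "finite I" "\<And>w. (\<Sum>\<alpha>\<in>box I e. \<gamma> \<alpha> * (\<Prod>i\<in>I. w i ^ \<alpha> i)) = 0" "\<alpha> \<in> box I e"
  shows "\<gamma> \<alpha> = 0"
  using assms
proof (induction I arbitrary: \<gamma> \<alpha> rule: finite_induct)
  case empty
  have "box {} e = {\<lambda>_. 0}" by (auto simp: box_def)
  then show ?case using empty by auto
next
  case (insert j I)
  have *: "(\<Sum>\<alpha>\<in>box I e. \<gamma> (\<alpha>(j := n)) * (\<Prod>i\<in>I. w i ^ \<alpha> i)) = 0" if "n \<le> e" for w n
  proof (rule power_sum_eq_0[where e=e and a="\<lambda>n. \<Sum>\<alpha>\<in>box I e. \<gamma> (\<alpha>(j := n)) * (\<Prod>i\<in>I. w i ^ \<alpha> i)", OF _ that])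
    fix x
    let ?w = "w(j := x)"
    have pr: "(\<Prod>i\<in>I. ?w i ^ (\<alpha>(j := n)) i) = (\<Prod>i\<in>I. w i ^ \<alpha> i)" for \<alpha> n
      using insert.hyps by (intro prod.cong) auto
    have "0 = (\<Sum>\<alpha>\<in>box (insert j I) e. \<gamma> \<alpha> * (\<Prod>i\<in>insert j I. ?w i ^ \<alpha> i))"
      using insert.prems(1) by simp
    also have "\<dots> = (\<Sum>(n, \<alpha>)\<in>{..e} \<times> box I e. \<gamma> (\<alpha>(j := n)) * (\<Prod>i\<in>insert j I. ?w i ^ (\<alpha>(j := n)) i))"
      by (subst sum.reindex_bij_betw[OF box_insert[OF insert(2), of e], symmetric])
        (simp add: case_prod_unfold)
    also have "\<dots> = (\<Sum>n\<le>e. \<Sum>\<alpha>\<in>box I e. \<gamma> (\<alpha>(j := n)) * (\<Prod>i\<in>insert j I. ?w i ^ (\<alpha>(j := n)) i))"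
      by (rule sum.cartesian_product[symmetric])
    also have "\<dots> = (\<Sum>n\<le>e. (\<Sum>\<alpha>\<in>box I e. \<gamma> (\<alpha>(j := n)) * (\<Prod>i\<in>I. w i ^ \<alpha> i)) * x ^ n)"
      using insert.hyps pr by (simp add: sum_distrib_left sum_distrib_right mult_ac)
    finally show "(\<Sum>n\<le>e. (\<Sum>\<alpha>\<in>box I e. \<gamma> (\<alpha>(j := n)) * (\<Prod>i\<in>I. w i ^ \<alpha> i)) * x ^ n) = 0" by simp
  qed
  obtain n \<beta> where n: "n \<le> e" "\<beta> \<in> box I e" "\<alpha> = \<beta>(j := n)"
    using insert.prems(2) bij_betw_imp_surj_on[OF box_insert[OF insert(2), of e]] by force
  then show ?case using insert.IH[of "\<lambda>\<alpha>. \<gamma> (\<alpha>(j := n))" \<beta>] * by (auto simp del: fun_upd_apply)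
qed

lemma hpoly_nonzero:
  fixes c :: "(nat \<Rightarrow> nat) \<Rightarrow> 'k::field_char_0"
  assumes "hpoly N d c" "c \<noteq> (\<lambda>_. 0)"
  shows "\<exists>v\<in>vecs N. peval N c v \<noteq> 0"
proof (rule ccontr)
  assume *: "\<not> ?thesis"
  have sub: "{\<alpha>. c \<alpha> \<noteq> 0} \<subseteq> box {..N} d"
  proof safe
    fix \<alpha> assume "c \<alpha> \<noteq> 0"
    then have "(\<forall>i>N. \<alpha> i = 0)" "(\<Sum>i\<le>N. \<alpha> i) = d" using assms(1) by (auto simp: hpoly_def)
    then show "\<alpha> \<in> box {..N} d" by (auto simp: box_def intro: member_le_sum)
  qed
  have pe: "peval N c w = (\<Sum>\<alpha>\<in>box {..N} d. c \<alpha> * (\<Prod>i\<le>N. w i ^ \<alpha> i))" for w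
    unfolding peval_def by (rule sum.mono_neutral_left[OF _ sub]) (auto simp: box_card)
  have 0: "peval N c w = 0" for w
  proof -
    have "peval N c w = peval N c (\<lambda>i. if i \<le> N then w i else 0)"
      by (rule hm_cong[OF hpoly_hm[OF assms(1)]]) auto
    moreover have "(\<lambda>i. if i \<le> N then w i else 0) \<in> vecs N" by (simp add: vecs_def)
    ultimately show ?thesis using * by auto
  qed
  obtain \<alpha> where \<alpha>: "c \<alpha> \<noteq> 0" using assms(2) by auto
  then show False using box_independent[where I="{..N}" and e=d and \<gamma>=c and \<alpha>=\<alpha>] 0 sub pe by auto
qed

section \<open>The Nullstellensatz\<close>

definition polyring :: "nat \<Rightarrow> ((nat \<Rightarrow> 'k::field) \<Rightarrow> 'k) set" where
  "polyring N = {f. \<exists>n F. (\<forall>d. hm N d (F d)) \<and> f = (\<lambda>v. \<Sum>d\<le>n. F d v)}"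

definition const_funs :: "((nat \<Rightarrow> 'k::field) \<Rightarrow> 'k) set" where
  "const_funs = range (\<lambda>c v. c)"

definition coords :: "nat \<Rightarrow> ((nat \<Rightarrow> 'k::field) \<Rightarrow> 'k) list" where
  "coords N = map (\<lambda>i v. v i) [0..<Suc N]"

lemma set_coords: "set (coords N) = (\<lambda>i v. v i) ` {..N}"
  by (auto simp: coords_def simp del: upt_Suc)

lemma subring_const_funs: "subring const_funs"
  by (auto simp: subring_def const_funs_def one_fun_def times_fun_def fun_diff_def)

lemma polyring_extend:
  assumes "f \<in> polyring N"
  obtains n F where "\<And>d. hm N d (F d)" "\<And>m. m \<ge> n \<Longrightarrow> f = (\<lambda>v. \<Sum>d\<le>m. F d v)"
proof -
  obtain n F where F: "\<forall>d. hm N d (F d)" "f = (\<lambda>v. \<Sum>d\<le>n. F d v)"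
    using assms by (auto simp: polyring_def)
  define G where "G d = (if d \<le> n then F d else (\<lambda>_. 0))" for d
  have "f = (\<lambda>v. \<Sum>d\<le>m. G d v)" if "m \<ge> n" for m
    unfolding F(2) using that
    by (intro ext sum.mono_neutral_cong_left) (auto simp: G_def)
  then show ?thesis using that[of G n] F by (auto simp: G_def hm_zero)
qed

lemma hm_polyring: "hm N d f \<Longrightarrow> f \<in> polyring N"
  unfolding polyring_def
  by (auto intro!: exI[of _ d] exI[of _ "\<lambda>e. if e = d then f else (\<lambda>_. 0)"] simp: hm_zero if_distrib[of "\<lambda>f. f _"] cong: if_cong)

lemma subring_polyring: "subring (polyring N)"
  unfolding subring_def
proof (intro conjI ballI)
  show "1 \<in> polyring N" using hm_polyring[OF hm_const[of N 1]] by (simp add: one_fun_def)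
  fix f g :: "(nat \<Rightarrow> 'a) \<Rightarrow> 'a" assume "f \<in> polyring N" "g \<in> polyring N"
  then obtain n F n' G where F: "\<And>d. hm N d (F d)" "\<And>m. m \<ge> n \<Longrightarrow> f = (\<lambda>v. \<Sum>d\<le>m. F d v)"
    and G: "\<And>d. hm N d (G d)" "\<And>m. m \<ge> n' \<Longrightarrow> g = (\<lambda>v. \<Sum>d\<le>m. G d v)"
    by (elim polyring_extend) blast
  define m where "m = max n n'"
  have f: "f = (\<lambda>v. \<Sum>d\<le>m. F d v)" and g: "g = (\<lambda>v. \<Sum>d\<le>m. G d v)"
    using F(2) G(2) by (auto simp: m_def)
  have "f - g = (\<lambda>v. \<Sum>d\<le>m. F d v - G d v)" by (simp add: f g fun_diff_def sum_subtractf)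
  then show "f - g \<in> polyring N" unfolding polyring_def using hm_diff[OF F(1) G(1)]
    by (auto intro!: exI[of _ m] exI[of _ "\<lambda>d v. F d v - G d v"])
  \<comment> \<open>The \<open>F d\<close> and \<open>G d\<close> with d > m are arbitrary, so they
    are replaced by zero before the convolution up to degree 2 m.\<close>
  define F' where "F' d = (if d \<le> m then F d else (\<lambda>_. 0))" for d
  define G' where "G' d = (if d \<le> m then G d else (\<lambda>_. 0))" for d
  have F': "hm N d (F' d)" and G': "hm N d (G' d)" for d using F G by (auto simp: F'_def G'_def hm_zero)
  define H where "H e v = (\<Sum>i\<le>e. F' i v * G' (e - i) v)" for e v
  have "hm N e (H e)" for e unfolding H_def
    by (rule hm_sum, rule hm_mult_eq[OF F' G']) auto
  moreover have "f * g = (\<lambda>v. \<Sum>e\<le>2*m. H e v)"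
  proof
    fix v
    have "(f * g) v = (\<Sum>i\<le>m. \<Sum>j\<le>m. F i v * G j v)"
      by (simp add: f g times_fun_def sum_product)
    also have "\<dots> = (\<Sum>i\<le>2*m. \<Sum>j\<le>2*m-i. F' i v * G' j v)"
    proof (rule sum.mono_neutral_cong_left)
      fix i assume "i \<in> {..m}"
      then show "(\<Sum>j\<le>m. F i v * G j v) = (\<Sum>j\<le>2*m-i. F' i v * G' j v)"
        by (intro sum.mono_neutral_cong_left) (auto simp: F'_def G'_def)
    qed (auto simp: F'_def)
    also have "\<dots> = (\<Sum>(i,j)\<in>(SIGMA i:{..2*m}. {..2*m-i}). F' i v * G' j v)"
      by (simp add: sum.Sigma)
    also have "\<dots> = (\<Sum>(e,i)\<in>(SIGMA e:{..2*m}. {..e}). F' i v * G' (e-i) v)"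
      by (rule sum.reindex_bij_witness[of _ "\<lambda>(e,i). (i,e-i)" "\<lambda>(i,j). (i+j,i)"]) auto
    also have "\<dots> = (\<Sum>e\<le>2*m. H e v)" by (simp add: sum.Sigma H_def)
    finally show "(f * g) v = (\<Sum>e\<le>2*m. H e v)" .
  qed
  ultimately show "f * g \<in> polyring N" unfolding polyring_def by blast
qed

lemma const_funs_polyring: "const_funs \<subseteq> polyring N"
  using hm_polyring[OF hm_const] by (auto simp: const_funs_def)

lemma coords_polyring: "set (coords N) \<subseteq> polyring N"
  using hm_polyring[OF hm_var] by (auto simp: set_coords)

lemma hm_in_subring:
  assumes "hm N d f" "subring B" "const_funs \<subseteq> B" "set (coords N) \<subseteq> B"
  shows "f \<in> B"
  using assms(1)
proof (induction rule: hm.induct)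
  case (hm_const c)
  then show ?case using assms(3) by (auto simp: const_funs_def)
next
  case (hm_Suc i d f)
  have "(\<lambda>v. v i) \<in> B" using hm_Suc(1) assms(4) by (auto simp: set_coords)
  then show ?case using subringD(4)[OF assms(2) _ hm_Suc(3)] by (auto simp: times_fun_def)
next
  case (hm_add d f g)
  then show ?case using subringD(6)[OF assms(2) hm_add(3,4)] by (auto simp: plus_fun_def)
qed

text \<open>A homomorphism that fixes constants is evaluation at the point whose coordinates are the
  images of the coordinate functions. This turns extensions of homomorphisms into points.\<close>

lemma hom_eval:
  assumes "hm N d f" and B: "subring B" "const_funs \<subseteq> B" "set (coords N) \<subseteq> B"
    and \<phi>: "ring_hom_on B Z \<phi>" "\<And>c. \<phi> (\<lambda>v. c) = c"
  shows "\<phi> f = f (\<lambda>i. if i \<le> N then \<phi> (\<lambda>v. v i) else 0)"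
  using assms(1)
proof (induction rule: hm.induct)
  case (hm_const c)
  then show ?case using \<phi> by simp
next
  case (hm_Suc i d f)
  have "(\<lambda>v. v i) \<in> B" "f \<in> B" using hm_Suc(1) B hm_in_subring[OF hm_Suc(2) B] by (auto simp: set_coords)
  then have "\<phi> ((\<lambda>v. v i) * f) = \<phi> (\<lambda>v. v i) * \<phi> f" by (intro ring_hom_onD[OF B(1) \<phi>(1)])
  then show ?case using hm_Suc by (simp add: times_fun_def)
next
  case (hm_add d f g)
  have "\<phi> (f + g) = \<phi> f + \<phi> g"
    by (intro ring_hom_onD[OF B(1) \<phi>(1)] hm_in_subring[OF hm_add(1) B] hm_in_subring[OF hm_add(2) B])
  then show ?case using hm_add by (simp add: plus_fun_def)
qed

lemma const_not_in_prime:
  assumes "prime_of (polyring N) Z" "(\<lambda>v. c) \<in> Z"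
  shows "c = 0"
proof (rule ccontr)
  assume "c \<noteq> 0"
  have "(\<lambda>v. inverse c) \<in> polyring N" using const_funs_polyring by (auto simp: const_funs_def)
  then have "(\<lambda>v. inverse c) * (\<lambda>v. c) \<in> Z" using assms by (auto simp: prime_of_def)
  then show False using \<open>c \<noteq> 0\<close> assms(1) by (auto simp: times_fun_def prime_of_def one_fun_def)
qed

lemma of_nat_not_in_prime:
  fixes Z :: "((nat \<Rightarrow> 'k::field_char_0) \<Rightarrow> 'k) set"
  assumes "prime_of (polyring N) Z" "k > 0"
  shows "of_nat k \<notin> Z"
  using const_not_in_prime[OF assms(1), of "of_nat k"] assms(2) by (auto simp: of_nat_fun)

text \<open>The polynomial ring arises from the constants by adjoining the coordinates. The
  tautological map on constants extends with f kept nonzero: the obstruction h is a constant outside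
  \<open>Z\<close>, hence nonzero. The extension is evaluation at the required point.\<close>

lemma nullstellensatz:
  fixes Z :: "((nat \<Rightarrow> 'k::field_char_0) \<Rightarrow> 'k) set"
  assumes ac: "alg_closed_field TYPE('k)" and Z: "prime_of (polyring N) Z"
    and f: "hm N d f" "f \<notin> Z"
  shows "\<exists>v\<in>vecs N. f v \<noteq> 0 \<and> (\<forall>e g. hm N e g \<longrightarrow> g \<in> Z \<longrightarrow> g v = 0)"
proof -
  interpret prime_ideal "polyring N" Z by unfold_locales (rule subring_polyring, rule Z)
  note S = adjs_subring[OF subring_const_funs, of "coords N"]
  have B: "const_funs \<subseteq> adjs const_funs (coords N)" "set (coords N) \<subseteq> adjs const_funs (coords N)"
    using adjs_incl adjs_gen subring_const_funs by blast+
  have fB: "f \<in> adjs const_funs (coords N)" by (rule hm_in_subring[OF f(1) S B])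
  obtain h where h: "h \<in> const_funs" "h \<notin> Z" "\<And>\<phi>::_ \<Rightarrow> 'k. ring_hom_on const_funs Z \<phi> \<and> \<phi> h \<noteq> 0 \<Longrightarrow>
     (\<exists>\<phi>'. ring_hom_on (adjs const_funs (coords N)) Z \<phi>' \<and> (\<forall>x\<in>const_funs. \<phi>' x = \<phi> x) \<and> \<phi>' f \<noteq> 0)"
    using extension_theorem[OF ac of_nat_not_in_prime[OF Z] subring_const_funs const_funs_polyring coords_polyring fB f(2)]
    by blast
  define \<phi> :: "((nat \<Rightarrow> 'k) \<Rightarrow> 'k) \<Rightarrow> 'k" where "\<phi> g = g (\<lambda>_. 0)" for g
  have "ring_hom_on const_funs Z \<phi>" unfolding ring_hom_on_def \<phi>_def
    using const_not_in_prime[OF Z] by (auto simp: const_funs_def)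
  moreover have "\<phi> h \<noteq> 0" using h(1,2) Z0 by (auto simp: \<phi>_def const_funs_def zero_fun_def)
  ultimately obtain \<phi>' where \<phi>': "ring_hom_on (adjs const_funs (coords N)) Z \<phi>'" "\<forall>x\<in>const_funs. \<phi>' x = \<phi> x" "\<phi>' f \<noteq> 0"
    using h(3) by blast
  have c: "\<phi>' (\<lambda>v. c) = c" for c using \<phi>'(2) by (auto simp: const_funs_def \<phi>_def)
  define v where "v i = (if i \<le> N then \<phi>' (\<lambda>v. v i) else 0)" for i
  have ev: "\<phi>' g = g v" if "hm N e g" for e g
    unfolding v_def by (rule hom_eval[OF that S B \<phi>'(1) c])
  have "g v = 0" if g: "hm N e g" "g \<in> Z" for e g
    using ev[OF g(1)] ring_hom_onD(6)[OF S \<phi>'(1) g(2) hm_in_subring[OF g(1) S B]] by simp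
  moreover have "f v \<noteq> 0" using ev[OF f(1)] \<phi>'(3) by simp
  moreover have "v \<in> vecs N" by (simp add: vecs_def v_def)
  ultimately show ?thesis by blast
qed

section \<open>Curves\<close>

definition hzeros :: "nat \<Rightarrow> ((nat \<Rightarrow> 'k::field) \<Rightarrow> 'k) set \<Rightarrow> (nat \<Rightarrow> 'k) set set" where
  "hzeros N G = {p \<in> PN N. \<forall>f\<in>G. \<forall>v\<in>p. f v = 0}"

lemma zclosed_hzeros: "(\<And>f. f \<in> G \<Longrightarrow> \<exists>d. hm N d f) \<Longrightarrow> zclosed N (hzeros N G)"
proof -
  assume G: "\<And>f. f \<in> G \<Longrightarrow> \<exists>d. hm N d f"
  define F where "F = {c. (\<exists>d. hpoly N d c) \<and> peval N c \<in> G}"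
  have "peval N ` F = G"
  proof safe
    fix f assume "f \<in> G"
    then obtain d c where "hpoly N d c" "peval N c = f" using G hm_hpoly by metis
    then show "f \<in> peval N ` F" using \<open>f \<in> G\<close> by (auto simp: F_def)
  qed (auto simp: F_def)
  then have "hzeros N G = zero_set N F" by (auto simp: hzeros_def zero_set_def)
  moreover have "\<forall>c\<in>F. \<exists>d. hpoly N d c" by (simp add: F_def)
  ultimately show ?thesis unfolding zclosed_def by blast
qed

lemma zclosedE:
  assumes "zclosed N S"
  obtains G where "\<And>f. f \<in> G \<Longrightarrow> \<exists>d. hm N d f" "S = hzeros N G"
proof -
  obtain F where F: "\<forall>c\<in>F. \<exists>d. hpoly N d c" "S = zero_set N F"
    using assms by (auto simp: zclosed_def)
  have "S = hzeros N (peval N ` F)" by (auto simp: F(2) zero_set_def hzeros_def)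
  then show ?thesis using that[of "peval N ` F"] F(1) hpoly_hm by blast
qed

lemma pt_self: "v \<in> pt v"
  unfolding pt_def by (auto intro: exI[of _ 1])

lemma pt_scale:
  assumes "c \<noteq> 0"
  shows "pt (\<lambda>i. c * v i) = pt (v :: nat \<Rightarrow> 'k::field)"
proof safe
  fix w assume "w \<in> pt (\<lambda>i. c * v i)"
  then obtain a where "w = (\<lambda>i. (a * c) * v i)" "a * c \<noteq> 0" using assms by (auto simp: pt_def mult.assoc)
  then show "w \<in> pt v" unfolding pt_def by blast
next
  fix w assume "w \<in> pt v"
  then obtain a where "w = (\<lambda>i. (a / c) * (c * v i))" "a / c \<noteq> 0" using assms by (auto simp: pt_def)
  then show "w \<in> pt (\<lambda>i. c * v i)" unfolding pt_def by blast
qed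

lemma PN_D:
  assumes "p \<in> PN N" "v \<in> p"
  shows "v \<in> vecs N" "v \<noteq> (\<lambda>_. 0)" "p = pt v"
proof -
  obtain w where w: "p = pt w" "w \<in> vecs N" "w \<noteq> (\<lambda>_. 0)" using assms by (auto simp: PN_def)
  then obtain c where c: "v = (\<lambda>i. c * w i)" "c \<noteq> 0" using assms by (auto simp: pt_def)
  then show "v \<in> vecs N" "v \<noteq> (\<lambda>_. 0)" using w by (auto simp: vecs_def fun_eq_iff)
  show "p = pt v" using pt_scale[of c w] c w by simp
qed

lemma PN_pt: "v \<in> vecs N \<Longrightarrow> v \<noteq> (\<lambda>_. 0) \<Longrightarrow> pt v \<in> PN N"
  by (auto simp: PN_def)

lemma PN_nonempty: "p \<in> PN N \<Longrightarrow> \<exists>v. v \<in> p"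
  using pt_self by (auto simp: PN_def)

lemma hm_pt:
  assumes "p \<in> PN N" "v \<in> p" "hm N d f"
  shows "(\<forall>w\<in>p. f w = 0) \<longleftrightarrow> f v = 0"
proof -
  have "p = pt v" using PN_D[OF assms(1,2)] by simp
  then show ?thesis using assms by (auto simp: pt_def hm_homogeneous[OF assms(3)])
qed

lemma pt_in_hzeros:
  assumes "v \<in> vecs N" "v \<noteq> (\<lambda>_. 0)" "\<And>f. f \<in> G \<Longrightarrow> \<exists>d. hm N d f" "\<And>f. f \<in> G \<Longrightarrow> f v = 0"
  shows "pt v \<in> hzeros N G"
proof -
  have "f w = 0" if f: "f \<in> G" and w: "w \<in> pt v" for f w
  proof -
    obtain d where "hm N d f" using assms(3) f by blast
    from hm_pt[OF PN_pt[OF assms(1,2)] pt_self this] show ?thesis using assms(4)[OF f] w by blast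
  qed
  then show ?thesis unfolding hzeros_def using PN_pt[OF assms(1,2)] by blast
qed

lemma vec_nonzero_coord:
  assumes "v \<in> vecs N" "v \<noteq> (\<lambda>_. 0)"
  shows "\<exists>i\<le>N. v i \<noteq> 0"
proof -
  obtain i where i: "v i \<noteq> 0" using assms(2) by auto
  have "v j = 0" if "j > N" for j using assms(1) that by (simp add: vecs_def)
  then have "i \<le> N" using i by (cases "i \<le> N") auto
  then show ?thesis using i by blast
qed

lemma pt_eqI:
  assumes "v \<in> vecs N" "w \<in> vecs N" "w i \<noteq> 0" "v i \<noteq> 0" "\<And>j. j \<le> N \<Longrightarrow> w i * v j = w j * v i"
  shows "pt v = pt (w :: nat \<Rightarrow> 'k::field)"
proof -
  have "v = (\<lambda>j. (v i / w i) * w j)"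
  proof
    fix j
    show "v j = (v i / w i) * w j"
      using assms by (cases "j \<le> N") (auto simp: vecs_def field_simps)
  qed
  then show ?thesis using pt_scale[of "v i / w i" w] assms by simp
qed

text \<open>The prime ideal of a nonprincipal ultrafilter on the set.\<close>

lemma prime_on_infinite_set:
  assumes "infinite (Z :: 'z set)"
  shows "\<exists>Q :: ('z \<Rightarrow> 'k::field) set. prime_of UNIV Q \<and> (\<forall>F. (\<forall>z\<in>Z. F z = 0) \<longrightarrow> F \<in> Q) \<and>
    (\<forall>(I::nat set) F. finite I \<longrightarrow> (\<forall>i\<in>I. F i \<in> Q) \<longrightarrow> infinite {z \<in> Z. \<forall>i\<in>I. F i z = 0})"
proof -
  define J where "J = {F :: 'z \<Rightarrow> 'k. \<forall>z\<in>Z. F z = 0}"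
  \<comment> \<open>Avoiding the functions with only finitely many zeros on the set forces every
    member of the prime to have infinitely many.\<close>
  define S where "S = {F :: 'z \<Rightarrow> 'k. finite {z \<in> Z. F z = 0}}"
  have U: "subring (UNIV :: ('z \<Rightarrow> 'k) set)" by (simp add: subring_def)
  have "\<exists>Q. prime_of UNIV Q \<and> J \<subseteq> Q \<and> Q \<inter> S = {}"
  proof (rule prime_avoiding[OF U])
    show "1 \<in> S" by (simp add: S_def)
    show "F * G \<in> S" if "F \<in> S" "G \<in> S" for F G
    proof -
      have "{z \<in> Z. (F * G) z = 0} = {z \<in> Z. F z = 0} \<union> {z \<in> Z. G z = 0}" by auto
      then show ?thesis using that by (simp add: S_def)
    qed
    show "J \<inter> S = {}"
    proof (rule ccontr)
      assume "J \<inter> S \<noteq> {}"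
      then obtain F where "F \<in> J" "F \<in> S" by blast
      then have "\<forall>z\<in>Z. F z = 0" "finite {z \<in> Z. F z = 0}" by (simp_all add: J_def S_def)
      moreover have "{z \<in> Z. F z = 0} = Z" using calculation by auto
      ultimately show False using assms by simp
    qed
  qed (auto simp: J_def)
  then obtain Q where Q: "prime_of UNIV Q" "J \<subseteq> Q" "Q \<inter> S = {}" by blast
  interpret prime_ideal UNIV Q by unfold_locales (rule U, rule Q)
  have inf: "infinite {z \<in> Z. \<forall>i\<in>I. F i z = 0}" if "finite I" "\<forall>i\<in>I. F i \<in> Q" for I :: "nat set" and F :: "nat \<Rightarrow> 'z \<Rightarrow> 'k"
  proof -
    \<comment> \<open>Finitely many members of Q combine into one with the same common zeros: at
      each z the coefficients, arbitrary functions of z, select an index where the value is nonzero,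
      if there is one.\<close>
    define s where "s z = (SOME i. i \<in> I \<and> F i z \<noteq> 0)" for z
    define u where "u i z = (if i = s z then 1 else 0 :: 'k)" for i and z :: 'z
    define G where "G = (\<Sum>i\<in>I. u i * F i)"
    have "G \<in> Q" unfolding G_def using that by (intro Z_sum Z_mult) auto
    moreover have "G z = 0 \<longleftrightarrow> (\<forall>i\<in>I. F i z = 0)" for z
    proof -
      have "G z = (\<Sum>i\<in>I. u i z * F i z)"
        unfolding G_def using that(1) by (induction I rule: finite_induct) auto
      also have "\<dots> = (if s z \<in> I then F (s z) z else 0)"
        using that(1) by (auto simp: u_def if_distrib[of "\<lambda>x. x * _"] sum.If_cases cong: if_cong)
      finally have e: "G z = (if s z \<in> I then F (s z) z else 0)" .
      show ?thesis
      proof (cases "\<exists>i. i \<in> I \<and> F i z \<noteq> 0")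
        case True
        then have "s z \<in> I \<and> F (s z) z \<noteq> 0" unfolding s_def by (rule someI_ex)
        then show ?thesis using e by auto
      next
        case False
        then show ?thesis using e by auto
      qed
    qed
    ultimately have "infinite {z \<in> Z. G z = 0}" using Q(3) by (auto simp: S_def)
    then show ?thesis using \<open>\<And>z. G z = 0 \<longleftrightarrow> (\<forall>i\<in>I. F i z = 0)\<close> by simp
  qed
  have "\<forall>F. (\<forall>z\<in>Z. F z = 0) \<longrightarrow> F \<in> Q" using Q(2) by (auto simp: J_def)
  with Q(1) inf show ?thesis by (intro exI[of _ Q] conjI allI impI) simp_all
qed

locale curve =
  fixes N :: nat and X :: "(nat \<Rightarrow> 'k::field_char_0) set set"
  assumes ac: "alg_closed_field TYPE('k)" and curve: "proj_curve N X" and nd: "nondegenerate N X"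
begin

definition "cone = \<Union>X"

lemma X_PN: "X \<subseteq> PN N"
  using curve by (auto simp: proj_curve_def zclosed_def zero_set_def)

lemma cone_vecs: "v \<in> cone \<Longrightarrow> v \<in> vecs N" and cone_nonzero: "v \<in> cone \<Longrightarrow> v \<noteq> (\<lambda>_. 0)"
  and cone_pt: "v \<in> cone \<Longrightarrow> pt v \<in> X"
proof -
  assume "v \<in> cone"
  then obtain p where "p \<in> X" "v \<in> p" by (auto simp: cone_def)
  then show "v \<in> vecs N" "v \<noteq> (\<lambda>_. 0)" "pt v \<in> X" using X_PN PN_D[of p N v] by auto
qed

lemma pt_cone: "pt v \<in> X \<Longrightarrow> v \<in> cone"
  using pt_self by (auto simp: cone_def)

lemma cone_scale:
  assumes "v \<in> cone" "c \<noteq> 0"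
  shows "(\<lambda>i. c * v i) \<in> cone"
  using cone_pt[OF assms(1)] by (intro pt_cone) (simp add: pt_scale[OF assms(2)])

lemma cone_closed:
  assumes "v \<in> vecs N" "v \<noteq> (\<lambda>_. 0)" "\<And>d f. hm N d f \<Longrightarrow> (\<And>w. w \<in> cone \<Longrightarrow> f w = 0) \<Longrightarrow> f v = 0"
  shows "v \<in> cone"
proof -
  obtain G where G: "\<And>f. f \<in> G \<Longrightarrow> \<exists>d. hm N d f" "X = hzeros N G"
    using curve zclosedE unfolding proj_curve_def by metis
  have "f v = 0" if "f \<in> G" for f
  proof -
    obtain d where "hm N d f" using G(1) \<open>f \<in> G\<close> by blast
    moreover have "f w = 0" if w: "w \<in> cone" for w
    proof -
      obtain p where "p \<in> X" "w \<in> p" using w by (auto simp: cone_def)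
      then show ?thesis using \<open>f \<in> G\<close> unfolding G(2) hzeros_def by blast
    qed
    ultimately show ?thesis by (rule assms(3))
  qed
  then show ?thesis using pt_in_hzeros[OF assms(1,2) G(1)] G(2) pt_cone by blast
qed

lemma cone_irreducible:
  assumes f: "hm N d f" and g: "hm N e g" and fg: "\<And>v. v \<in> cone \<Longrightarrow> f v * g v = 0"
  shows "(\<forall>v\<in>cone. f v = 0) \<or> (\<forall>v\<in>cone. g v = 0)"
proof -
  have "zclosed N (hzeros N {f})" "zclosed N (hzeros N {g})" using f g by (auto intro!: zclosed_hzeros)
  moreover have "X \<subseteq> hzeros N {f} \<union> hzeros N {g}"
  proof
    fix p assume p: "p \<in> X"
    then have pP: "p \<in> PN N" using X_PN by auto
    then obtain v where v: "v \<in> p" using PN_nonempty by blast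
    then have "f v * g v = 0" using fg p by (auto simp: cone_def)
    then show "p \<in> hzeros N {f} \<union> hzeros N {g}"
      using pP hm_pt[OF pP v f] hm_pt[OF pP v g] by (auto simp: hzeros_def)
  qed
  ultimately have "X \<subseteq> hzeros N {f} \<or> X \<subseteq> hzeros N {g}"
    using curve unfolding proj_curve_def zirred_def by blast
  then show ?thesis by (auto simp: cone_def hzeros_def)
qed

lemma cone_nondegenerate:
  assumes "hm N (Suc 0) f" "\<And>v. v \<in> cone \<Longrightarrow> f v = 0"
  shows "f v = 0"
proof -
  obtain c where c: "hpoly N (Suc 0) c" "peval N c = f" using hm_hpoly[OF assms(1)] by blast
  have "X \<subseteq> zero_set N {c}" using assms(2) c X_PN by (auto simp: zero_set_def cone_def)
  then have "c = (\<lambda>_. 0)" using nd c(1) unfolding nondegenerate_def by auto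
  then show ?thesis using c(2) by (auto simp: peval_def)
qed

text \<open>P^0 is a single point, whereas a chain of length 1 in X needs two points.\<close>

lemma N_pos: "N \<ge> 1"
proof (rule ccontr)
  assume "\<not> N \<ge> 1"
  then have N: "N = 0" by simp
  have "zdim_ge N X 1" using curve by (simp add: proj_curve_def)
  then obtain Y where "\<forall>i\<le>1. zclosed N (Y i) \<and> zirred N (Y i)" "\<forall>i<1. Y i \<subset> Y (Suc i)" "Y 1 \<subseteq> X"
    unfolding zdim_ge_def by blast
  then have Y: "Y 0 \<noteq> {}" "Y 0 \<subset> Y (Suc 0)" "Y (Suc 0) \<subseteq> X" by (auto simp: zirred_def)
  then obtain p q :: "(nat \<Rightarrow> 'k) set" where "p \<in> PN N" "q \<in> PN N" "p \<noteq> q" using X_PN by blast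
  moreover obtain v w where "v \<in> p" "w \<in> q" using calculation PN_nonempty by blast
  ultimately have "pt v \<noteq> pt w" "v \<in> vecs 0" "w \<in> vecs 0" "v \<noteq> (\<lambda>_. 0)" "w \<noteq> (\<lambda>_. 0)"
    using PN_D N by metis+
  then show False using pt_eqI[of v 0 w 0] vec_nonzero_coord[of v 0] vec_nonzero_coord[of w 0] by auto
qed

text \<open>
  Restricting such a prime ideal of functions on an infinite hyperplane section to polynomials
  gives an irreducible closed subset that is not a point, hence a chain of length 2 in X.
\<close>

lemma finite_hyperplane_section:
  assumes b: "hm N (Suc 0) b" and b0: "b u \<noteq> 0"
  shows "finite {p \<in> X. \<forall>v\<in>p. b v = 0}"
proof (rule ccontr)
  define S where "S = {p \<in> X. \<forall>v\<in>p. b v = 0}"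
  assume "infinite {p \<in> X. \<forall>v\<in>p. b v = 0}"
  then have "infinite S" by (simp add: S_def)
  from prime_on_infinite_set[OF this] obtain P :: "((nat \<Rightarrow> 'k) set \<Rightarrow> 'k) set"
    where PP: "prime_of UNIV P \<and> (\<forall>F. (\<forall>z\<in>S. F z = 0) \<longrightarrow> F \<in> P) \<and>
    (\<forall>(I::nat set) F. finite I \<longrightarrow> (\<forall>i\<in>I. F i \<in> P) \<longrightarrow> infinite {z \<in> S. \<forall>i\<in>I. F i z = 0})"
    by (elim exE) (rule that)
  have P: "prime_of UNIV P" using PP by (rule conjunct1)
  have P0: "F \<in> P" if "\<And>z. z \<in> S \<Longrightarrow> F z = 0" for F
    using PP[THEN conjunct2, THEN conjunct1] that by simp
  have Pinf: "infinite {z \<in> S. \<forall>i\<in>I. F i z = 0}" if "finite I" "\<And>i. i \<in> I \<Longrightarrow> F i \<in> P" for I :: "nat set" and F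
    using PP[THEN conjunct2, THEN conjunct2] that by simp
  have SP: "S \<subseteq> PN N" using X_PN by (auto simp: S_def)
  define rep :: "(nat \<Rightarrow> 'k) set \<Rightarrow> nat \<Rightarrow> 'k" where "rep z = (SOME v. v \<in> z)" for z
  have rep: "rep z \<in> z" if "z \<in> PN N" for z unfolding rep_def using PN_nonempty[OF that] by (rule someI_ex)
  \<comment> \<open>The pullback of the prime to polynomials along z -> \<open>rep z\<close>. For
    forms, vanishing at a point does not depend on the chosen representative.\<close>
  define Q where "Q = {f \<in> polyring N. (\<lambda>z. f (rep z)) \<in> P}"
  have Qprime: "prime_of (polyring N) Q"
  proof -
    define T :: "((nat \<Rightarrow> 'k) \<Rightarrow> 'k) \<Rightarrow> (nat \<Rightarrow> 'k) set \<Rightarrow> 'k" where "T f = (\<lambda>z. f (rep z))" for f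
    have T: "T (f + g) = T f + T g" "T (f * g) = T f * T g" "T 0 = 0" "T 1 = 1" for f g
      by (auto simp: T_def)
    have Q: "f \<in> Q \<longleftrightarrow> f \<in> polyring N \<and> T f \<in> P" for f by (simp add: Q_def T_def)
    note R = subringD[OF subring_polyring[of N]]
    have P': "0 \<in> P" "1 \<notin> P" "\<And>x y. x \<in> P \<Longrightarrow> y \<in> P \<Longrightarrow> x + y \<in> P"
      "\<And>x y. y \<in> P \<Longrightarrow> x * y \<in> P" "\<And>x y. x * y \<in> P \<Longrightarrow> x \<in> P \<or> y \<in> P"
      using P by (auto simp: prime_of_def)
    show ?thesis unfolding prime_of_def
    proof (intro conjI ballI impI subsetI)
      fix x y assume "x \<in> polyring N" "y \<in> polyring N" "x * y \<in> Q"
      then show "x \<in> Q \<or> y \<in> Q" using P'(5)[of "T x" "T y"] by (simp add: Q T)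
    qed (auto simp: Q T P' intro: R)
  qed
  interpret prime_ideal "polyring N" Q by unfold_locales (rule subring_polyring, rule Qprime)
  obtain i0 where i0: "i0 \<le> N" "(\<lambda>v. v i0) \<notin> Q"
  proof (rule ccontr)
    assume "\<not> thesis"
    then have "\<And>i. i \<le> N \<Longrightarrow> (\<lambda>v. v i) \<in> Q" using that by blast
    then have "infinite {z \<in> S. \<forall>i\<in>{..N}. rep z i = 0}"
      by (intro Pinf[of "{..N}" "\<lambda>i z. rep z i"]) (auto simp: Q_def)
    moreover have "{z \<in> S. \<forall>i\<in>{..N}. rep z i = 0} = {}"
    proof (rule ccontr)
      assume "\<not> ?thesis"
      then obtain z where z: "z \<in> S" "\<forall>i\<in>{..N}. rep z i = 0" by blast
      then have "z \<in> PN N" using SP by blast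
      from vec_nonzero_coord[OF PN_D(1,2)[OF this rep[OF this]]] show False using z by auto
    qed
    ultimately show False by simp
  qed
  define Y where "Y = hzeros N {f \<in> Q. \<exists>d. hm N d f}"
  have YQ: "f \<in> Q" if f: "hm N d f" "\<And>y v. y \<in> Y \<Longrightarrow> v \<in> y \<Longrightarrow> f v = 0" for d f
  proof (rule ccontr)
    assume "f \<notin> Q"
    \<comment> \<open>The factor x_i0 keeps the vector supplied by the Nullstellensatz away from the
      origin, so that it defines a point.\<close>
    then have "(\<lambda>v. v i0) * f \<notin> Q" using Z_prime hm_polyring[OF f(1)] hm_polyring[OF hm_var[OF i0(1)]] i0(2) by blast
    then have "(\<lambda>v. v i0 * f v) \<notin> Q" by (simp add: times_fun_def)
    then obtain v where v: "v \<in> vecs N" "v i0 * f v \<noteq> 0" "\<And>e g. hm N e g \<Longrightarrow> g \<in> Q \<Longrightarrow> g v = 0"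
      using nullstellensatz[OF ac Qprime hm_Suc[OF i0(1) f(1)]] by blast
    have "pt v \<in> Y" unfolding Y_def using v by (intro pt_in_hzeros) auto
    then show False using f(2) pt_self v(2) by auto
  qed
  have QY: "f v = 0" if "hm N d f" "f \<in> Q" "y \<in> Y" "v \<in> y" for d f y v
    using that by (auto simp: Y_def hzeros_def)
  have Yclosed: "zclosed N Y" unfolding Y_def by (intro zclosed_hzeros) auto
  have Yirr: "zirred N Y" unfolding zirred_def
  proof (intro conjI allI impI)
    show "Y \<noteq> {}"
    proof
      assume "Y = {}"
      then have "(\<lambda>_. 1) \<in> Q" by (intro YQ[OF hm_const]) auto
      then show False using Z1 by (simp add: one_fun_def)
    qed
    fix C1 C2 assume C: "zclosed N C1" "zclosed N C2" "Y \<subseteq> C1 \<union> C2"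
    have sep: "\<exists>d f. hm N d f \<and> f \<notin> Q \<and> (\<forall>y\<in>C. \<forall>v\<in>y. f v = 0)" if CC: "zclosed N C" "\<not> Y \<subseteq> C" for C
    proof -
      obtain G where G: "\<And>f. f \<in> G \<Longrightarrow> \<exists>d. hm N d f" "C = hzeros N G" using zclosedE[OF CC(1)] by metis
      obtain y where "y \<in> Y" "y \<notin> C" using CC(2) by blast
      then obtain f v where "f \<in> G" "v \<in> y" "f v \<noteq> 0" by (auto simp: G(2) hzeros_def Y_def)
      moreover obtain d where "hm N d f" using G(1) \<open>f \<in> G\<close> by blast
      moreover have "\<forall>y\<in>C. \<forall>v\<in>y. f v = 0" using \<open>f \<in> G\<close> unfolding G(2) hzeros_def by blast
      ultimately show ?thesis using QY \<open>y \<in> Y\<close> by blast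
    qed
    show "Y \<subseteq> C1 \<or> Y \<subseteq> C2"
    proof (rule ccontr)
      assume "\<not> ?thesis"
      then have n: "\<not> Y \<subseteq> C1" "\<not> Y \<subseteq> C2" by auto
      obtain d f where f: "hm N d f" "f \<notin> Q" "\<forall>y\<in>C1. \<forall>v\<in>y. f v = 0" using sep[OF C(1) n(1)] by blast
      obtain e g where g: "hm N e g" "g \<notin> Q" "\<forall>y\<in>C2. \<forall>v\<in>y. g v = 0" using sep[OF C(2) n(2)] by blast
      have "(\<lambda>v. f v * g v) \<in> Q" using f g C(3) by (intro YQ[OF hm_mult]) auto
      then have "f * g \<in> Q" by (simp add: times_fun_def)
      then show False using Z_prime hm_polyring f g by blast
    qed
  qed
  have YS: "Y \<subseteq> S"
  proof
    fix y assume y: "y \<in> Y"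
    obtain G where G: "\<And>f. f \<in> G \<Longrightarrow> \<exists>d. hm N d f" "X = hzeros N G"
      using curve zclosedE unfolding proj_curve_def by metis
    have fQ: "f \<in> Q" if "hm N d f" "\<And>z v. z \<in> S \<Longrightarrow> v \<in> z \<Longrightarrow> f v = 0" for d f
    proof -
      have "(\<lambda>z. f (rep z)) \<in> P"
      proof (rule P0)
        fix z assume "z \<in> S"
        then show "f (rep z) = 0" using SP by (intro that(2)[of z] rep) auto
      qed
      then show ?thesis using hm_polyring[OF that(1)] by (simp add: Q_def)
    qed
    have *: "f v = 0" if "hm N d f" "\<And>z v. z \<in> S \<Longrightarrow> v \<in> z \<Longrightarrow> f v = 0" "v \<in> y" for d f v
      using QY[OF that(1) _ y that(3)] that(1,2) fQ by blast
    have "y \<in> PN N" using y by (auto simp: Y_def hzeros_def)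
    moreover have "f v = 0" if f: "f \<in> G" "v \<in> y" for f v
    proof -
      obtain d where "hm N d f" using G f by blast
      moreover have "f w = 0" if "z \<in> S" "w \<in> z" for z w
        using that f(1) G(2) unfolding S_def hzeros_def by blast
      ultimately show ?thesis using f(2) by (rule *)
    qed
    ultimately have "y \<in> hzeros N G" by (auto simp: hzeros_def)
    then have "y \<in> X" using G(2) by simp
    then show "y \<in> S" using *[OF b] by (auto simp: S_def)
  qed
  obtain z0 where z0: "z0 \<in> Y" using Yirr by (auto simp: zirred_def)
  have zP: "z0 \<in> PN N" using z0 by (auto simp: Y_def hzeros_def)
  define w where "w = rep z0"
  have w: "w \<in> z0" "w \<in> vecs N" "w \<noteq> (\<lambda>_. 0)" "z0 = pt w" using rep[OF zP] PN_D[OF zP] by (auto simp: w_def)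
  obtain k where k: "k \<le> N" "w k \<noteq> 0" using vec_nonzero_coord w by blast
  \<comment> \<open>These are 2 x 2 minors of the pair v, w. With pivot w_k nonzero they vanish
    together exactly on multiples of w.\<close>
  define h where "h j v = w k * v j - w j * v k" for j and v :: "nat \<Rightarrow> 'k"
  have hh: "hm N (Suc 0) (h j)" if "j \<le> N" for j unfolding h_def[abs_def]
    by (intro hm_diff hm_scale hm_var that k)
  have h0: "z = z0" if "z \<in> PN N" "v \<in> z" "\<forall>j\<le>N. h j v = 0" for z v
  proof -
    have v: "v \<in> vecs N" "v \<noteq> (\<lambda>_. 0)" "z = pt v" using PN_D[OF that(1,2)] by auto
    obtain j where "j \<le> N" "v j \<noteq> 0" using vec_nonzero_coord v by blast
    then have "v k \<noteq> 0" using that(3) k by (auto simp: h_def)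
    then have "pt v = pt w" using that(3) k by (intro pt_eqI[OF v(1) w(2), of k]) (auto simp: h_def)
    then show ?thesis using v w by simp
  qed
  have hw: "h j v = 0" if "v \<in> z0" "j \<le> N" for j v
    using hm_pt[OF zP w(1) hh[OF that(2)]] that(1) by (auto simp: h_def)
  have z0h: "{z0} = hzeros N (h ` {..N})"
  proof (rule set_eqI)
    fix z
    have "z \<in> {z0}" if z: "z \<in> hzeros N (h ` {..N})"
    proof -
      have zP: "z \<in> PN N" using z by (simp add: hzeros_def)
      then obtain v where v: "v \<in> z" using PN_nonempty by blast
      then show ?thesis using h0[OF zP v] z by (auto simp: hzeros_def)
    qed
    moreover have "z0 \<in> hzeros N (h ` {..N})" using zP hw by (auto simp: hzeros_def)
    ultimately show "z \<in> {z0} \<longleftrightarrow> z \<in> hzeros N (h ` {..N})" by blast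
  qed
  \<comment> \<open>If Y were the point z0, all minors would lie in Q and hence vanish together at
    infinitely many points of S, although they do so only at z0.\<close>
  have ne: "{z0} \<noteq> Y"
  proof
    assume Y: "{z0} = Y"
    have "h j \<in> Q" if "j \<le> N" for j by (rule YQ[OF hh[OF that]]) (use Y hw that in auto)
    then have "infinite {z \<in> S. \<forall>j\<in>{..N}. h j (rep z) = 0}"
      by (intro Pinf[of "{..N}" "\<lambda>j z. h j (rep z)"]) (auto simp: Q_def)
    moreover have "{z \<in> S. \<forall>j\<in>{..N}. h j (rep z) = 0} \<subseteq> {z0}"
    proof
      fix z assume z: "z \<in> {z \<in> S. \<forall>j\<in>{..N}. h j (rep z) = 0}"
      then have "z \<in> PN N" using SP by auto
      then show "z \<in> {z0}" using h0[OF _ rep] z by auto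
    qed
    ultimately show False using finite_subset by blast
  qed
  have z0c: "zclosed N {z0}" unfolding z0h using hh by (intro zclosed_hzeros) auto
  have z0i: "zirred N {z0}" by (auto simp: zirred_def)
  have YX: "Y \<subset> X"
  proof -
    have "Y \<subseteq> X" using YS by (auto simp: S_def)
    moreover have "Y \<noteq> X"
    proof
      assume "Y = X"
      then have "b v = 0" if "v \<in> cone" for v using that YS by (auto simp: cone_def S_def)
      then show False using cone_nondegenerate[OF b] b0 by blast
    qed
    ultimately show ?thesis by blast
  qed
  have "zdim_ge N X 2"
    unfolding zdim_ge_def
  proof (intro exI[of _ "\<lambda>i. if i = 0 then {z0} else if i = 1 then Y else X"] conjI allI impI)
    fix i :: nat
    show "zclosed N (if i = 0 then {z0} else if i = 1 then Y else X)"
      "zirred N (if i = 0 then {z0} else if i = 1 then Y else X)"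
      using z0c z0i Yclosed Yirr curve by (auto simp: proj_curve_def)
    assume "i < 2"
    then show "(if i = 0 then {z0} else if i = 1 then Y else X) \<subset>
       (if Suc i = 0 then {z0} else if Suc i = 1 then Y else X)"
      using YX z0 ne by (cases "i = 0") auto
  qed auto
  then show False using curve by (simp add: proj_curve_def)
qed

end

section \<open>Pencils without base points\<close>

text \<open>Dimension bounds for spaces of functions on \<open>C\<close> are expressed through this:
  members of the span of r functions become dependent as soon as there are more than r of
  them.\<close>

definition lincomb :: "'v set \<Rightarrow> 'i set \<Rightarrow> ('i \<Rightarrow> 'v \<Rightarrow> 'k::field) \<Rightarrow> ('v \<Rightarrow> 'k) \<Rightarrow> bool" where
  "lincomb C I F f \<longleftrightarrow> (\<exists>\<kappa>. \<forall>v\<in>C. f v = (\<Sum>i\<in>I. \<kappa> i * F i v))"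

lemma lincomb_member: "finite I \<Longrightarrow> i \<in> I \<Longrightarrow> (\<And>v. v \<in> C \<Longrightarrow> f v = F i v) \<Longrightarrow> lincomb C I F f"
  unfolding lincomb_def
  by (rule exI[of _ "\<lambda>j. if j = i then 1 else 0"]) (simp add: if_distrib[of "\<lambda>x. x * _"] sum.delta cong: if_cong)

lemma lincomb_add:
  assumes "lincomb C I F f" "lincomb C I F g"
  shows "lincomb C I F (\<lambda>v. f v + g v)"
proof -
  obtain \<kappa> \<mu> where "\<forall>v\<in>C. f v = (\<Sum>i\<in>I. \<kappa> i * F i v)" "\<forall>v\<in>C. g v = (\<Sum>i\<in>I. \<mu> i * F i v)"
    using assms by (auto simp: lincomb_def)
  then show ?thesis unfolding lincomb_def
    by (intro exI[of _ "\<lambda>i. \<kappa> i + \<mu> i"]) (simp add: distrib_right sum.distrib)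
qed

lemma lincomb_scale:
  assumes "lincomb C I F f"
  shows "lincomb C I F (\<lambda>v. c * f v)"
proof -
  obtain \<kappa> where "\<forall>v\<in>C. f v = (\<Sum>i\<in>I. \<kappa> i * F i v)"
    using assms by (auto simp: lincomb_def)
  then show ?thesis unfolding lincomb_def
    by (intro exI[of _ "\<lambda>i. c * \<kappa> i"]) (simp add: sum_distrib_left mult.assoc)
qed

lemma lincomb_sum: "(\<And>j. j \<in> J \<Longrightarrow> lincomb C I F (G j)) \<Longrightarrow> lincomb C I F (\<lambda>v. \<Sum>j\<in>J. G j v)"
proof (induction J rule: infinite_finite_induct)
  case (insert j J)
  then show ?case using lincomb_add[of C I F "G j" "\<lambda>v. \<Sum>j\<in>J. G j v"] by simp
qed (auto simp: lincomb_def intro: exI[of _ "\<lambda>_. 0"])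

lemma lincomb_trans:
  assumes "lincomb C I F f" "\<And>i. i \<in> I \<Longrightarrow> lincomb C J G (F i)"
  shows "lincomb C J G f"
proof -
  obtain \<kappa> where \<kappa>: "\<forall>v\<in>C. f v = (\<Sum>i\<in>I. \<kappa> i * F i v)" using assms by (auto simp: lincomb_def)
  have "lincomb C J G (\<lambda>v. \<Sum>i\<in>I. \<kappa> i * F i v)" by (intro lincomb_sum lincomb_scale assms)
  then show ?thesis using \<kappa> by (auto simp: lincomb_def)
qed

lemma lincomb_mult:
  assumes "lincomb C I F f"
  shows "lincomb C I (\<lambda>i v. g v * F i v) (\<lambda>v. g v * f v)"
proof -
  obtain \<kappa> where "\<forall>v\<in>C. f v = (\<Sum>i\<in>I. \<kappa> i * F i v)"
    using assms by (auto simp: lincomb_def)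
  then show ?thesis unfolding lincomb_def
    by (intro exI[of _ \<kappa>]) (simp add: sum_distrib_left mult_ac)
qed

lemma lincomb_cong: "lincomb C I F g \<Longrightarrow> (\<And>v. v \<in> C \<Longrightarrow> f v = g v) \<Longrightarrow> lincomb C I F f"
  by (auto simp: lincomb_def)

lemma lincomb_dependent:
  assumes "finite I" "finite J" "card J < card I" "\<And>i. i \<in> I \<Longrightarrow> lincomb C J G (F i)"
  shows "\<exists>\<gamma>. (\<exists>i\<in>I. \<gamma> i \<noteq> 0) \<and> (\<forall>v\<in>C. (\<Sum>i\<in>I. \<gamma> i * F i v) = 0)"
proof -
  have "\<forall>i\<in>I. \<exists>\<kappa>. \<forall>v\<in>C. F i v = (\<Sum>j\<in>J. \<kappa> j * G j v)" using assms(4) by (auto simp: lincomb_def)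
  then obtain M where M: "\<And>i v. i \<in> I \<Longrightarrow> v \<in> C \<Longrightarrow> F i v = (\<Sum>j\<in>J. M i j * G j v)" by metis
  obtain \<gamma> where \<gamma>: "\<exists>i\<in>I. \<gamma> i \<noteq> 0" "\<forall>j\<in>J. (\<Sum>i\<in>I. \<gamma> i * M i j) = 0"
    using linear_system_nontrivial[OF assms(2,1,3), of M] by blast
  have "(\<Sum>i\<in>I. \<gamma> i * F i v) = 0" if "v \<in> C" for v
  proof -
    have "(\<Sum>i\<in>I. \<gamma> i * F i v) = (\<Sum>i\<in>I. \<Sum>j\<in>J. \<gamma> i * M i j * G j v)"
      by (intro sum.cong) (simp_all add: M that sum_distrib_left mult.assoc)
    also have "\<dots> = (\<Sum>j\<in>J. (\<Sum>i\<in>I. \<gamma> i * M i j) * G j v)"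
      by (subst sum.swap) (simp add: sum_distrib_right)
    finally show ?thesis using \<gamma> by simp
  qed
  then show ?thesis using \<gamma> by blast
qed

text \<open>Points are treated one by one: f + c g stays nonzero at the old points and becomes
  nonzero at the new one unless c is one of finitely many quotients - f v / g v.\<close>

lemma avoid_points:
  fixes L :: "('v \<Rightarrow> 'k::field_char_0) set"
  assumes L: "\<And>f g c. f \<in> L \<Longrightarrow> g \<in> L \<Longrightarrow> (\<lambda>v. f v + c * g v) \<in> L" and "L \<noteq> {}"
    and "finite F" "\<And>v. v \<in> F \<Longrightarrow> \<exists>f\<in>L. f v \<noteq> 0"
  shows "\<exists>f\<in>L. \<forall>v\<in>F. f v \<noteq> 0"
  using assms(3,4)
proof (induction F rule: finite_induct)
  case empty
  then show ?case using assms(2) by auto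
next
  case (insert u F)
  obtain f where f: "f \<in> L" "\<forall>v\<in>F. f v \<noteq> 0" using insert by auto
  obtain g where g: "g \<in> L" "g u \<noteq> 0" using insert.prems by auto
  have "infinite (UNIV :: 'k set)" by (rule infinite_UNIV_char_0)
  then obtain c where c: "c \<notin> (\<lambda>v. - f v / g v) ` insert u F"
    using ex_new_if_finite[OF _ finite_imageI] insert.hyps(1) by (metis finite_insert)
  have "f v + c * g v \<noteq> 0" if "v \<in> insert u F" for v
  proof
    assume e: "f v + c * g v = 0"
    then have "g v \<noteq> 0" using that f g by auto
    then have "c = - f v / g v" using e by (simp add: field_simps eq_neg_iff_add_eq_0)
    then show False using c that by blast
  qed
  then show ?case by (intro bexI[OF _ L[OF f(1) g(1), of c]] ballI)
qed

context curve
begin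

text \<open>Only the points of X with b = 0 impose a condition on a. They are finite in number, so
  \<open>avoid_points\<close> applies to one representative of each.\<close>

lemma base_point_free:
  assumes L: "\<And>f. f \<in> L \<Longrightarrow> hm N (Suc 0) f" "\<And>f g c. f \<in> L \<Longrightarrow> g \<in> L \<Longrightarrow> (\<lambda>v. f v + c * g v) \<in> L"
    and b: "b \<in> L" "b u \<noteq> 0" and bp: "\<And>v. v \<in> cone \<Longrightarrow> \<exists>f\<in>L. f v \<noteq> 0"
  shows "\<exists>a\<in>L. \<forall>v\<in>cone. a v \<noteq> 0 \<or> b v \<noteq> 0"
proof -
  define F where "F = {p \<in> X. \<forall>v\<in>p. b v = 0}"
  have finF: "finite F" unfolding F_def by (rule finite_hyperplane_section[OF L(1)[OF b(1)] b(2)])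
  define rep :: "(nat \<Rightarrow> 'k) set \<Rightarrow> nat \<Rightarrow> 'k" where "rep p = (SOME v. v \<in> p)" for p
  have rep: "rep p \<in> p" if "p \<in> X" for p
    unfolding rep_def using PN_nonempty X_PN that by (intro someI_ex[of "\<lambda>v. v \<in> p"]) blast
  have "\<exists>a\<in>L. \<forall>v\<in>rep ` F. a v \<noteq> 0"
  proof (rule avoid_points[OF L(2)])
    fix v assume "v \<in> rep ` F"
    then have "v \<in> cone" using rep by (auto simp: cone_def F_def)
    then show "\<exists>f\<in>L. f v \<noteq> 0" by (rule bp)
  qed (use b finF in auto)
  then obtain a where a: "a \<in> L" "\<And>p. p \<in> F \<Longrightarrow> a (rep p) \<noteq> 0" by auto
  have "a v \<noteq> 0" if v: "v \<in> cone" "b v = 0" for v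
  proof -
    obtain p where p: "p \<in> X" "v \<in> p" using v by (auto simp: cone_def)
    have pP: "p \<in> PN N" using p X_PN by auto
    have "p \<in> F" using hm_pt[OF pP p(2) L(1)[OF b(1)]] v(2) p(1) by (simp add: F_def)
    then have "a (rep p) \<noteq> 0" by (rule a)
    then show ?thesis using hm_pt[OF pP p(2) L(1)[OF a(1)]] rep[OF p(1)] by auto
  qed
  then show ?thesis using a(1) by blast
qed

end

section \<open>The coordinate ring of the cone as a finite module over k[a, b]\<close>

locale pencil = curve N X for N and X :: "(nat \<Rightarrow> 'k::field_char_0) set set" +
  fixes a b :: "(nat \<Rightarrow> 'k) \<Rightarrow> 'k"
  assumes a: "hm N (Suc 0) a" and b: "hm N (Suc 0) b" and bpf: "\<And>v. v \<in> cone \<Longrightarrow> a v \<noteq> 0 \<or> b v \<noteq> 0"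
begin

text \<open>If no power of x_i lay in the ideal generated by a, b and the functions vanishing on the
  cone, a prime containing this ideal and avoiding these powers would give a point of the cone with
  a = b = 0. The degree of g and h is then corrected by passing to homogeneous components.\<close>

lemma power_in_ideal:
  assumes i: "i \<le> N"
  shows "\<exists>M g h. hm N M g \<and> hm N M h \<and> (\<forall>v\<in>cone. v i ^ Suc M = a v * g v + b v * h v)"
proof -
  note R = subringD[OF subring_polyring[of N, where 'a='k]]
  define J where "J = {f \<in> polyring N. \<exists>g\<in>polyring N. \<exists>h\<in>polyring N. \<forall>v\<in>cone. f v = a v * g v + b v * h v}"
  define S :: "((nat \<Rightarrow> 'k) \<Rightarrow> 'k) set" where "S = range (\<lambda>n v. v i ^ n)"
  have vanish: "f \<in> J" if "hm N d f" "\<And>v. v \<in> cone \<Longrightarrow> f v = 0" for d f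
    unfolding J_def using that hm_polyring[OF that(1)] R(2) by (auto intro!: bexI[of _ 0])
  have "a \<in> J" unfolding J_def using hm_polyring[OF a] R(1,2)
    by (intro CollectI conjI bexI[of _ 1] bexI[of _ 0]) auto
  moreover have "b \<in> J" unfolding J_def using hm_polyring[OF b] R(1,2)
    by (intro CollectI conjI bexI[of _ 0] bexI[of _ 1]) auto
  ultimately have ab: "a \<in> J" "b \<in> J" .
  have "J \<inter> S \<noteq> {}"
  proof
    assume JS: "J \<inter> S = {}"
    have "\<exists>Z. prime_of (polyring N) Z \<and> J \<subseteq> Z \<and> Z \<inter> S = {}"
    proof (rule prime_avoiding[OF subring_polyring _ _ _ _ _ _ JS])
      show "0 \<in> J" using vanish[OF hm_zero] by (simp add: zero_fun_def)
      show "f + g \<in> J" if fg: "f \<in> J" "g \<in> J" for f g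
      proof -
        obtain p q p' q' where "p \<in> polyring N" "q \<in> polyring N" "\<forall>v\<in>cone. f v = a v * p v + b v * q v"
          "p' \<in> polyring N" "q' \<in> polyring N" "\<forall>v\<in>cone. g v = a v * p' v + b v * q' v"
          "f \<in> polyring N" "g \<in> polyring N"
          using fg by (auto simp: J_def)
        then show ?thesis unfolding J_def
          by (intro CollectI conjI R bexI[of _ "p + p'"] bexI[of _ "q + q'"]) (auto simp: algebra_simps)
      qed
      show "r * f \<in> J" if rf: "r \<in> polyring N" "f \<in> J" for r f
      proof -
        obtain p q where "p \<in> polyring N" "q \<in> polyring N" "\<forall>v\<in>cone. f v = a v * p v + b v * q v"
          "f \<in> polyring N" using rf by (auto simp: J_def)
        then show ?thesis unfolding J_def using rf(1)
          by (intro CollectI conjI R bexI[of _ "r * p"] bexI[of _ "r * q"]) (auto simp: algebra_simps)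
      qed
      show "1 \<in> S" unfolding S_def by (auto simp: one_fun_def intro!: image_eqI[of _ _ 0])
      show "f * g \<in> S" if "f \<in> S" "g \<in> S" for f g
        using that by (auto simp: S_def times_fun_def power_add[symmetric])
    qed (auto simp: J_def)
    then obtain Z where Z: "prime_of (polyring N) Z" "J \<subseteq> Z" "Z \<inter> S = {}" by blast
    have "(\<lambda>v. v i) \<in> S" unfolding S_def by (auto intro!: image_eqI[of _ _ 1])
    then have "(\<lambda>v. v i) \<notin> Z" using Z by blast
    then obtain v where v: "v \<in> vecs N" "v i \<noteq> 0" "\<And>e g. hm N e g \<Longrightarrow> g \<in> Z \<Longrightarrow> g v = 0"
      using nullstellensatz[OF ac Z(1) hm_var[OF i]] by blast
    have "v \<in> cone"
    proof (rule cone_closed[OF v(1)])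
      show "v \<noteq> (\<lambda>_. 0)" using v(2) by auto
      fix d f assume f: "hm N d f" "\<And>w. w \<in> cone \<Longrightarrow> f w = 0"
      then show "f v = 0" using v(3)[OF f(1)] vanish[OF f] Z(2) by blast
    qed
    moreover have "a v = 0" "b v = 0" using v(3) a b ab Z(2) by blast+
    ultimately show False using bpf by blast
  qed
  then obtain n g h where g: "g \<in> polyring N" "h \<in> polyring N"
    "\<And>v. v \<in> cone \<Longrightarrow> v i ^ n = a v * g v + b v * h v"
    by (auto simp: J_def S_def)
  \<comment> \<open>Multiplying the relation by x_i raises the exponent to \<open>Suc n\<close>. The
    components needed are then those of degree n, which makes sense for n = 0 too.\<close>
  have xi: "(\<lambda>v. v i) \<in> polyring N" by (rule hm_polyring[OF hm_var[OF i]])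
  obtain n1 G where G: "\<And>d. hm N d (G d)" "\<And>m. m \<ge> n1 \<Longrightarrow> (\<lambda>v. v i) * g = (\<lambda>v. \<Sum>d\<le>m. G d v)"
    using polyring_extend[OF R(4)[OF xi g(1)]] by metis
  obtain n2 H where H: "\<And>d. hm N d (H d)" "\<And>m. m \<ge> n2 \<Longrightarrow> (\<lambda>v. v i) * h = (\<lambda>v. \<Sum>d\<le>m. H d v)"
    using polyring_extend[OF R(4)[OF xi g(2)]] by metis
  define m where "m = max n (max n1 n2)"
  have Gm: "v i * g v = (\<Sum>d\<le>m. G d v)" for v using G(2)[of m, THEN fun_cong, of v] by (simp add: m_def)
  have Hm: "v i * h v = (\<Sum>d\<le>m. H d v)" for v using H(2)[of m, THEN fun_cong, of v] by (simp add: m_def)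
  have "v i ^ Suc n = a v * G n v + b v * H n v" if v: "v \<in> cone" for v
  proof -
    \<comment> \<open>The component of degree d + 1 of the difference of the two sides. Scaling v by
      x shows that all of them vanish; the one at d = n is the claim.\<close>
    define c where "c d = (if d = n then v i ^ Suc n else 0) - (a v * G d v + b v * H d v)" for d
    have *: "(\<Sum>d\<le>m. c d * x ^ Suc d) = 0" for x
    proof (cases "x = 0")
      case False
      let ?w = "\<lambda>j. x * v j"
      have w: "?w \<in> cone" by (rule cone_scale[OF v False])
      have "?w i ^ Suc n = a ?w * (?w i * g ?w) + b ?w * (?w i * h ?w)"
        using g(3)[OF w] by (simp add: algebra_simps)
      also have "\<dots> = a ?w * (\<Sum>d\<le>m. G d ?w) + b ?w * (\<Sum>d\<le>m. H d ?w)"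
        using Gm[of ?w] Hm[of ?w] by simp
      also have "\<dots> = (\<Sum>d\<le>m. (a v * G d v + b v * H d v) * x ^ Suc d)"
        using hm_homogeneous[OF a, of x v] hm_homogeneous[OF b, of x v]
          hm_homogeneous[OF G(1), of _ x v] hm_homogeneous[OF H(1), of _ x v]
        by (simp add: sum_distrib_left sum.distrib[symmetric] algebra_simps)
      also have "?w i ^ Suc n = (\<Sum>d\<le>m. (if d = n then v i ^ Suc n else 0) * x ^ Suc d)"
        by (subst sum.remove[of _ n]) (auto simp: m_def power_mult_distrib)
      finally show ?thesis by (simp add: c_def left_diff_distrib sum_subtractf)
    qed simp
    define c' where "c' d = (if d = 0 then 0 else c (d - 1))" for d
    have "(\<Sum>d\<le>Suc m. c' d * x ^ d) = 0" for x
      using * by (subst sum.atMost_Suc_shift) (simp add: c'_def)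
    from power_sum_eq_0[OF this, of "Suc n"] have "c n = 0" by (simp add: c'_def m_def)
    then show ?thesis by (simp add: c_def)
  qed
  then show ?thesis using G(1) H(1) by blast
qed

text \<open>Pigeonhole: D is (N + 1) M, so a monomial of degree above D has an exponent above M,
  hence contains a power of a variable that \<open>power_in_ideal\<close> rewrites.\<close>

lemma generation:
  "\<exists>D. \<forall>d f. hm N (Suc d) f \<longrightarrow> D \<le> d \<longrightarrow>
     (\<exists>g h. hm N d g \<and> hm N d h \<and> (\<forall>v\<in>cone. f v = a v * g v + b v * h v))"
proof -
  obtain M0 where M0: "\<And>i. i \<le> N \<Longrightarrow> \<exists>g h. hm N (M0 i) g \<and> hm N (M0 i) h \<and>
      (\<forall>v\<in>cone. v i ^ Suc (M0 i) = a v * g v + b v * h v)"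
    using power_in_ideal by metis
  define M where "M = (\<Sum>i\<le>N. M0 i)"
  define D where "D = (\<Sum>i\<le>N. M)"
  have mon: "\<exists>g h. hm N d g \<and> hm N d h \<and> (\<forall>v\<in>cone. monomial N \<alpha> v = a v * g v + b v * h v)"
    if \<alpha>: "\<alpha> \<in> expo N (Suc d)" and d: "D \<le> d" for \<alpha> d
  proof -
    have "\<exists>i\<le>N. \<alpha> i > M"
    proof (rule ccontr)
      assume "\<not> ?thesis"
      then have "(\<Sum>i\<le>N. \<alpha> i) \<le> D" unfolding D_def by (intro sum_mono) (auto simp: not_less)
      then show False using \<alpha> d by (simp add: expo_def)
    qed
    then obtain i where i: "i \<le> N" "\<alpha> i > M" by blast
    then have "M0 i \<le> M" unfolding M_def by (intro member_le_sum) auto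
    then have Mi: "M0 i < \<alpha> i" using i by simp
    obtain g h where g: "hm N (M0 i) g" "hm N (M0 i) h"
      "\<And>v. v \<in> cone \<Longrightarrow> v i ^ Suc (M0 i) = a v * g v + b v * h v"
      using M0[OF i(1)] by blast
    define \<beta> where "\<beta> = \<alpha>(i := \<alpha> i - Suc (M0 i))"
    have m: "monomial N \<alpha> v = v i ^ Suc (M0 i) * monomial N \<beta> v" for v :: "nat \<Rightarrow> 'k"
    proof -
      have "monomial N \<alpha> v = v i ^ \<alpha> i * (\<Prod>j\<in>{..N}-{i}. v j ^ \<alpha> j)"
        unfolding monomial_def using i by (intro prod.remove) auto
      moreover have "monomial N \<beta> v = v i ^ \<beta> i * (\<Prod>j\<in>{..N}-{i}. v j ^ \<beta> j)"
        unfolding monomial_def using i by (intro prod.remove) auto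
      moreover have "(\<Prod>j\<in>{..N}-{i}. v j ^ \<beta> j) = (\<Prod>j\<in>{..N}-{i}. v j ^ \<alpha> j)"
        by (intro prod.cong) (auto simp: \<beta>_def)
      moreover have "v i ^ \<alpha> i = v i ^ Suc (M0 i) * v i ^ \<beta> i"
        using Mi by (subst power_add[symmetric]) (simp add: \<beta>_def)
      ultimately show ?thesis by (simp add: mult_ac)
    qed
    have "\<beta> \<in> expo N (d - M0 i)" and dM: "M0 i \<le> d"
    proof -
      have "(\<Sum>j\<le>N. \<alpha> j) = \<alpha> i + (\<Sum>j\<in>{..N}-{i}. \<alpha> j)" using i by (intro sum.remove) auto
      moreover have "(\<Sum>j\<le>N. \<beta> j) = \<beta> i + (\<Sum>j\<in>{..N}-{i}. \<beta> j)" using i by (intro sum.remove) auto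
      moreover have "(\<Sum>j\<in>{..N}-{i}. \<beta> j) = (\<Sum>j\<in>{..N}-{i}. \<alpha> j)"
        by (intro sum.cong) (auto simp: \<beta>_def)
      moreover have "\<beta> i = \<alpha> i - Suc (M0 i)" by (simp add: \<beta>_def)
      moreover have "(\<Sum>j\<le>N. \<alpha> j) = Suc d" using \<alpha> by (simp add: expo_def)
      ultimately have "(\<Sum>j\<le>N. \<beta> j) = d - M0 i" "M0 i \<le> d" using Mi by auto
      then show "\<beta> \<in> expo N (d - M0 i)" "M0 i \<le> d" using \<alpha> i by (auto simp: expo_def \<beta>_def)
    qed
    then have hb: "hm N (d - M0 i) (monomial N \<beta> :: _ \<Rightarrow> 'k)" by (intro hm_monomial)
    have e: "M0 i + (d - M0 i) = d" using dM by simp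
    show ?thesis
    proof (intro exI conjI ballI)
      show "hm N d (\<lambda>v. g v * monomial N \<beta> v)" "hm N d (\<lambda>v. h v * monomial N \<beta> v)"
        by (rule hm_mult_eq[OF g(1) hb e], rule hm_mult_eq[OF g(2) hb e])
      fix v assume "v \<in> cone"
      then show "monomial N \<alpha> v = a v * (g v * monomial N \<beta> v) + b v * (h v * monomial N \<beta> v)"
        unfolding m[of v] using g(3)[of v] by (simp only: distrib_right mult.assoc)
    qed
  qed
  have "\<exists>g h. hm N d g \<and> hm N d h \<and> (\<forall>v\<in>cone. f v = a v * g v + b v * h v)"
    if f: "hm N (Suc d) f" and d: "D \<le> d" for d f
  proof -
    obtain \<gamma> where \<gamma>: "f = (\<lambda>v. \<Sum>\<alpha>\<in>expo N (Suc d). \<gamma> \<alpha> * monomial N \<alpha> v)" using hm_expand[OF f] by blast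
    obtain g h where gh: "\<And>\<alpha>. \<alpha> \<in> expo N (Suc d) \<Longrightarrow> hm N d (g \<alpha>) \<and> hm N d (h \<alpha>) \<and>
       (\<forall>v\<in>cone. monomial N \<alpha> v = a v * g \<alpha> v + b v * h \<alpha> v)" using mon[OF _ d] by metis
    show ?thesis
    proof (intro exI conjI ballI)
      show "hm N d (\<lambda>v. \<Sum>\<alpha>\<in>expo N (Suc d). \<gamma> \<alpha> * g \<alpha> v)" "hm N d (\<lambda>v. \<Sum>\<alpha>\<in>expo N (Suc d). \<gamma> \<alpha> * h \<alpha> v)"
        using gh by (auto intro!: hm_sum hm_scale)
      fix v assume "v \<in> cone"
      then show "f v = a v * (\<Sum>\<alpha>\<in>expo N (Suc d). \<gamma> \<alpha> * g \<alpha> v) + b v * (\<Sum>\<alpha>\<in>expo N (Suc d). \<gamma> \<alpha> * h \<alpha> v)"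
        unfolding \<gamma> using gh by (simp add: sum_distrib_left sum.distrib[symmetric] algebra_simps)
    qed
  qed
  then show ?thesis by blast
qed

definition W :: "nat \<times> nat \<times> (nat \<Rightarrow> nat) \<Rightarrow> (nat \<Rightarrow> 'k) \<Rightarrow> 'k" where
  "W = (\<lambda>(s, t, \<alpha>) v. a v ^ s * (b v ^ t * monomial N \<alpha> v))"

text \<open>Iterating \<open>generation\<close> lowers the degree to at most D, where
  \<open>E\<close> contains all exponents. The indices s, t <= d are not tied to the degree of the
  form, so after enlarging d one family of (d + 1)^2 card E functions covers all degrees up to
  d.\<close>

lemma spanning:
  "\<exists>E. finite E \<and> (\<forall>d f. hm N d f \<longrightarrow> lincomb cone ({..d} \<times> {..d} \<times> E) W f)"
proof -
  obtain D where D: "\<And>d f. hm N (Suc d) f \<Longrightarrow> D \<le> d \<Longrightarrow>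
     \<exists>g h. hm N d g \<and> hm N d h \<and> (\<forall>v\<in>cone. f v = a v * g v + b v * h v)"
    using generation by blast
  define E where "E = (\<Union>e\<le>D. expo N e)"
  have finE: "finite E" by (auto simp: E_def expo_finite)
  have "lincomb cone ({..d} \<times> {..d} \<times> E) W f" if "hm N d f" for d f
    using that
  proof (induction d arbitrary: f)
    case 0
    obtain \<gamma> where \<gamma>: "f = (\<lambda>v. \<Sum>\<alpha>\<in>expo N 0. \<gamma> \<alpha> * monomial N \<alpha> v)" using hm_expand[OF 0] by blast
    show ?case unfolding \<gamma>
      by (intro lincomb_sum lincomb_scale lincomb_member[of _ "(0, 0, _)"]) (auto simp: E_def W_def finE[unfolded E_def])
  next
    case (Suc d)
    show ?case
    proof (cases "D \<le> d")
      case True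
      obtain g h where gh: "hm N d g" "hm N d h" "\<And>v. v \<in> cone \<Longrightarrow> f v = a v * g v + b v * h v"
        using D[OF Suc.prems True] by blast
      have 1: "lincomb cone ({..Suc d} \<times> {..Suc d} \<times> E) W (\<lambda>v. a v * g v)"
      proof (rule lincomb_trans[OF lincomb_mult[OF Suc.IH[OF gh(1)]]])
        fix \<omega> assume "\<omega> \<in> {..d} \<times> {..d} \<times> E"
        then obtain s t \<alpha> where "\<omega> = (s, t, \<alpha>)" "s \<le> d" "t \<le> d" "\<alpha> \<in> E" by auto
        then show "lincomb cone ({..Suc d} \<times> {..Suc d} \<times> E) W (\<lambda>v. a v * W \<omega> v)"
          by (intro lincomb_member[of _ "(Suc s, t, \<alpha>)"]) (auto simp: finE W_def)
      qed
      have 2: "lincomb cone ({..Suc d} \<times> {..Suc d} \<times> E) W (\<lambda>v. b v * h v)"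
      proof (rule lincomb_trans[OF lincomb_mult[OF Suc.IH[OF gh(2)]]])
        fix \<omega> assume "\<omega> \<in> {..d} \<times> {..d} \<times> E"
        then obtain s t \<alpha> where "\<omega> = (s, t, \<alpha>)" "s \<le> d" "t \<le> d" "\<alpha> \<in> E" by auto
        then show "lincomb cone ({..Suc d} \<times> {..Suc d} \<times> E) W (\<lambda>v. b v * W \<omega> v)"
          by (intro lincomb_member[of _ "(s, Suc t, \<alpha>)"]) (auto simp: finE W_def)
      qed
      show ?thesis by (rule lincomb_cong[OF lincomb_add[OF 1 2] gh(3)])
    next
      case False
      obtain \<gamma> where \<gamma>: "f = (\<lambda>v. \<Sum>\<alpha>\<in>expo N (Suc d). \<gamma> \<alpha> * monomial N \<alpha> v)" using hm_expand[OF Suc.prems] by blast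
      show ?thesis unfolding \<gamma>
      proof (intro lincomb_sum lincomb_scale)
        fix \<alpha> assume "\<alpha> \<in> expo N (Suc d)"
        then have "\<alpha> \<in> E" using False by (auto simp: E_def)
        then show "lincomb cone ({..Suc d} \<times> {..Suc d} \<times> E) W (monomial N \<alpha>)"
          by (intro lincomb_member[of _ "(0, 0, \<alpha>)"]) (auto simp: finE W_def)
      qed
    qed
  qed
  then show ?thesis using finE by blast
qed

end

section \<open>Dimension of secant varieties\<close>

lemma lincomb_prod:
  assumes "lincomb C I F f" "lincomb C J G g"
  shows "lincomb C (I \<times> J) (\<lambda>(i, j) v. F i v * G j v) (\<lambda>v. f v * g v)"
proof -
  obtain \<kappa> \<mu> where "\<forall>v\<in>C. f v = (\<Sum>i\<in>I. \<kappa> i * F i v)" "\<forall>v\<in>C. g v = (\<Sum>j\<in>J. \<mu> j * G j v)"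
    using assms by (auto simp: lincomb_def)
  then show ?thesis unfolding lincomb_def
    by (intro exI[of _ "\<lambda>(i, j). \<kappa> i * \<mu> j"])
      (simp add: sum_product sum.cartesian_product case_prod_unfold mult_ac)
qed

lemma lincomb_mono:
  assumes "lincomb C I F f" "I \<subseteq> J" "finite J"
  shows "lincomb C J F f"
  by (rule lincomb_trans[OF assms(1)]) (use assms in \<open>auto intro: lincomb_member\<close>)

lemma lincomb_compose: "lincomb C I F f \<Longrightarrow> (\<And>u. u \<in> D \<Longrightarrow> \<sigma> u \<in> C) \<Longrightarrow>
    lincomb D I (\<lambda>i u. F i (\<sigma> u)) (\<lambda>u. f (\<sigma> u))"
  unfolding lincomb_def by blast

text \<open>Binomial expansion, used to peel off one summand of a sum of k points at a time. The
  degrees of both factors stay at most d.\<close>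

lemma hm_add_expand:
  "hm N d f \<Longrightarrow> \<exists>ps. (\<forall>(g, h)\<in>set ps. \<exists>e\<le>d. hm N e g \<and> hm N (d - e) h) \<and>
     (\<forall>v w. f (\<lambda>i. v i + w i) = (\<Sum>(g, h)\<leftarrow>ps. g v * h w))"
proof (induction rule: hm.induct)
  case (hm_const c)
  show ?case by (rule exI[of _ "[(\<lambda>_. 1, \<lambda>_. c)]"]) (auto intro: hm.hm_const)
next
  case (hm_Suc i d f)
  then obtain ps where ps: "\<forall>(g, h)\<in>set ps. \<exists>e\<le>d. hm N e g \<and> hm N (d - e) h"
     "\<And>v w. f (\<lambda>i. v i + w i) = (\<Sum>(g, h)\<leftarrow>ps. g v * h w)" by blast
  define qs where "qs = map (\<lambda>(g, h). (\<lambda>v. v i * g v, h)) ps @ map (\<lambda>(g, h). (g, \<lambda>v. v i * h v)) ps"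
  have "\<exists>e\<le>Suc d. hm N e g' \<and> hm N (Suc d - e) h'" if "(g', h') \<in> set qs" for g' h'
  proof -
    obtain g h where gh: "(g, h) \<in> set ps"
      "(g', h') = (\<lambda>v. v i * g v, h) \<or> (g', h') = (g, \<lambda>v. v i * h v)"
      using \<open>(g', h') \<in> set qs\<close> by (auto simp: qs_def)
    then obtain e where e: "e \<le> d" "hm N e g" "hm N (d - e) h" using ps(1) by blast
    from gh(2) show ?thesis
    proof
      assume *: "(g', h') = (\<lambda>v. v i * g v, h)"
      then show ?thesis using e hm.hm_Suc[OF hm_Suc(1) e(2)] by (intro exI[of _ "Suc e"]) auto
    next
      assume *: "(g', h') = (g, \<lambda>v. v i * h v)"
      then show ?thesis using e hm.hm_Suc[OF hm_Suc(1) e(3)] by (intro exI[of _ e]) (auto simp: Suc_diff_le)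
    qed
  qed
  moreover have "(v i + w i) * f (\<lambda>i. v i + w i) = (\<Sum>(g, h)\<leftarrow>qs. g v * h w)" for v w
  proof -
    have "(\<Sum>(g, h)\<leftarrow>qs. g v * h w) = v i * (\<Sum>(g, h)\<leftarrow>ps. g v * h w) + w i * (\<Sum>(g, h)\<leftarrow>ps. g v * h w)"
      unfolding qs_def by (simp add: sum_list_const_mult[symmetric] comp_def case_prod_unfold mult_ac)
    then show ?thesis unfolding ps(2) by (simp add: distrib_right)
  qed
  ultimately show ?case by blast
next
  case (hm_add d f f')
  then obtain ps qs where "\<forall>(g, h)\<in>set ps. \<exists>e\<le>d. hm N e g \<and> hm N (d - e) h"
     "\<And>v w. f (\<lambda>i. v i + w i) = (\<Sum>(g, h)\<leftarrow>ps. g v * h w)"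
     "\<forall>(g, h)\<in>set qs. \<exists>e\<le>d. hm N e g \<and> hm N (d - e) h"
     "\<And>v w. f' (\<lambda>i. v i + w i) = (\<Sum>(g, h)\<leftarrow>qs. g v * h w)" by blast
  then show ?case by (intro exI[of _ "ps @ qs"]) auto
qed

lemma lincomb_sum_list:
  "(\<And>x. x \<in> set xs \<Longrightarrow> lincomb C I F (G x)) \<Longrightarrow> lincomb C I F (\<lambda>v. \<Sum>x\<leftarrow>xs. G x v)"
proof (induction xs)
  case Nil
  then show ?case by (auto simp: lincomb_def intro: exI[of _ "\<lambda>_. 0"])
next
  case (Cons x xs)
  then show ?case using lincomb_add[of C I F "G x" "\<lambda>v. \<Sum>x\<leftarrow>xs. G x v"] by simp
qed

text \<open>The top coefficient f u is recorded because it guarantees a zero on every line whose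
  direction u satisfies f u \<noteq> 0, when d is positive.\<close>

lemma hm_on_line:
  fixes f :: "(nat \<Rightarrow> 'k::field) \<Rightarrow> 'k"
  shows "hm N d f \<Longrightarrow> \<exists>P. degree P \<le> d \<and> coeff P d = f u \<and> (\<forall>x. f (\<lambda>i. v i + x * u i) = poly P x)"
proof (induction rule: hm.induct)
  case (hm_const c)
  show ?case by (rule exI[of _ "[:c:]"]) auto
next
  case (hm_Suc i d f)
  then obtain P where P: "degree P \<le> d" "coeff P d = f u" "\<And>x. f (\<lambda>i. v i + x * u i) = poly P x" by blast
  have "degree ([:v i, u i:] * P) \<le> Suc d"
    using degree_mult_le[of "[:v i, u i:]" P] P(1) by (auto split: if_splits)
  then show ?case using P by (intro exI[of _ "[:v i, u i:] * P"]) (auto simp: coeff_eq_0 algebra_simps)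
next
  case (hm_add d f g)
  then obtain P Q where "degree P \<le> d" "coeff P d = f u" "\<And>x. f (\<lambda>i. v i + x * u i) = poly P x"
    "degree Q \<le> d" "coeff Q d = g u" "\<And>x. g (\<lambda>i. v i + x * u i) = poly Q x" by blast
  then show ?case by (intro exI[of _ "P + Q"]) (auto intro: degree_add_le)
qed

definition vsum :: "nat \<Rightarrow> (nat \<Rightarrow> nat \<Rightarrow> 'k::field) \<Rightarrow> nat \<Rightarrow> 'k" where
  "vsum k u = (\<lambda>i. \<Sum>j<k. u j i)"

context pencil
begin

text \<open>
  Points of rank less than k are sums of k vectors some of which are zero; None indexes the
  indicator function of the zero vector.
\<close>

definition "cone0 = insert (\<lambda>_. 0) cone"

definition W0 :: "(nat \<times> nat \<times> (nat \<Rightarrow> nat)) option \<Rightarrow> (nat \<Rightarrow> 'k) \<Rightarrow> 'k" where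
  "W0 \<omega> v = (case \<omega> of None \<Rightarrow> if v = (\<lambda>_. 0) then 1 else 0
     | Some \<omega> \<Rightarrow> if v = (\<lambda>_. 0) then 0 else W \<omega> v)"

lemma lincomb_cone0:
  assumes "lincomb cone I W f" "finite I"
  shows "lincomb cone0 (insert None (Some ` I)) W0 f"
proof -
  obtain \<kappa> where \<kappa>: "\<forall>v\<in>cone. f v = (\<Sum>i\<in>I. \<kappa> i * W i v)" using assms by (auto simp: lincomb_def)
  define \<mu> where "\<mu> \<omega> = (case \<omega> of None \<Rightarrow> f (\<lambda>_. 0) | Some i \<Rightarrow> \<kappa> i)" for \<omega>
  have "f v = (\<Sum>\<omega>\<in>insert None (Some ` I). \<mu> \<omega> * W0 \<omega> v)" if v: "v \<in> cone0" for v
  proof -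
    have "(\<Sum>\<omega>\<in>insert None (Some ` I). \<mu> \<omega> * W0 \<omega> v) = \<mu> None * W0 None v + (\<Sum>i\<in>I. \<mu> (Some i) * W0 (Some i) v)"
      using assms(2) by (subst sum.insert) (auto simp: sum.reindex)
    also have "\<dots> = f v"
    proof (cases "v = (\<lambda>_. 0)")
      case False
      then have "v \<in> cone" using v by (simp add: cone0_def)
      then show ?thesis using False \<kappa> by (simp add: \<mu>_def W0_def)
    qed (simp add: \<mu>_def W0_def)
    finally show ?thesis by simp
  qed
  then show ?thesis by (auto simp: lincomb_def)
qed

text \<open>A function of a sum of k points is a combination of products with one factor for each
  point. All degrees are at most \<open>D\<close>, so the same index set serves every factor and
  lists of length k index the products.\<close>

lemma vsum_lincomb:
  assumes E: "finite E" "\<And>d f. hm N d f \<Longrightarrow> lincomb cone ({..d} \<times> {..d} \<times> E) W f"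
    and d: "d \<le> D" "hm N d f"
  shows "lincomb {u. \<forall>j. u j \<in> cone0} {xs. set xs \<subseteq> insert None (Some ` ({..D} \<times> {..D} \<times> E)) \<and> length xs = k}
    (\<lambda>xs u. \<Prod>j<k. W0 (xs ! j) (u j)) (\<lambda>u. f (vsum k u))"
  using d
proof (induction k arbitrary: d f)
  case 0
  have "{xs. set xs \<subseteq> insert None (Some ` ({..D} \<times> {..D} \<times> E)) \<and> length xs = 0} = {[]}" by auto
  then show ?case by (auto simp: lincomb_def vsum_def)
next
  case (Suc k)
  let ?U = "{u. \<forall>j. u j \<in> cone0}"
  let ?\<Omega> = "insert None (Some ` ({..D} \<times> {..D} \<times> E))"
  let ?\<Lambda> = "\<lambda>k. {xs. set xs \<subseteq> ?\<Omega> \<and> length xs = k}"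
  let ?G = "\<lambda>k xs u. \<Prod>j<k. W0 (xs ! j) (u j)"
  have fin: "finite (?\<Lambda> m)" for m using E(1) by (intro finite_lists_length_eq) auto
  obtain ps where ps: "\<forall>(g, h)\<in>set ps. \<exists>e\<le>d. hm N e g \<and> hm N (d - e) h"
     "\<And>v w. f (\<lambda>i. v i + w i) = (\<Sum>(g, h)\<leftarrow>ps. g v * h w)" using hm_add_expand[OF Suc.prems(2)] by blast
  have f: "f (vsum (Suc k) u) = (\<Sum>x\<leftarrow>ps. fst x (vsum k u) * snd x (u k))" for u
    using ps(2)[of "vsum k u" "u k"] by (simp add: vsum_def case_prod_unfold)
  have "lincomb ?U (?\<Lambda> (Suc k)) (?G (Suc k)) (\<lambda>u. fst x (vsum k u) * snd x (u k))" if x: "x \<in> set ps" for x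
  proof -
    obtain e where e: "e \<le> d" "hm N e (fst x)" "hm N (d - e) (snd x)" using ps(1) x by force
    have 1: "lincomb ?U (?\<Lambda> k) (?G k) (\<lambda>u. fst x (vsum k u))" using e Suc.prems by (intro Suc.IH[of e]) auto
    have "lincomb cone ({..D} \<times> {..D} \<times> E) W (snd x)"
      by (rule lincomb_mono[OF E(2)[OF e(3)]]) (use Suc.prems E(1) in auto)
    then have "lincomb cone0 ?\<Omega> W0 (snd x)" using E(1) by (intro lincomb_cone0) auto
    then have 2: "lincomb ?U ?\<Omega> (\<lambda>\<omega> u. W0 \<omega> (u k)) (\<lambda>u. snd x (u k))" by (rule lincomb_compose) auto
    show ?thesis
    proof (rule lincomb_trans[OF lincomb_prod[OF 1 2]])
      fix y assume "y \<in> ?\<Lambda> k \<times> ?\<Omega>"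
      then obtain xs \<omega> where y: "y = (xs, \<omega>)" "xs \<in> ?\<Lambda> k" "\<omega> \<in> ?\<Omega>" by blast
      then have m: "xs @ [\<omega>] \<in> ?\<Lambda> (Suc k)" by auto
      have "?G k xs u * W0 \<omega> (u k) = ?G (Suc k) (xs @ [\<omega>]) u" for u
        using y(2) by (simp add: nth_append)
      then show "lincomb ?U (?\<Lambda> (Suc k)) (?G (Suc k)) ((\<lambda>(i, j) v. ?G k i v * W0 j (v k)) y)"
        unfolding y(1) by (intro lincomb_member[OF fin m]) simp
    qed
  qed
  then show ?case unfolding f by (rule lincomb_sum_list)
qed

text \<open>More monomials in the m_i than independent functions on k-fold sums give a relation F.
  It is a polynomial in the m_i, hence constant on their common fibres, and it is nonzero as a
  polynomial, hence nonzero at some tuple w of values. Callers exhibit a vector with these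
  values.\<close>

lemma dimension_bound:
  fixes m :: "nat \<Rightarrow> (nat \<Rightarrow> 'k) \<Rightarrow> 'k"
  assumes I: "finite I" "2 * k < card I" and m: "\<forall>i\<in>I. hm N (Suc 0) (m i)"
  shows "\<exists>\<delta> F w. hm N \<delta> F \<and> (\<forall>u. (\<forall>j. u j \<in> cone0) \<longrightarrow> F (vsum k u) = 0) \<and>
    (\<forall>v v'. (\<forall>i\<in>I. m i v = m i v') \<longrightarrow> F v = F v') \<and> (\<forall>v. (\<forall>i\<in>I. m i v = w i) \<longrightarrow> F v \<noteq> 0)"
proof -
  obtain E where E: "finite E" "\<And>d f. hm N d f \<Longrightarrow> lincomb cone ({..d} \<times> {..d} \<times> E) W f"
    using spanning by blast
  define n where "n = card I"
  \<comment> \<open>Chosen so that the index set for one point has at most c (e + 1)^2 elements: D +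
    1 <= (n + 1)(e + 1), and the summand 1 accounts for \<open>None\<close>.\<close>
  define c where "c = (n + 1)^2 * card E + 1"
  \<comment> \<open>At most (c (e + 1)^2)^k = e (e + 1)^(2k) functions span a space that contains (e + 1)^n monomials.\<close>
  define e where "e = c ^ k"
  define D where "D = n * e"
  let ?\<Omega> = "insert None (Some ` ({..D} \<times> {..D} \<times> E))"
  let ?\<Lambda> = "{xs. set xs \<subseteq> ?\<Omega> \<and> length xs = k}"
  let ?U = "{u. \<forall>j. u j \<in> cone0}"
  define F where "F \<alpha> v = (\<Prod>i\<in>I. m i v ^ \<alpha> i)" for \<alpha> :: "nat \<Rightarrow> nat" and v
  have F: "hm N (\<Sum>i\<in>I. \<alpha> i) (F \<alpha>)" for \<alpha>
    using hm_prod[of I N "\<lambda>i. \<alpha> i * Suc 0" "\<lambda>i v. m i v ^ \<alpha> i"] hm_power m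
    unfolding F_def[abs_def] by fastforce
  have deg: "(\<Sum>i\<in>I. \<alpha> i) \<le> D" if "\<alpha> \<in> box I e" for \<alpha>
    using sum_bounded_above[of I \<alpha> e] that by (auto simp: D_def n_def box_def)
  have card: "card ?\<Lambda> < card (box I e)"
  proof -
    have "card ?\<Omega> = card ({..D} \<times> {..D} \<times> E) + 1"
      using E(1) by (subst card_insert_disjoint) (auto simp: card_image)
    also have "\<dots> = (D + 1)^2 * card E + 1" by (simp add: card_cartesian_product power2_eq_square algebra_simps)
    also have "D + 1 \<le> (n + 1) * (e + 1)" by (simp add: D_def)
    then have "(D + 1)^2 * card E + 1 \<le> ((n + 1) * (e + 1))^2 * card E + (e + 1)^2"
      by (intro add_mono mult_right_mono power_mono) auto
    also have "\<dots> = c * (e + 1)^2" unfolding c_def power_mult_distrib by (simp only: distrib_left distrib_right mult_1 mult_1_right mult_ac)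
    finally have "card ?\<Omega> ^ k \<le> (c * (e + 1)^2) ^ k" by (intro power_mono) auto
    also have "\<dots> = e * (e + 1) ^ (2 * k)" by (simp add: e_def power_mult_distrib power_mult)
    also have "\<dots> < (e + 1) * (e + 1) ^ (2 * k)" by simp
    also have "\<dots> = (e + 1) ^ Suc (2 * k)" by simp
    also have "\<dots> \<le> (e + 1) ^ card I" using I(2) by (intro power_increasing) auto
    also have "\<dots> = card (box I e)" using box_card[OF I(1)] by simp
    finally show ?thesis using E(1) by (subst card_lists_length_eq) auto
  qed
  have "finite ?\<Lambda>" using E(1) by (intro finite_lists_length_eq) auto
  moreover have "finite (box I e)" using box_card[OF I(1)] by simp
  ultimately obtain \<gamma> where \<gamma>: "\<exists>\<alpha>\<in>box I e. \<gamma> \<alpha> \<noteq> 0"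
    "\<And>u. u \<in> ?U \<Longrightarrow> (\<Sum>\<alpha>\<in>box I e. \<gamma> \<alpha> * F \<alpha> (vsum k u)) = 0"
    using lincomb_dependent[OF _ _ card, of ?U "\<lambda>xs u. \<Prod>j<k. W0 (xs ! j) (u j)" "\<lambda>\<alpha> u. F \<alpha> (vsum k u)"]
      vsum_lincomb[OF E deg F] by blast
  obtain \<alpha>0 where \<alpha>0: "\<alpha>0 \<in> box I e" "\<gamma> \<alpha>0 \<noteq> 0" using \<gamma>(1) by blast
  \<comment> \<open>The relation mixes degrees, so the homogeneous part containing a monomial with
    nonzero coefficient is kept. It still vanishes on the sums because these are stable under
    scaling.\<close>
  define \<delta> where "\<delta> = (\<Sum>i\<in>I. \<alpha>0 i)"
  define B where "B d = {\<alpha> \<in> box I e. (\<Sum>i\<in>I. \<alpha> i) = d}" for d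
  define H where "H d v = (\<Sum>\<alpha>\<in>B d. \<gamma> \<alpha> * F \<alpha> v)" for d v
  have finb: "finite (box I e)" using box_card[OF I(1)] by simp
  have "hm N \<delta> (H \<delta>)" unfolding H_def[abs_def]
    using F by (intro hm_sum hm_scale) (auto simp: B_def)
  moreover have "H \<delta> (vsum k u) = 0" if u: "\<forall>j. u j \<in> cone0" for u
  proof (rule power_sum_eq_0[where a = "\<lambda>d. H d (vsum k u)" and e = D])
    show "\<delta> \<le> D" unfolding \<delta>_def by (rule deg[OF \<alpha>0(1)])
    fix x
    let ?u = "\<lambda>j i. x * u j i"
    have "(\<lambda>i. x * u j i) \<in> cone0" for j
      using u[rule_format, of j] cone_scale[of "u j" x] by (cases "x = 0") (auto simp: cone0_def)
    then have "?u \<in> ?U" by simp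
    then have "0 = (\<Sum>\<alpha>\<in>box I e. \<gamma> \<alpha> * F \<alpha> (vsum k ?u))" using \<gamma>(2) by simp
    also have "vsum k ?u = (\<lambda>i. x * vsum k u i)" by (simp add: vsum_def sum_distrib_left)
    also have "(\<Sum>\<alpha>\<in>box I e. \<gamma> \<alpha> * F \<alpha> (\<lambda>i. x * vsum k u i)) =
      (\<Sum>\<alpha>\<in>box I e. \<gamma> \<alpha> * (x ^ (\<Sum>i\<in>I. \<alpha> i) * F \<alpha> (vsum k u)))"
      by (simp add: hm_homogeneous[OF F])
    also have "\<dots> = (\<Sum>d\<le>D. \<Sum>\<alpha>\<in>B d. \<gamma> \<alpha> * (x ^ (\<Sum>i\<in>I. \<alpha> i) * F \<alpha> (vsum k u)))"
      unfolding B_def using deg finb by (intro sum.group[symmetric]) auto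
    also have "\<dots> = (\<Sum>d\<le>D. H d (vsum k u) * x ^ d)"
      unfolding H_def sum_distrib_right by (intro sum.cong) (auto simp: B_def mult_ac)
    finally show "(\<Sum>d\<le>D. H d (vsum k u) * x ^ d) = 0" by simp
  qed
  moreover have "H \<delta> v = H \<delta> v'" if "\<forall>i\<in>I. m i v = m i v'" for v v'
    using that unfolding H_def F_def by (intro sum.cong arg_cong2[of _ _ _ _ "(*)"] prod.cong) auto
  \<comment> \<open>If no tuple w worked, this part would vanish as a polynomial function of free
    variables w_i, against independence of monomials.\<close>
  moreover have "\<exists>w. \<forall>v. (\<forall>i\<in>I. m i v = w i) \<longrightarrow> H \<delta> v \<noteq> 0"
  proof (rule ccontr)
    assume no: "\<not> ?thesis"
    define \<gamma>' where "\<gamma>' \<alpha> = (if \<alpha> \<in> B \<delta> then \<gamma> \<alpha> else 0)" for \<alpha>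
    have "(\<Sum>\<alpha>\<in>box I e. \<gamma>' \<alpha> * (\<Prod>i\<in>I. w i ^ \<alpha> i)) = 0" for w
    proof -
      obtain v where v: "\<forall>i\<in>I. m i v = w i" "H \<delta> v = 0" using no by blast
      have "H \<delta> v = (\<Sum>\<alpha>\<in>box I e. \<gamma>' \<alpha> * F \<alpha> v)" unfolding H_def
        by (rule sum.mono_neutral_cong_left) (use finb in \<open>auto simp: B_def \<gamma>'_def\<close>)
      also have "\<dots> = (\<Sum>\<alpha>\<in>box I e. \<gamma>' \<alpha> * (\<Prod>i\<in>I. w i ^ \<alpha> i))" using v(1) by (simp add: F_def)
      finally show ?thesis using v(2) by simp
    qed
    from box_independent[OF I(1) this \<alpha>0(1)] show False using \<alpha>0 by (simp add: \<gamma>'_def B_def \<delta>_def)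
  qed
  ultimately show ?thesis by blast
qed

end

section \<open>Generic fibres of a pencil\<close>

lemma sum_fun_apply: "(sum f I) v = (\<Sum>i\<in>I. f i v)" for f :: "'i \<Rightarrow> 'v \<Rightarrow> 'k::comm_ring_1"
  by (induction I rule: infinite_finite_induct) auto

lemma power_fun_apply: "(f ^ n) v = f v ^ n" for f :: "'v \<Rightarrow> 'k::comm_ring_1"
  by (induction n) auto

text \<open>Coefficients in \<open>const_funs\<close> are scalars in disguise; evaluating them at
  the arbitrary argument \<open>undefined\<close> recovers an ordinary polynomial over k.\<close>

lemma poly_const_funs:
  fixes y :: "(nat \<Rightarrow> 'k::field) \<Rightarrow> 'k"
  assumes p: "cpoly const_funs p"
  shows "coeff p i = (\<lambda>v. coeff (map_poly (\<lambda>f. f undefined) p) i)"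
    and "poly p y = (\<lambda>v. poly (map_poly (\<lambda>f. f undefined) p) (y v))"
proof -
  have c: "coeff p i = (\<lambda>v. coeff p i undefined)" for i
    using cpolyD[OF p, of i] by (auto simp: const_funs_def)
  define q where "q = map_poly (\<lambda>f. f undefined) p"
  have q: "coeff q i = coeff p i undefined" for i by (simp add: q_def coeff_map_poly)
  show "coeff p i = (\<lambda>v. coeff (map_poly (\<lambda>f. f undefined) p) i)"
    unfolding q_def[symmetric] q by (rule c)
  have "poly p y v = poly q (y v)" for v
  proof -
    have cv: "coeff p i v = coeff p i undefined" for i using fun_cong[OF c, of i v] .
    have "poly p y v = (\<Sum>i\<le>degree p. coeff q i * y v ^ i)"
      unfolding poly_altdef sum_fun_apply times_fun_apply power_fun_apply
      by (intro sum.cong) (auto simp: cv q)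
    also have "\<dots> = (\<Sum>i\<le>degree q. coeff q i * y v ^ i)"
    proof (rule sum.mono_neutral_right)
      have "degree q \<le> degree p" by (rule degree_le) (auto simp: q coeff_eq_0)
      then show "{..degree q} \<subseteq> {..degree p}" by simp
    qed (auto simp: coeff_eq_0)
    finally show ?thesis by (simp add: poly_altdef)
  qed
  then show "poly p y = (\<lambda>v. poly (map_poly (\<lambda>f. f undefined) p) (y v))" by (auto simp: q_def)
qed

lemma adj_const_funsD:
  fixes y :: "(nat \<Rightarrow> 'k::field) \<Rightarrow> 'k"
  shows "x \<in> adj const_funs y \<Longrightarrow> \<exists>q. \<forall>v. x v = poly q (y v)"
  using poly_const_funs(2) by (fastforce simp: adj_def)

lemma adj_const_funsI:
  fixes y :: "(nat \<Rightarrow> 'k::field) \<Rightarrow> 'k"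
  shows "(\<lambda>v. \<Sum>i\<le>n. c i * y v ^ i) \<in> adj const_funs y"
proof -
  define p where "p = (\<Sum>i\<le>n. monom (\<lambda>v :: nat \<Rightarrow> 'k. c i) i)"
  have "coeff p i \<in> const_funs" for i
  proof -
    have "coeff p i = (if i \<le> n then (\<lambda>v. c i) else 0)" by (simp add: p_def coeff_sum)
    then show ?thesis by (auto simp: const_funs_def zero_fun_def)
  qed
  moreover have "poly p y = (\<lambda>v. \<Sum>i\<le>n. c i * y v ^ i)"
    by (rule ext) (simp add: p_def poly_sum poly_monom sum_fun_apply power_fun_apply)
  ultimately show ?thesis
    unfolding adj_def cpoly_def by (intro CollectI exI[of _ p]) simp
qed

section \<open>The affine chart b = 1 and its coordinate ring\<close>

context pencil
begin

text \<open>The part of X off the hyperplane b = 0, with each point represented by its vector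
  normalised to b = 1. Forms of different degrees can be compared as functions here.\<close>

definition "C = {v \<in> cone. b v = 1}"

definition "ZC = {f \<in> polyring N. \<forall>v\<in>C. f v = 0}"

text \<open>By scaling, f b vanishes on the whole cone. The cone is irreducible and b is not zero on
  it by nondegeneracy, so f vanishes on it.\<close>

lemma zero_on_C:
  assumes b0: "b u \<noteq> 0" and f: "hm N d f" "\<And>v. v \<in> C \<Longrightarrow> f v = 0" and v: "v \<in> cone"
  shows "f v = 0"
proof -
  have "f w * b w = 0" if w: "w \<in> cone" for w
  proof (cases "b w = 0")
    case False
    define w' where "w' = (\<lambda>i. inverse (b w) * w i)"
    have "w' \<in> cone" unfolding w'_def using cone_scale[OF w, of "inverse (b w)"] False by simp
    moreover have "b w' = 1" unfolding w'_def using hm_homogeneous[OF b, of "inverse (b w)" w] False by simp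
    ultimately have "f w' = 0" by (intro f) (simp add: C_def)
    then show ?thesis unfolding w'_def using hm_homogeneous[OF f(1), of "inverse (b w)" w] False by simp
  qed simp
  then show ?thesis using cone_irreducible[OF f(1) b] cone_nondegenerate[OF b] b0 v by blast
qed

text \<open>Missing degrees are filled up with powers of b, which equal 1 on
  \<open>C\<close>.\<close>

lemma homogenize:
  assumes "f \<in> polyring N"
  shows "\<exists>d f'. hm N d f' \<and> (\<forall>v\<in>C. f' v = f v)"
proof -
  obtain n F where F: "\<And>d. hm N d (F d)" "f = (\<lambda>v. \<Sum>d\<le>n. F d v)"
    using assms by (auto simp: polyring_def)
  have "hm N n (\<lambda>v. \<Sum>d\<le>n. F d v * b v ^ (n - d))"
  proof (rule hm_sum)
    fix d assume "d \<in> {..n}"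
    then show "hm N n (\<lambda>v. F d v * b v ^ (n - d))" using hm_mult[OF F(1) hm_power[OF b]] by (metis add_diff_inverse_nat atMost_iff not_le mult.right_neutral One_nat_def)
  qed
  moreover have "\<forall>v\<in>C. (\<Sum>d\<le>n. F d v * b v ^ (n - d)) = f v" by (simp add: C_def F(2))
  ultimately show ?thesis by blast
qed

lemma ZC_prime:
  assumes b0: "b u \<noteq> 0"
  shows "prime_of (polyring N) ZC"
  unfolding prime_of_def
proof (intro conjI ballI impI)
  note R = subringD[OF subring_polyring[of N, where 'a='k]]
  show "ZC \<subseteq> polyring N" "0 \<in> ZC" using R by (auto simp: ZC_def)
  show "1 \<notin> ZC"
  proof
    assume "1 \<in> ZC"
    then have "C = {}" by (auto simp: ZC_def)
    then have "b v = 0" if "v \<in> cone" for v using zero_on_C[OF b0 b _ that] by blast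
    then show False using cone_nondegenerate[OF b] b0 by blast
  qed
  show "x + y \<in> ZC" if "x \<in> ZC" "y \<in> ZC" for x y using that R by (auto simp: ZC_def)
  show "x * y \<in> ZC" if "x \<in> polyring N" "y \<in> ZC" for x y using that R by (auto simp: ZC_def)
  fix x y assume xy: "x \<in> polyring N" "y \<in> polyring N" "x * y \<in> ZC"
  obtain d x' where x': "hm N d x'" "\<And>v. v \<in> C \<Longrightarrow> x' v = x v" using homogenize[OF xy(1)] by blast
  obtain e y' where y': "hm N e y'" "\<And>v. v \<in> C \<Longrightarrow> y' v = y v" using homogenize[OF xy(2)] by blast
  have "x' v * y' v = 0" if "v \<in> cone" for v
  proof (rule zero_on_C[OF b0 hm_mult[OF x'(1) y'(1)] _ that])
    fix w assume "w \<in> C"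
    then show "x' w * y' w = 0" using xy(3) x'(2) y'(2) by (auto simp: ZC_def)
  qed
  from cone_irreducible[OF x'(1) y'(1) this] have "(\<forall>v\<in>cone. x' v = 0) \<or> (\<forall>v\<in>cone. y' v = 0)" by blast
  moreover have "C \<subseteq> cone" by (auto simp: C_def)
  ultimately have "(\<forall>v\<in>C. x v = 0) \<or> (\<forall>v\<in>C. y v = 0)" using x'(2) y'(2) by (metis subsetD)
  then show "x \<in> ZC \<or> y \<in> ZC" using xy by (auto simp: ZC_def)
qed

text \<open>A binary form over an algebraically closed field is a product of linear factors. By
  primality a factor l - c m vanishes on \<open>C\<close>; the remaining possibility, a power of m,
  is excluded because m is not zero on \<open>C\<close>.\<close>

lemma linear_factor:
  assumes b0: "b u \<noteq> 0" and l: "l \<in> polyring N" and m: "m \<in> polyring N" and m0: "\<exists>v\<in>C. m v \<noteq> 0"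
    and P: "P \<noteq> 0" "degree P \<le> n" "\<And>v. v \<in> C \<Longrightarrow> (\<Sum>i\<le>n. coeff P i * l v ^ i * m v ^ (n - i)) = 0"
  shows "\<exists>c. \<forall>v\<in>C. l v = c * m v"
  using P
proof (induction "degree P" arbitrary: P n)
  interpret prime_ideal "polyring N" ZC by unfold_locales (rule subring_polyring, rule ZC_prime[OF b0])
  note R = subringD[OF R] subring_power[OF R] subring_sum[OF R]
  have cf: "(\<lambda>v. c) \<in> polyring N" for c :: 'k using const_funs_polyring by (auto simp: const_funs_def)
  have mZ: "m \<notin> ZC" using m0 by (auto simp: ZC_def)
  { case 0
    then have "(\<Sum>i\<le>n. coeff P i * l v ^ i * m v ^ (n - i)) = coeff P 0 * m v ^ n" for v
      by (subst sum.remove[of _ 0]) (auto simp: coeff_eq_0)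
    moreover have "coeff P 0 \<noteq> 0" using 0 by (metis leading_coeff_0_iff)
    ultimately have "m v ^ n = 0" if "v \<in> C" for v using 0(4)[OF that] by simp
    then have "m ^ n \<in> ZC" using R(7)[OF m] by (auto simp: ZC_def power_fun_apply)
    then show ?case using Z_power[OF m] mZ by blast }
  { case (Suc d)
    obtain c where c: "poly P c = 0" using ac Suc.hyps(2) unfolding alg_closed_field_def
      by (metis le_add1 plus_1_eq_Suc)
    then obtain Q where Q: "P = [:-c, 1:] * Q" by (meson dvd_def poly_eq_0_iff_dvd)
    have Q0: "Q \<noteq> 0" using Suc.prems Q by auto
    have dQ: "degree P = Suc (degree Q)" unfolding Q using Q0 by (subst degree_mult_eq) auto
    then obtain k where n: "n = Suc k" "degree Q \<le> k" using Suc.prems(2) by (cases n) auto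
    have cP: "coeff P i = (if i = 0 then 0 else coeff Q (i - 1)) - c * coeff Q i" for i
      unfolding Q by (cases i) auto
    define S where "S v = (\<Sum>i\<le>k. coeff Q i * l v ^ i * m v ^ (k - i))" for v
    have "(\<Sum>i\<le>n. coeff P i * l v ^ i * m v ^ (n - i)) = (l v - c * m v) * S v" for v
    proof -
      have "(\<Sum>i\<le>Suc k. (if i = 0 then 0 else coeff Q (i - 1)) * l v ^ i * m v ^ (Suc k - i)) = l v * S v"
        by (subst sum.atMost_Suc_shift) (simp add: S_def sum_distrib_left mult_ac)
      moreover have "(\<Sum>i\<le>Suc k. c * coeff Q i * l v ^ i * m v ^ (Suc k - i)) = c * m v * S v"
        using n(2) by (simp add: S_def sum_distrib_left mult_ac coeff_eq_0 Suc_diff_le)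
      ultimately show ?thesis unfolding n cP by (simp add: left_diff_distrib sum_subtractf)
    qed
    then have *: "(l v - c * m v) * S v = 0" if "v \<in> C" for v using Suc.prems(3)[OF that] by simp
    have 1: "(\<lambda>v. l v - c * m v) \<in> polyring N"
      using R(3)[OF l R(4)[OF cf m]] by (simp add: fun_diff_def times_fun_def)
    have "(\<Sum>i\<le>k. (\<lambda>v. coeff Q i) * l ^ i * m ^ (k - i)) \<in> polyring N" by (intro R cf l m)
    moreover have "(\<Sum>i\<le>k. (\<lambda>v. coeff Q i) * l ^ i * m ^ (k - i)) = S"
      by (rule ext) (simp add: S_def sum_fun_apply power_fun_apply)
    ultimately have 2: "S \<in> polyring N" by simp
    have "(\<lambda>v. l v - c * m v) * S \<in> ZC" using * R(4)[OF 1 2] by (simp add: ZC_def)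
    then consider "(\<lambda>v. l v - c * m v) \<in> ZC" | "S \<in> ZC" using Z_prime[OF 1 2] by blast
    then show ?case
    proof cases
      case 1
      then show ?thesis by (auto simp: ZC_def)
    next
      case 2
      then show ?thesis using Suc.hyps(1)[of Q k] Suc.hyps(2) dQ Q0 n(2) by (simp add: ZC_def S_def)
    qed }
qed

lemma C_nonempty: "b u \<noteq> 0 \<Longrightarrow> C \<noteq> {}"
  using ZC_prime[of u] by (auto simp: prime_of_def ZC_def subringD(1)[OF subring_polyring])

text \<open>With m = 1 in \<open>linear_factor\<close>, l is a constant c on \<open>C\<close>. Thus
  l - c b vanishes on the cone, and by nondegeneracy everywhere.\<close>

lemma poly_vanish_C:
  assumes b0: "b u \<noteq> 0" and l: "hm N (Suc 0) l" and P: "P \<noteq> 0" "\<And>v. v \<in> C \<Longrightarrow> poly P (l v) = 0"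
  shows "\<exists>c. \<forall>v. l v = c * b v"
proof -
  have "\<exists>c. \<forall>v\<in>C. l v = c * (\<lambda>_. 1) v"
    using C_nonempty[OF b0] P
    by (intro linear_factor[OF b0 hm_polyring[OF l] hm_polyring[OF hm_const] _ P(1) order_refl])
      (auto simp: poly_altdef)
  then obtain c where c: "\<And>v. v \<in> C \<Longrightarrow> l v = c" by auto
  have h: "hm N (Suc 0) (\<lambda>v. l v - c * b v)" by (intro hm_diff hm_scale l b)
  have "l v - c * b v = 0" if "v \<in> cone" for v
    by (rule zero_on_C[OF b0 h _ that]) (use c in \<open>auto simp: C_def\<close>)
  from cone_nondegenerate[OF h this] show ?thesis by (intro exI[of _ c]) auto
qed

lemma linear_form_not_multiple: "\<exists>l. hm N (Suc 0) l \<and> \<not> (\<exists>c. \<forall>v. l v = c * b v)"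
proof (rule ccontr)
  assume "\<not> ?thesis"
  then have *: "\<exists>c. \<forall>v. l v = c * b v" if "hm N (Suc 0) l" for l using that by blast
  obtain c where c: "\<And>v. v 0 = c * b v" using *[OF hm_var[of 0]] by auto
  obtain d where d: "\<And>v. v 1 = d * b v" using *[OF hm_var[of 1]] N_pos by auto
  let ?e = "\<lambda>k i. if i = k then 1 else 0 :: 'k"
  have "c * b (?e 0) = 1" "d * b (?e 0) = 0" using c[of "?e 0"] d[of "?e 0"] by auto
  then have "d = 0" by auto
  then show False using d[of "?e 1"] by simp
qed

text \<open>A relation makes a proportional to b, so a is constant on \<open>C\<close> and the
  monomials in the finite set \<open>E\<close> already span all forms there. The powers of any
  linear form l are then dependent, so l is a multiple of b. For N >= 1 this fails for some
  l.\<close>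

lemma a_transcendental:
  assumes b0: "b u \<noteq> 0" and P: "\<And>v. v \<in> C \<Longrightarrow> poly P (a v) = 0"
  shows "P = 0"
proof (rule ccontr)
  assume "P \<noteq> 0"
  then obtain c where c: "\<And>v. a v = c * b v" using poly_vanish_C[OF b0 a _ P] by blast
  obtain E where E: "finite E" "\<And>d f. hm N d f \<Longrightarrow> lincomb cone ({..d} \<times> {..d} \<times> E) W f"
    using spanning by blast
  have lin: "lincomb C E (monomial N) f" if "hm N d f" for d f
  proof (rule lincomb_trans)
    show "lincomb C ({..d} \<times> {..d} \<times> E) W f" using E(2)[OF that] by (auto simp: lincomb_def C_def)
    fix \<omega> assume "\<omega> \<in> {..d} \<times> {..d} \<times> E"
    then obtain s t \<alpha> where \<omega>: "\<omega> = (s, t, \<alpha>)" "\<alpha> \<in> E" by auto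
    have "lincomb C E (monomial N) (\<lambda>v. c ^ s * monomial N \<alpha> v)"
      by (intro lincomb_scale lincomb_member[OF E(1) \<omega>(2)]) auto
    then show "lincomb C E (monomial N) (W \<omega>)"
      by (rule lincomb_cong) (simp add: W_def \<omega> C_def c)
  qed
  obtain l where l: "hm N (Suc 0) l" "\<not> (\<exists>c. \<forall>v. l v = c * b v)" using linear_form_not_multiple by blast
  have "\<exists>\<gamma>. (\<exists>i\<in>{..card E}. \<gamma> i \<noteq> 0) \<and> (\<forall>v\<in>C. (\<Sum>i\<in>{..card E}. \<gamma> i * l v ^ i) = 0)"
    by (rule lincomb_dependent[OF _ E(1), of _ C "monomial N" "\<lambda>i v. l v ^ i"])
      (use lin hm_power[OF l(1)] in auto)
  then obtain \<gamma> i where \<gamma>: "i \<le> card E" "\<gamma> i \<noteq> 0" "\<And>v. v \<in> C \<Longrightarrow> (\<Sum>i\<le>card E. \<gamma> i * l v ^ i) = 0" by auto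
  define p where "p = (\<Sum>i\<le>card E. monom (\<gamma> i) i)"
  have "coeff p i \<noteq> 0" using \<gamma>(1,2) by (simp add: p_def coeff_sum)
  then have "p \<noteq> 0" by auto
  moreover have "poly p (l v) = 0" if "v \<in> C" for v
    using \<gamma>(3)[OF that] by (simp add: p_def poly_sum poly_monom)
  ultimately show False using poly_vanish_C[OF b0 l(1)] l(2) by blast
qed

end

section \<open>A general fibre and the growth of the spaces of forms\<close>

context pencil
begin

lemma poly_a_polyring: "(\<lambda>v. poly q (a v)) \<in> polyring N"
proof -
  have S: "adj const_funs a \<subseteq> polyring N"
    by (rule adj_least[OF subring_const_funs subring_polyring const_funs_polyring hm_polyring[OF a]])
  have "(\<lambda>v. \<Sum>i\<le>degree q. coeff q i * a v ^ i) \<in> adj const_funs a" by (rule adj_const_funsI)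
  then show ?thesis using S by (auto simp: poly_altdef)
qed

text \<open>Evaluation of k[a] at a general \<tau> extends to \<open>card K\<close> homomorphisms on
  the coordinate ring; these are the points of T. Modulo one fixed denominator, forms of degree d
  are combinations of a^s e_k with s bounded by d plus a constant, which gives the linear bound with
  slope \<open>card T\<close>.\<close>

lemma generic_fibre:
  assumes b0: "b u \<noteq> 0"
  shows "\<exists>T \<tau> B. finite T \<and> T \<subseteq> C \<and> (\<forall>v\<in>T. a v = \<tau>) \<and>
    (\<forall>d (I :: nat set) F. finite I \<longrightarrow> (\<forall>i\<in>I. hm N d (F i)) \<longrightarrow>
      (\<forall>\<gamma>. (\<forall>v\<in>C. (\<Sum>i\<in>I. \<gamma> i * F i v) = 0) \<longrightarrow> (\<forall>i\<in>I. \<gamma> i = 0)) \<longrightarrow> card I \<le> (d + B) * card T)"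
proof -
  interpret prime_ideal "polyring N" ZC by unfold_locales (rule subring_polyring, rule ZC_prime[OF b0])
  obtain E where E: "finite E" "\<And>d f. hm N d f \<Longrightarrow> lincomb cone ({..d} \<times> {..d} \<times> E) W f"
    using spanning by blast
  let ?w = "\<lambda>(s, \<alpha>) v. a v ^ s * monomial N \<alpha> v"
  have lin: "lincomb C ({..d} \<times> E) ?w f" if "hm N d f" for d f
  proof (rule lincomb_trans)
    show "lincomb C ({..d} \<times> {..d} \<times> E) W f" using E(2)[OF that] by (auto simp: lincomb_def C_def)
    fix \<omega> assume "\<omega> \<in> {..d} \<times> {..d} \<times> E"
    then obtain s t \<alpha> where \<omega>: "\<omega> = (s, t, \<alpha>)" "s \<le> d" "\<alpha> \<in> E" by auto
    show "lincomb C ({..d} \<times> E) ?w (W \<omega>)"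
      by (rule lincomb_member[of _ "(s, \<alpha>)"]) (use \<omega> E(1) in \<open>auto simp: W_def C_def\<close>)
  qed
  define A where "A = adj const_funs a"
  have A: "subring A" unfolding A_def by (rule adj_subring[OF subring_const_funs])
  have AR: "A \<subseteq> polyring N" unfolding A_def
    by (rule adj_least[OF subring_const_funs subring_polyring const_funs_polyring hm_polyring[OF a]])
  have polyA: "(\<lambda>v. poly q (a v)) \<in> A" for q
    using adj_const_funsI[where y = a and n = "degree q" and c = "coeff q"] by (simp add: A_def poly_altdef)
  have polyZ: "q = 0" if "(\<lambda>v. poly q (a v)) \<in> ZC" for q
    using that by (intro a_transcendental[OF b0]) (simp add: ZC_def)
  have trans: "\<not> algebraic const_funs a"
  proof
    assume "algebraic const_funs a"
    then obtain p where p: "cpoly const_funs p" "poly p a \<in> ZC" "\<not> cpoly ZC p" by (auto simp: algebraic_def)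
    define q where "q = map_poly (\<lambda>f. f undefined) p"
    have "q = 0" using p(2) poly_const_funs(2)[OF p(1), of a] by (intro polyZ) (simp add: q_def)
    then have "coeff p i = 0" for i using poly_const_funs(1)[OF p(1), of i] by (simp add: q_def zero_fun_def)
    then show False using p(3) Z0 by (simp add: cpoly_def)
  qed
  have alg: "algebraic A (\<lambda>v. v i)" if i: "i \<le> N" for i
  proof -
    \<comment> \<open>Large enough for the (e + 1)^2 products x_i^s a^r with s, r <= e to outnumber
      the (2 e + 1) card E functions that span them; their dependence is an algebraic equation of
      x_i over k[a].\<close>
    define e where "e = 2 * card E"
    define F where "F = (\<lambda>(s, r) v. v i ^ s * a v ^ r)"
    have "hm N (s + r) (F (s, r))" for s r
      using hm_mult[OF hm_power[OF hm_var[OF i], of s] hm_power[OF a, of r]] by (simp add: F_def)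
    then have "lincomb C ({..2*e} \<times> E) ?w (F (s, r))" if "s \<le> e" "r \<le> e" for s r
      by (rule lincomb_mono[OF lin]) (use that E(1) in auto)
    moreover have "card ({..2*e} \<times> E) < card ({..e} \<times> {..e})"
    proof -
      have "card ({..2*e} \<times> E) = (2 * e + 1) * card E" by (simp add: card_cartesian_product)
      also have "\<dots> \<le> (e + 1) * e" by (simp add: e_def algebra_simps)
      also have "\<dots> < (e + 1) * (e + 1)" by simp
      finally show ?thesis by (simp add: card_cartesian_product)
    qed
    ultimately have "\<exists>\<gamma>. (\<exists>x\<in>{..e} \<times> {..e}. \<gamma> x \<noteq> 0) \<and> (\<forall>v\<in>C. (\<Sum>x\<in>{..e} \<times> {..e}. \<gamma> x * F x v) = 0)"
      using E(1) by (intro lincomb_dependent[where J = "{..2*e} \<times> E" and G = ?w]) auto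
    then obtain \<gamma> s0 r0 where \<gamma>: "s0 \<le> e" "r0 \<le> e" "\<gamma> (s0, r0) \<noteq> 0"
      "\<And>v. v \<in> C \<Longrightarrow> (\<Sum>x\<in>{..e} \<times> {..e}. \<gamma> x * F x v) = 0" by auto
    define Q where "Q s = (\<Sum>r\<le>e. monom (\<gamma> (s, r)) r)" for s
    define p where "p = (\<Sum>s\<le>e. monom (\<lambda>v. poly (Q s) (a v)) s)"
    have cp: "coeff p s = (if s \<le> e then (\<lambda>v. poly (Q s) (a v)) else 0)" for s
      by (simp add: p_def coeff_sum)
    have cA: "cpoly A p" using polyA subringD(2)[OF A] by (auto simp: cpoly_def cp)
    have "poly p (\<lambda>v. v i) v = (\<Sum>x\<in>{..e} \<times> {..e}. \<gamma> x * F x v)" for v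
    proof -
      have "(\<Sum>x\<in>{..e} \<times> {..e}. \<gamma> x * F x v) = (\<Sum>s\<le>e. \<Sum>r\<le>e. \<gamma> (s, r) * F (s, r) v)"
        by (simp add: sum.cartesian_product case_prod_unfold)
      then show ?thesis
        by (simp add: p_def poly_sum poly_monom sum_fun_apply power_fun_apply Q_def F_def
          sum_distrib_left sum_distrib_right mult_ac)
    qed
    moreover have "poly p (\<lambda>v. v i) \<in> polyring N"
      by (rule poly_R[OF cpoly_mono[OF AR cA] hm_polyring[OF hm_var[OF i]]])
    ultimately have "poly p (\<lambda>v. v i) \<in> ZC" using \<gamma>(4) by (simp add: ZC_def)
    moreover have "\<not> cpoly ZC p"
    proof
      assume "cpoly ZC p"
      then have "coeff p s0 \<in> ZC" by (rule cpolyD)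
      then have "Q s0 = 0" using \<gamma>(1) by (intro polyZ) (simp add: cp)
      moreover have "coeff (Q s0) r0 = \<gamma> (s0, r0)" using \<gamma>(2) by (simp add: Q_def coeff_sum)
      ultimately show False using \<gamma>(3) by simp
    qed
    ultimately show ?thesis using cA unfolding algebraic_def by blast
  qed
  define S where "S = adjs A (coords N)"
  have SS: "subring S" unfolding S_def by (rule adjs_subring[OF A])
  have cfA: "const_funs \<subseteq> A" unfolding A_def by (rule adj_incl[OF subring_const_funs])
  have AS: "A \<subseteq> S" unfolding S_def by (rule adjs_incl[OF A])
  have cS: "const_funs \<subseteq> S" "set (coords N) \<subseteq> S"
    using cfA AS adjs_gen[OF A] by (auto simp: S_def)
  have SR: "S \<subseteq> polyring N" unfolding S_def by (rule adjs_least[OF A subring_polyring AR coords_polyring])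
  obtain K e where K: "finite K" "\<forall>k\<in>K. e k \<in> polyring N" and sp: "spans_over A S K e"
    and extS: "\<forall>f\<in>S. f \<notin> ZC \<longrightarrow> (\<exists>h\<in>A. h \<notin> ZC \<and> (\<forall>\<phi>::_ \<Rightarrow> 'k. ring_hom_on A ZC \<phi> \<and> \<phi> h \<noteq> 0 \<longrightarrow>
        (\<exists>\<Phi>. extensions A S K f \<phi> \<Phi>)))"
  proof -
    have "\<forall>y\<in>set (coords N). algebraic A y" using alg by (auto simp: set_coords)
    moreover have "\<forall>k>0. of_nat k \<notin> ZC" using of_nat_not_in_prime[OF ZC_prime[OF b0]] by blast
    note tower[OF ac this A AR coords_polyring]
    ultimately have "\<exists>K e. finite K \<and> (\<forall>k\<in>K. e k \<in> polyring N) \<and> spans_over A S K e \<and>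
      (\<forall>f\<in>S. f \<notin> ZC \<longrightarrow> (\<exists>h\<in>A. h \<notin> ZC \<and> (\<forall>\<phi>::_ \<Rightarrow> 'k. ring_hom_on A ZC \<phi> \<and> \<phi> h \<noteq> 0 \<longrightarrow>
        (\<exists>\<Phi>. extensions A S K f \<phi> \<Phi>))))" unfolding S_def by simp
    then show ?thesis by (elim exE conjE) (rule that)
  qed
  \<comment> \<open>With f = 1 nothing is to be avoided upstairs; h only describes where the full
    number of extensions exists.\<close>
  obtain h where h: "h \<in> A" "h \<notin> ZC" "\<And>\<phi>::_ \<Rightarrow> 'k. ring_hom_on A ZC \<phi> \<Longrightarrow> \<phi> h \<noteq> 0 \<Longrightarrow>
        (\<exists>\<Phi>. extensions A S K 1 \<phi> \<Phi>)"
    using extS[rule_format, OF subringD(1)[OF SS] Z1] by blast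
  obtain g where g: "cpoly const_funs g" "h = poly g a" using h(1) by (auto simp: A_def adj_def)
  define \<phi>0 :: "((nat \<Rightarrow> 'k) \<Rightarrow> 'k) \<Rightarrow> 'k" where "\<phi>0 = (\<lambda>f. f undefined)"
  \<comment> \<open>The obstruction is h = g(a) for a nonzero polynomial g, so any non-root \<tau>
    of g is general enough.\<close>
  have "map_poly \<phi>0 g \<noteq> 0"
  proof
    assume "map_poly \<phi>0 g = 0"
    then have "h = 0" using poly_const_funs(2)[OF g(1), of a] by (simp add: g(2) \<phi>0_def zero_fun_def)
    then show False using h(2) Z0 by simp
  qed
  then obtain \<tau> where \<tau>: "poly (map_poly \<phi>0 g) \<tau> \<noteq> 0" using poly_all_0_iff_0 by blast
  have "ring_hom_on const_funs ZC \<phi>0" unfolding ring_hom_on_def \<phi>0_def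
    using const_not_in_prime[OF ZC_prime[OF b0]] by (auto simp: const_funs_def)
  from extend_transcendental[OF subring_const_funs trans this, of \<tau>] obtain \<phi> where
    \<phi>: "ring_hom_on A ZC \<phi>" "\<And>x. x \<in> const_funs \<Longrightarrow> \<phi> x = \<phi>0 x"
      "\<And>g. cpoly const_funs g \<Longrightarrow> \<phi> (poly g a) = poly (map_poly \<phi>0 g) \<tau>"
    unfolding A_def by blast
  have "\<phi> h \<noteq> 0" using \<phi>(3)[OF g(1)] g(2) \<tau> by simp
  then obtain \<Phi> where ex: "extensions A S K 1 \<phi> \<Phi>" using h(3)[OF \<phi>(1)] by blast
  have \<Phi>: "\<And>k. k \<in> K \<Longrightarrow> ring_hom_on S ZC (\<Phi> k)" "\<And>k x. k \<in> K \<Longrightarrow> x \<in> A \<Longrightarrow> \<Phi> k x = \<phi> x"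
    "\<And>k l. k \<in> K \<Longrightarrow> l \<in> K \<Longrightarrow> \<forall>x\<in>S. \<Phi> k x = \<Phi> l x \<Longrightarrow> k = l"
    using ex unfolding extensions_def by blast+
  have \<Phi>c: "\<Phi> k (\<lambda>v. c) = c" if "k \<in> K" for k c
  proof -
    have "(\<lambda>v. c) \<in> const_funs" by (auto simp: const_funs_def)
    then show ?thesis using \<Phi>(2)[OF that] \<phi>(2) cfA by (auto simp: \<phi>0_def)
  qed
  define pnt where "pnt k = (\<lambda>i. if i \<le> N then \<Phi> k (\<lambda>v. v i) else 0)" for k
  have ev: "\<Phi> k f = f (pnt k)" if "k \<in> K" "hm N d f" for k d f
    unfolding pnt_def by (rule hom_eval[OF that(2) SS cS \<Phi>(1)[OF that(1)] \<Phi>c[OF that(1)]])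
  have hS: "f \<in> S" if "hm N d f" for d f by (rule hm_in_subring[OF that SS cS])
  have ev0: "f (pnt k) = 0" if "k \<in> K" "hm N d f" "f \<in> ZC" for k d f
    using ev[OF that(1,2)] ring_hom_onD(6)[OF SS \<Phi>(1)[OF that(1)] that(3) hS[OF that(2)]] by simp
  have pa: "a (pnt k) = \<tau>" if "k \<in> K" for k
  proof -
    have *: "cpoly const_funs [:0, 1:]"
      by (intro cpoly_arith subringD subring_const_funs)
    have "poly [:0, 1:] a = a" by simp
    then have "\<phi> a = \<tau>" using \<phi>(3)[OF *] by (simp add: map_poly_pCons \<phi>0_def)
    moreover have "a \<in> A" unfolding A_def by (rule adj_gen[OF subring_const_funs])
    ultimately show ?thesis using ev[OF that a] \<Phi>(2)[OF that] by simp
  qed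
  have pb: "b (pnt k) = 1" if "k \<in> K" for k
  proof -
    have "(b - 1) \<in> ZC" using subringD(1,3)[OF R] hm_polyring[OF b] by (auto simp: ZC_def C_def)
    moreover have "b \<in> S" "1 \<in> S" using hS[OF b] subringD(1)[OF SS] by auto
    ultimately have "\<Phi> k b - \<Phi> k 1 = 0"
      using ring_hom_onD(5,6)[OF SS \<Phi>(1)[OF that]] subringD(3)[OF SS] by metis
    then show ?thesis using ev[OF that b] ring_hom_onD(1)[OF SS \<Phi>(1)[OF that]] by simp
  qed
  have pC: "pnt k \<in> C" if k: "k \<in> K" for k
  proof -
    have "pnt k \<in> cone"
    proof (rule cone_closed)
      show "pnt k \<in> vecs N" by (simp add: vecs_def pnt_def)
      show "pnt k \<noteq> (\<lambda>_. 0)"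
      proof
        assume "pnt k = (\<lambda>_. 0)"
        then show False using pb[OF k] hm_homogeneous[OF b, of 0 "pnt k"] by simp
      qed
      fix d f assume f: "hm N d f" "\<And>w. w \<in> cone \<Longrightarrow> f w = 0"
      then have "f \<in> ZC" using hm_polyring by (auto simp: ZC_def C_def)
      then show "f (pnt k) = 0" by (rule ev0[OF k f(1)])
    qed
    then show ?thesis using pb[OF k] by (simp add: C_def)
  qed
  \<comment> \<open>The homomorphisms act on \<open>S\<close> by evaluation at the points, so equal
    points give equal homomorphisms, hence equal indices.\<close>
  have inj: "inj_on pnt K"
  proof (rule inj_onI)
    fix k l assume kl: "k \<in> K" "l \<in> K" "pnt k = pnt l"
    have "\<Phi> k x = \<Phi> l x" if x: "x \<in> S" for x
    proof -
      obtain n G where G: "\<And>d. hm N d (G d)" "x = (\<lambda>v. \<Sum>d\<le>n. G d v)"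
      proof -
        have "x \<in> polyring N" using SR x by blast
        then show ?thesis using that by (auto simp: polyring_def)
      qed
      have x': "x = (\<Sum>d\<le>n. G d)" by (rule ext) (simp add: G(2) sum_fun_apply)
      have "\<Phi> m x = (\<Sum>d\<le>n. G d (pnt m))" if "m \<in> K" for m
        unfolding x' using ring_hom_onD(9)[OF SS \<Phi>(1)[OF that], of "{..n}" G, OF hS[OF G(1)]]
          ev[OF that G(1)] by simp
      then show ?thesis using kl by simp
    qed
    then show "k = l" using \<Phi>(3)[OF kl(1,2)] by blast
  qed
  define T where "T = pnt ` K"
  have cT: "card T = card K" unfolding T_def by (rule card_image[OF inj])
  have "\<forall>\<alpha>\<in>E. \<exists>H q. (\<lambda>v. poly H (a v)) \<notin> ZC \<and>
     (\<forall>v\<in>C. poly H (a v) * monomial N \<alpha> v = (\<Sum>k\<in>K. poly (q k) (a v) * e k v))"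
  proof
    fix \<alpha> assume "\<alpha> \<in> E"
    have "hm N (\<Sum>i\<le>N. \<alpha> i) (monomial N \<alpha> :: _ \<Rightarrow> 'k)"
      unfolding monomial_def[abs_def] using hm_prod[of "{..N}" N "\<lambda>i. \<alpha> i * Suc 0" "\<lambda>i v. v i ^ \<alpha> i"] hm_power[OF hm_var]
      by auto
    then have "monomial N \<alpha> \<in> S" by (rule hS)
    then obtain H r where Hr: "H \<in> A" "H \<notin> ZC" "\<And>k. k \<in> K \<Longrightarrow> r k \<in> A"
      "H * monomial N \<alpha> - (\<Sum>k\<in>K. r k * e k) \<in> ZC" using sp unfolding spans_over_def by blast
    obtain H' where H': "\<And>v. H v = poly H' (a v)" using adj_const_funsD Hr(1) unfolding A_def by blast
    have "\<forall>k\<in>K. \<exists>q. \<forall>v. r k v = poly q (a v)" using adj_const_funsD Hr(3) unfolding A_def by blast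
    then obtain q where q: "\<And>k v. k \<in> K \<Longrightarrow> r k v = poly (q k) (a v)" by metis
    have "(\<lambda>v. poly H' (a v)) \<notin> ZC" using Hr(2) H' by (metis (no_types, lifting) ext)
    moreover have "poly H' (a v) * monomial N \<alpha> v = (\<Sum>k\<in>K. poly (q k) (a v) * e k v)" if "v \<in> C" for v
    proof -
      have "(H * monomial N \<alpha> - (\<Sum>k\<in>K. r k * e k)) v = 0" using Hr(4) that by (auto simp: ZC_def)
      then show ?thesis using q by (simp add: H' sum_fun_apply)
    qed
    ultimately show "\<exists>H q. (\<lambda>v. poly H (a v)) \<notin> ZC \<and>
     (\<forall>v\<in>C. poly H (a v) * monomial N \<alpha> v = (\<Sum>k\<in>K. poly (q k) (a v) * e k v))" by blast
  qed
  from bchoice[OF this] obtain H where "\<forall>\<alpha>\<in>E. \<exists>q. (\<lambda>v. poly (H \<alpha>) (a v)) \<notin> ZC \<and>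
     (\<forall>v\<in>C. poly (H \<alpha>) (a v) * monomial N \<alpha> v = (\<Sum>k\<in>K. poly (q k) (a v) * e k v))" by blast
  from bchoice[OF this] obtain q where Hq0: "\<forall>\<alpha>\<in>E. (\<lambda>v. poly (H \<alpha>) (a v)) \<notin> ZC \<and>
     (\<forall>v\<in>C. poly (H \<alpha>) (a v) * monomial N \<alpha> v = (\<Sum>k\<in>K. poly (q \<alpha> k) (a v) * e k v))" by blast
  have H: "\<And>\<alpha>. \<alpha> \<in> E \<Longrightarrow> (\<lambda>v. poly (H \<alpha>) (a v)) \<notin> ZC"
    and Hq: "\<And>\<alpha> v. \<alpha> \<in> E \<Longrightarrow> v \<in> C \<Longrightarrow> poly (H \<alpha>) (a v) * monomial N \<alpha> v = (\<Sum>k\<in>K. poly (q \<alpha> k) (a v) * e k v)"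
    using Hq0 by simp_all
  \<comment> \<open>One denominator for all monomials in \<open>E\<close>. It is a polynomial in a
    alone, and nonzero, so multiplication by it can be cancelled on \<open>C\<close>.\<close>
  define HH where "HH = (\<Prod>\<alpha>\<in>E. H \<alpha>)"
  have HH0: "HH \<noteq> 0"
  proof
    assume "HH = 0"
    then obtain \<alpha> where "\<alpha> \<in> E" "H \<alpha> = 0" using E(1) by (auto simp: HH_def)
    then show False using H[of \<alpha>] Z0 by (simp add: zero_fun_def)
  qed
  then have HHZ: "(\<lambda>v. poly HH (a v)) \<notin> ZC" using polyZ by blast
  define Q where "Q \<alpha> k = (\<Prod>\<beta>\<in>E - {\<alpha>}. H \<beta>) * q \<alpha> k" for \<alpha> k
  define B where "B = (\<Sum>\<alpha>\<in>E. \<Sum>k\<in>K. degree (Q \<alpha> k))"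
  have dQ: "degree (Q \<alpha> k) \<le> B" if "\<alpha> \<in> E" "k \<in> K" for \<alpha> k
  proof -
    have "degree (Q \<alpha> k) \<le> (\<Sum>k\<in>K. degree (Q \<alpha> k))" using that K by (intro member_le_sum) auto
    also have "\<dots> \<le> B" unfolding B_def using that E
      by (intro member_le_sum[of \<alpha> E "\<lambda>\<alpha>. \<Sum>k\<in>K. degree (Q \<alpha> k)"]) auto
    finally show ?thesis .
  qed
  have HHm: "poly HH (a v) * monomial N \<alpha> v = (\<Sum>k\<in>K. poly (Q \<alpha> k) (a v) * e k v)" if "\<alpha> \<in> E" "v \<in> C" for \<alpha> v
  proof -
    have "HH = H \<alpha> * (\<Prod>\<beta>\<in>E - {\<alpha>}. H \<beta>)" unfolding HH_def using that E by (intro prod.remove) auto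
    then have "poly HH (a v) * monomial N \<alpha> v = poly (\<Prod>\<beta>\<in>E - {\<alpha>}. H \<beta>) (a v) * (poly (H \<alpha>) (a v) * monomial N \<alpha> v)"
      by (simp add: mult_ac)
    then show ?thesis unfolding Hq[OF that] Q_def by (simp add: sum_distrib_left mult_ac)
  qed
  let ?e = "\<lambda>(s, k) v. a v ^ s * e k v"
  have lin2: "lincomb C ({..d + B} \<times> K) ?e (\<lambda>v. poly HH (a v) * f v)" if f: "hm N d f" for d f
  proof (rule lincomb_trans[OF lincomb_mult[OF lin[OF f]]])
    fix \<omega> assume "\<omega> \<in> {..d} \<times> E"
    then obtain s \<alpha> where \<omega>: "\<omega> = (s, \<alpha>)" "s \<le> d" "\<alpha> \<in> E" by auto
    have "lincomb C ({..d + B} \<times> K) ?e (\<lambda>v. \<Sum>k\<in>K. \<Sum>i\<le>degree (Q \<alpha> k). coeff (Q \<alpha> k) i * (a v ^ (s + i) * e k v))"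
    proof (intro lincomb_sum lincomb_scale)
      fix k i assume "k \<in> K" "i \<in> {..degree (Q \<alpha> k)}"
      then have "(s + i, k) \<in> {..d + B} \<times> K" using \<omega> dQ[of \<alpha> k] by auto
      then show "lincomb C ({..d + B} \<times> K) ?e (\<lambda>v. a v ^ (s + i) * e k v)"
        using K(1) by (intro lincomb_member[of _ "(s + i, k)"]) auto
    qed
    then show "lincomb C ({..d + B} \<times> K) ?e (\<lambda>v. poly HH (a v) * (case \<omega> of (s, \<alpha>) \<Rightarrow> \<lambda>v. a v ^ s * monomial N \<alpha> v) v)"
    proof (rule lincomb_cong)
      fix v assume v: "v \<in> C"
      have "poly HH (a v) * (a v ^ s * monomial N \<alpha> v) = a v ^ s * (\<Sum>k\<in>K. poly (Q \<alpha> k) (a v) * e k v)"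
        using HHm[OF \<omega>(3) v] by (simp add: mult_ac)
      also have "\<dots> = (\<Sum>k\<in>K. \<Sum>i\<le>degree (Q \<alpha> k). coeff (Q \<alpha> k) i * (a v ^ (s + i) * e k v))"
        by (simp add: poly_altdef sum_distrib_left sum_distrib_right power_add mult_ac)
      finally show "poly HH (a v) * (case \<omega> of (s, \<alpha>) \<Rightarrow> \<lambda>v. a v ^ s * monomial N \<alpha> v) v
        = (\<Sum>k\<in>K. \<Sum>i\<le>degree (Q \<alpha> k). coeff (Q \<alpha> k) i * (a v ^ (s + i) * e k v))" by (simp add: \<omega>(1))
    qed
  qed
  \<comment> \<open>The exponents 0, ..., d + B are d + B + 1 in number, so the constant in the
    conclusion is \<open>Suc B\<close>.\<close>
  have bound: "card I \<le> (d + Suc B) * card T"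
    if I: "finite I" "\<forall>i\<in>I. hm N d (F i)" "\<forall>\<gamma>. (\<forall>v\<in>C. (\<Sum>i\<in>I. \<gamma> i * F i v) = 0) \<longrightarrow> (\<forall>i\<in>I. \<gamma> i = 0)"
    for d and I :: "nat set" and F
  proof (rule ccontr)
    assume "\<not> ?thesis"
    then have lt: "card ({..d + B} \<times> K) < card I" by (simp add: card_cartesian_product cT)
    have "\<exists>\<gamma>. (\<exists>i\<in>I. \<gamma> i \<noteq> 0) \<and> (\<forall>v\<in>C. (\<Sum>i\<in>I. \<gamma> i * (poly HH (a v) * F i v)) = 0)"
      by (rule lincomb_dependent[OF I(1) _ lt]) (use lin2 I(2) K(1) in auto)
    then obtain \<gamma> where \<gamma>: "\<exists>i\<in>I. \<gamma> i \<noteq> 0" "\<And>v. v \<in> C \<Longrightarrow> (\<Sum>i\<in>I. \<gamma> i * (poly HH (a v) * F i v)) = 0" by blast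
    define G where "G v = (\<Sum>i\<in>I. \<gamma> i * F i v)" for v
    have "hm N d G" unfolding G_def[abs_def] using I(2) by (intro hm_sum hm_scale) auto
    then have GR: "G \<in> polyring N" by (rule hm_polyring)
    have "poly HH (a v) * G v = 0" if "v \<in> C" for v
      using \<gamma>(2)[OF that] by (simp add: G_def sum_distrib_left mult_ac)
    then have "(\<lambda>v. poly HH (a v)) * G \<in> ZC" using subringD(4)[OF R poly_a_polyring GR] by (simp add: ZC_def)
    then have "G \<in> ZC" using Z_prime[OF poly_a_polyring GR] HHZ by blast
    then show False using I(3) \<gamma>(1) unfolding ZC_def G_def by blast
  qed
  show ?thesis
  proof (intro exI conjI allI impI)
    show "finite T" "T \<subseteq> C" "\<forall>v\<in>T. a v = \<tau>" using K(1) pC pa by (auto simp: T_def)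
  qed (rule bound)
qed

end

section \<open>Linear forms vanishing on the general fibre\<close>

context pencil
begin

text \<open>For each other point w, a coordinate distinguishing it from v yields (x_i - w_i b) /
  (v_i - w_i), which is 0 at w and 1 at v since b = 1. The product over w is brought to degree d by
  powers of b.\<close>

lemma lagrange_forms:
  assumes T: "finite T" "T \<subseteq> C" and v: "v \<in> T" and d: "card T \<le> Suc d"
  shows "\<exists>f. hm N d f \<and> f v = 1 \<and> (\<forall>w\<in>T - {v}. f w = 0)"
proof -
  have "\<exists>l. hm N (Suc 0) l \<and> l w = 0 \<and> l v = 1" if w: "w \<in> T - {v}" for w
  proof -
    obtain i where i: "v i \<noteq> w i" using w by (metis DiffE insertI1 ext)
    have vw: "v \<in> vecs N" "w \<in> vecs N" "b v = 1" "b w = 1"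
      using w v T cone_vecs by (auto simp: C_def)
    then have iN: "i \<le> N" using i by (cases "i \<le> N") (auto simp: vecs_def)
    define l where "l u = inverse (v i - w i) * (u i - w i * b u)" for u :: "nat \<Rightarrow> 'k"
    have "hm N (Suc 0) l" unfolding l_def[abs_def] by (intro hm_scale hm_diff hm_var iN b)
    then show ?thesis using i vw by (intro exI[of _ l]) (simp add: l_def)
  qed
  then obtain l where l: "\<And>w. w \<in> T - {v} \<Longrightarrow> hm N (Suc 0) (l w) \<and> l w w = 0 \<and> l w v = 1" by metis
  define f where "f u = b u ^ (d - card (T - {v})) * (\<Prod>w\<in>T - {v}. l w u)" for u
  have "hm N ((d - card (T - {v})) * Suc 0 + (\<Sum>w\<in>T - {v}. Suc 0)) f" unfolding f_def[abs_def]
    using l by (intro hm_mult hm_power hm_prod b) auto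
  moreover have "card (T - {v}) \<le> d" using d v T by simp
  ultimately have "hm N d f" by simp
  moreover have "f v = 1" using v T l by (auto simp: f_def C_def intro!: prod.neutral)
  moreover have "f w = 0" if "w \<in> T - {v}" for w
    using that l T by (auto simp: f_def intro!: bexI[of _ w])
  ultimately show ?thesis by blast
qed

text \<open>Equivalently, T spans the hyperplane a = \<tau> b. The proof compares the spaces of
  forms of two consecutive degrees on \<open>C\<close>.\<close>

lemma fibre_spans:
  assumes b0: "b u \<noteq> 0"
  shows "\<exists>T \<tau>. finite T \<and> T \<subseteq> C \<and> (\<forall>v\<in>T. a v = \<tau>) \<and>
    (\<forall>l. hm N (Suc 0) l \<longrightarrow> (\<forall>v\<in>T. l v = 0) \<longrightarrow> (\<exists>c. \<forall>v. l v = c * (a v - \<tau> * b v)))"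
proof -
  interpret prime_ideal "polyring N" ZC by unfold_locales (rule subring_polyring, rule ZC_prime[OF b0])
  obtain T \<tau> B where T0: "finite T \<and> T \<subseteq> C \<and> (\<forall>v\<in>T. a v = \<tau>) \<and>
    (\<forall>d (I :: nat set) F. finite I \<longrightarrow> (\<forall>i\<in>I. hm N d (F i)) \<longrightarrow>
      (\<forall>\<gamma>. (\<forall>v\<in>C. (\<Sum>i\<in>I. \<gamma> i * F i v) = 0) \<longrightarrow> (\<forall>i\<in>I. \<gamma> i = 0)) \<longrightarrow> card I \<le> (d + B) * card T)"
    using generic_fibre[OF b0] by (elim exE) (rule that)
  then have T: "finite T" "T \<subseteq> C" "\<And>v. v \<in> T \<Longrightarrow> a v = \<tau>" by simp_all
  have bound: "card I \<le> (d + B) * card T"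
    if "finite I" "\<forall>i\<in>I. hm N d (F i)"
      "\<forall>\<gamma>. (\<forall>v\<in>C. (\<Sum>i\<in>I. \<gamma> i * F i v) = 0) \<longrightarrow> (\<forall>i\<in>I. \<gamma> i = 0)" for d F and I :: "nat set"
    using T0[THEN conjunct2, THEN conjunct2, THEN conjunct2, rule_format, of I d F] that by blast
  define D where "D = card T"
  define free where "free d n \<longleftrightarrow> (\<exists>F. (\<forall>i\<in>{..<n}. hm N d (F i)) \<and>
     (\<forall>\<gamma>. (\<forall>v\<in>C. (\<Sum>i\<in>{..<n}. \<gamma> i * F i v) = 0) \<longrightarrow> (\<forall>i\<in>{..<n}. \<gamma> i = 0)))" for d and n :: nat
  have free_bound: "n \<le> (d + B) * D" if "free d n" for d n
    using that bound[of "{..<n}" d] unfolding free_def D_def by auto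
  \<comment> \<open>The dimension of the space of forms of degree d on \<open>C\<close>, expressed
    as the largest number of independent ones.\<close>
  define h where "h d = (GREATEST n. free d n)" for d
  have free0: "free d 0" for d by (simp add: free_def)
  have hf: "free d (h d)" for d unfolding h_def
    by (rule GreatestI_nat[where P = "free d" and k = 0 and b = "(d + B) * D"]) (use free0 free_bound in blast)+
  have hmax: "n \<le> h d" if "free d n" for n d unfolding h_def
    by (rule Greatest_le_nat[where P = "free d" and b = "(d + B) * D"]) (use that free_bound in blast)+
  have dep: "\<exists>\<gamma>. (\<exists>i\<in>I. \<gamma> i \<noteq> 0) \<and> (\<forall>v\<in>C. (\<Sum>i\<in>I. \<gamma> i * F i v) = 0)"
    if I: "finite I" "h d < card I" "\<And>i. i \<in> I \<Longrightarrow> hm N d (F i)" for d and I :: "'i set" and F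
  proof -
    obtain f where f: "bij_betw f {..<card I} I"
      using ex_bij_betw_nat_finite[OF I(1)] by (auto simp: atLeast0LessThan)
    have "\<not> free d (card I)" using hmax[of d "card I"] I(2) by auto
    moreover have "\<forall>i\<in>{..<card I}. hm N d (F (f i))" using f I(3) by (auto dest: bij_betwE)
    ultimately obtain \<gamma> i where \<gamma>: "i < card I" "\<gamma> i \<noteq> 0" "\<forall>v\<in>C. (\<Sum>i\<in>{..<card I}. \<gamma> i * F (f i) v) = 0"
      unfolding free_def by (auto dest!: spec[of _ "\<lambda>i. F (f i)"])
    define g where "g = the_inv_into {..<card I} f"
    have g: "g (f i) = i" if "i < card I" for i
      using f that unfolding g_def by (intro the_inv_into_f_f) (auto simp: bij_betw_def)
    have "(\<Sum>i\<in>I. \<gamma> (g i) * F i v) = (\<Sum>i\<in>{..<card I}. \<gamma> i * F (f i) v)" for v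
      using sum.reindex_bij_betw[OF f, of "\<lambda>i. \<gamma> (g i) * F i v"] g by simp
    moreover have "f i \<in> I" "\<gamma> (g (f i)) \<noteq> 0" using \<gamma> f g by (auto dest: bij_betwE)
    ultimately show ?thesis using \<gamma>(3) by (intro exI[of _ "\<lambda>i. \<gamma> (g i)"]) auto
  qed
  \<comment> \<open>If the dimension grew by at least D + 1 at every step from D on, n steps would
    give n (D + 1) <= (D + n + B) D, that is n <= (D + B) D; one step more is a contradiction.
    Starting at d >= D makes the Lagrange forms of degree d + 1 available.\<close>
  have "\<exists>d\<ge>D. h (Suc d) \<le> h d + D"
  proof (rule ccontr)
    assume no: "\<not> ?thesis"
    have step: "h d + Suc D \<le> h (Suc d)" if "D \<le> d" for d
    proof -
      have "\<not> h (Suc d) \<le> h d + D" using no that by blast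
      then show ?thesis by simp
    qed
    have "n * Suc D \<le> h (D + n)" for n
    proof (induction n)
      case (Suc n)
      then show ?case using step[of "D + n"] by simp
    qed simp
    from this[of "(D + B) * D + 1"] have "((D + B) * D + 1) * Suc D \<le> h (D + ((D + B) * D + 1))" .
    also have "\<dots> \<le> (D + ((D + B) * D + 1) + B) * D" by (rule free_bound[OF hf])
    finally show False by (simp add: algebra_simps)
  qed
  then obtain d where d: "D \<le> d" "h (Suc d) \<le> h d + D" by blast
  define m where "m v = a v - \<tau> * b v" for v
  have m: "hm N (Suc 0) m" unfolding m_def[abs_def] by (intro hm_diff hm_scale a b)
  have mC: "m v = a v - \<tau>" if "v \<in> C" for v using that by (simp add: m_def C_def)
  have mT: "m v = 0" if "v \<in> T" for v using T that mC by auto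
  have m0: "\<exists>v\<in>C. m v \<noteq> 0"
  proof (rule ccontr)
    assume "\<not> ?thesis"
    then have "poly [:-\<tau>, 1:] (a v) = 0" if "v \<in> C" for v using that mC by auto
    from a_transcendental[OF b0 this] show False by simp
  qed
  then have mZ: "m \<notin> ZC" by (auto simp: ZC_def)
  note mR = hm_polyring[OF m]
  have cancel: "\<forall>v\<in>C. f v = 0" if "hm N e f" "\<And>v. v \<in> C \<Longrightarrow> m v * f v = 0" for e f
  proof -
    have "m * f \<in> ZC" using that subringD(4)[OF R mR hm_polyring[OF that(1)]] by (simp add: ZC_def)
    then have "f \<in> ZC" using Z_prime[OF mR hm_polyring[OF that(1)]] mZ by blast
    then show ?thesis by (simp add: ZC_def)
  qed
  have "\<forall>v\<in>T. \<exists>f. hm N (Suc d) f \<and> f v = 1 \<and> (\<forall>w\<in>T - {v}. f w = 0)"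
    using lagrange_forms[OF T(1,2)] d(1) by (auto simp: D_def)
  from bchoice[OF this] obtain L where L0: "\<forall>v\<in>T. hm N (Suc d) (L v) \<and> L v v = 1 \<and> (\<forall>w\<in>T - {v}. L v w = 0)" ..
  have L: "\<And>v. v \<in> T \<Longrightarrow> hm N (Suc d) (L v)" "\<And>v w. v \<in> T \<Longrightarrow> w \<in> T \<Longrightarrow> L v w = (if v = w then 1 else 0)"
    using L0 by auto
  from hf[of d] obtain G where G0: "(\<forall>i\<in>{..<h d}. hm N d (G i)) \<and>
     (\<forall>\<gamma>. (\<forall>v\<in>C. (\<Sum>i\<in>{..<h d}. \<gamma> i * G i v) = 0) \<longrightarrow> (\<forall>i\<in>{..<h d}. \<gamma> i = 0))"
    unfolding free_def by (elim exE) (rule that)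
  have G: "\<And>i. i < h d \<Longrightarrow> hm N d (G i)"
    "\<And>\<gamma>. \<forall>v\<in>C. (\<Sum>i<h d. \<gamma> i * G i v) = 0 \<Longrightarrow> \<forall>i<h d. \<gamma> i = 0"
    using G0 by simp_all
  \<comment> \<open>The h d + D + 1 forms (a - \<tau> b) G_i, L_v and w have degree d + 1, hence are dependent on C.\<close>
  have divide: "\<exists>q. hm N d q \<and> (\<forall>v\<in>C. w v = m v * q v)"
    if w: "hm N (Suc d) w" "\<And>v. v \<in> T \<Longrightarrow> w v = 0" for w
  proof -
    define I :: "(nat + (nat \<Rightarrow> 'k) option) set" where "I = {..<h d} <+> insert None (Some ` T)"
    define F where "F x = (case x of Inl i \<Rightarrow> (\<lambda>v. m v * G i v) | Inr None \<Rightarrow> w | Inr (Some t) \<Rightarrow> L t)" for x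
    have cI: "card I = h d + Suc D" unfolding I_def D_def using T
      by (subst card_Plus) (auto simp: card_image card_insert_if)
    have sumI: "sum g I = (\<Sum>i<h d. g (Inl i)) + (g (Inr None) + (\<Sum>t\<in>T. g (Inr (Some t))))" for g :: "_ \<Rightarrow> 'k"
      unfolding I_def using T by (subst sum.Plus) (auto simp: sum.reindex)
    have "\<exists>\<gamma>. (\<exists>i\<in>I. \<gamma> i \<noteq> 0) \<and> (\<forall>v\<in>C. (\<Sum>i\<in>I. \<gamma> i * F i v) = 0)"
    proof (rule dep[of I "Suc d"])
      show "finite I" unfolding I_def using T by simp
      show "h (Suc d) < card I" using d cI by simp
      fix x assume "x \<in> I"
      then show "hm N (Suc d) (F x)"
        using w L(1) G(1) hm_mult[OF m G(1)] by (auto simp: I_def F_def)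
    qed
    then obtain \<gamma> where \<gamma>: "\<exists>i\<in>I. \<gamma> i \<noteq> 0" "\<And>v. v \<in> C \<Longrightarrow> (\<Sum>i\<in>I. \<gamma> i * F i v) = 0" by blast
    define q where "q v = (\<Sum>i<h d. \<gamma> (Inl i) * G i v)" for v
    have q: "hm N d q" unfolding q_def[abs_def] by (intro hm_sum hm_scale G) simp
    have e: "m v * q v + (\<gamma> (Inr None) * w v + (\<Sum>t\<in>T. \<gamma> (Inr (Some t)) * L t v)) = 0" if "v \<in> C" for v
      using \<gamma>(2)[OF that] unfolding sumI by (simp add: F_def q_def sum_distrib_left mult_ac)
    \<comment> \<open>At the point t the terms with m and with w vanish, and of the Lagrange forms
      only L_t survives.\<close>
    have t0: "\<gamma> (Inr (Some t)) = 0" if t: "t \<in> T" for t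
    proof -
      have "(\<Sum>s\<in>T. \<gamma> (Inr (Some s)) * L s t) = (\<Sum>s\<in>T. if s = t then \<gamma> (Inr (Some s)) else 0)"
        using L(2) t by (intro sum.cong) auto
      also have "\<dots> = \<gamma> (Inr (Some t))" using T(1) t by simp
      finally show ?thesis using e[of t] t T(2) w(2)[OF t] mT[OF t] by auto
    qed
    then have e: "m v * q v + \<gamma> (Inr None) * w v = 0" if "v \<in> C" for v using e[OF that] by simp
    \<comment> \<open>Otherwise m times a combination of the G_i vanishes on \<open>C\<close>;
      cancelling m contradicts their independence.\<close>
    have "\<gamma> (Inr None) \<noteq> 0"
    proof
      assume n: "\<gamma> (Inr None) = 0"
      then have "\<forall>v\<in>C. q v = 0" using e by (intro cancel[OF q]) auto
      then have "\<forall>i<h d. \<gamma> (Inl i) = 0" unfolding q_def by (rule G(2))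
      then show False using \<gamma>(1) n t0 by (auto simp: I_def)
    qed
    then have "w v = m v * (- inverse (\<gamma> (Inr None)) * q v)" if "v \<in> C" for v
      using e[OF that] by (simp add: field_simps eq_neg_iff_add_eq_0)
    then show ?thesis using hm_scale[OF q] by blast
  qed
  have span: "\<exists>c. \<forall>v. l v = c * m v" if l: "hm N (Suc 0) l" "\<forall>v\<in>T. l v = 0" for l
  proof -
    \<comment> \<open>Instead of an eigenvector, the orbit of b^d under q -> (l/m) q is used: on
      \<open>C\<close>, l^i = m^i q_i. Its first h d + 1 members are dependent, which after
      multiplication by m^(h d) is a homogeneous relation between l and m, ready for
      \<open>linear_factor\<close>.\<close>
    have "\<forall>q. \<exists>q'. hm N d q \<longrightarrow> hm N d q' \<and> (\<forall>v\<in>C. l v * q v = m v * q' v)"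
    proof
      fix q
      have "hm N (Suc d) (\<lambda>v. l v * q v)" if "hm N d q" using hm_mult[OF l(1) that] by simp
      then show "\<exists>q'. hm N d q \<longrightarrow> hm N d q' \<and> (\<forall>v\<in>C. l v * q v = m v * q' v)"
        using divide[of "\<lambda>v. l v * q v"] l(2) by auto
    qed
    from choice[OF this] obtain nxt where nxt: "\<And>q. hm N d q \<Longrightarrow> hm N d (nxt q)"
      "\<And>q v. hm N d q \<Longrightarrow> v \<in> C \<Longrightarrow> l v * q v = m v * nxt q v" by blast
    define q where "q i = (nxt ^^ i) (\<lambda>v. b v ^ d)" for i
    have qh: "hm N d (q i)" for i
      using hm_power[OF b, of d] by (induction i) (auto simp: q_def intro: nxt)
    have ql: "l v ^ i = m v ^ i * q i v" if v: "v \<in> C" for i v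
    proof (induction i)
      case 0
      then show ?case using v by (simp add: q_def C_def)
    next
      case (Suc i)
      then show ?case using nxt(2)[OF qh v, of i] by (simp add: q_def mult_ac)
    qed
    have "\<exists>\<gamma>. (\<exists>i\<in>{..h d}. \<gamma> i \<noteq> 0) \<and> (\<forall>v\<in>C. (\<Sum>i\<in>{..h d}. \<gamma> i * q i v) = 0)"
      by (rule dep[of _ d]) (auto intro: qh)
    then obtain \<gamma> i where \<gamma>: "i \<le> h d" "\<gamma> i \<noteq> 0" "\<And>v. v \<in> C \<Longrightarrow> (\<Sum>i\<le>h d. \<gamma> i * q i v) = 0" by auto
    define P where "P = (\<Sum>i\<le>h d. monom (\<gamma> i) i)"
    have cP: "coeff P i = (if i \<le> h d then \<gamma> i else 0)" for i by (simp add: P_def coeff_sum)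
    have "coeff P i \<noteq> 0" using \<gamma>(1,2) by (simp add: cP)
    then have P0: "P \<noteq> 0" by auto
    have dP: "degree P \<le> h d" by (rule degree_le) (simp add: cP)
    have van: "(\<Sum>i\<le>h d. coeff P i * l v ^ i * m v ^ (h d - i)) = 0" if v: "v \<in> C" for v
    proof -
      have "(\<Sum>i\<le>h d. coeff P i * l v ^ i * m v ^ (h d - i)) = (\<Sum>i\<le>h d. m v ^ h d * (\<gamma> i * q i v))"
      proof (intro sum.cong refl)
        fix i assume i: "i \<in> {..h d}"
        then have "m v ^ i * m v ^ (h d - i) = m v ^ h d" by (simp add: power_add[symmetric])
        moreover have "coeff P i * l v ^ i * m v ^ (h d - i) = \<gamma> i * q i v * (m v ^ i * m v ^ (h d - i))"
          using i by (simp add: cP ql[OF v] mult_ac)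
        ultimately show "coeff P i * l v ^ i * m v ^ (h d - i) = m v ^ h d * (\<gamma> i * q i v)" by (simp add: mult_ac)
      qed
      then show ?thesis using \<gamma>(3)[OF v] by (simp add: sum_distrib_left[symmetric])
    qed
    obtain c where c: "\<And>v. v \<in> C \<Longrightarrow> l v = c * m v"
      using linear_factor[OF b0 hm_polyring[OF l(1)] mR m0 P0 dP van] by blast
    have lm: "hm N (Suc 0) (\<lambda>v. l v - c * m v)" by (intro hm_diff hm_scale l(1) m)
    have "l v - c * m v = 0" if "v \<in> cone" for v
      by (rule zero_on_C[OF b0 lm _ that]) (use c in auto)
    from cone_nondegenerate[OF lm this] show ?thesis by (intro exI[of _ c]) auto
  qed
  show ?thesis
  proof (rule exI[of _ T], rule exI[of _ \<tau>], intro conjI allI impI)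
    show "finite T" "T \<subseteq> C" "\<forall>v\<in>T. a v = \<tau>" using T by auto
    fix l assume "hm N (Suc 0) l" "\<forall>v\<in>T. l v = 0"
    then show "\<exists>c. \<forall>v. l v = c * (a v - \<tau> * b v)" unfolding m_def[symmetric] by (rule span)
  qed
qed

end

section \<open>Ranks\<close>

interpretation fv: vector_space "\<lambda>(c :: 'k::field) (v :: nat \<Rightarrow> 'k) i. c * v i"
  by unfold_locales (auto simp: algebra_simps)

interpretation fvp: vector_space_pair "\<lambda>(c :: 'k::field) (v :: nat \<Rightarrow> 'k) i. c * v i" "(*) :: 'k \<Rightarrow> 'k \<Rightarrow> 'k"
  by unfold_locales (auto simp: algebra_simps)

definition unit_vec :: "nat \<Rightarrow> nat \<Rightarrow> 'k::field" where
  "unit_vec j = (\<lambda>i. if i = j then 1 else 0)"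

lemma vecs_expand:
  assumes "v \<in> vecs N"
  shows "v = (\<Sum>j\<le>N. (\<lambda>i. v j * unit_vec j i))"
proof
  fix i
  have "(\<Sum>j\<le>N. v j * unit_vec j i) = (if i \<le> N then v i else 0)"
    by (simp add: unit_vec_def if_distrib[of "\<lambda>x. _ * x"] sum.delta' cong: if_cong)
  then show "v i = (\<Sum>j\<le>N. (\<lambda>i. v j * unit_vec j i)) i"
    using assms by (auto simp: sum_fun_apply vecs_def)
qed

text \<open>B is a basis of the span of T. A functional that is 1 at p and 0 on B would be a linear
  form contradicting the hypothesis, so p lies in this span. The form m bounds the size of
  B.\<close>

lemma span_by_linear_forms:
  fixes T :: "(nat \<Rightarrow> 'k::field_char_0) set"
  assumes T: "finite T" "T \<subseteq> vecs N" and p: "p \<in> vecs N"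
    and sp: "\<And>l. hm N (Suc 0) l \<Longrightarrow> (\<forall>v\<in>T. l v = 0) \<Longrightarrow> l p = 0"
    and m: "hm N (Suc 0) m" "\<And>v. v \<in> T \<Longrightarrow> m v = 0" "m u \<noteq> 0"
  shows "\<exists>B c. B \<subseteq> T \<and> card B \<le> N \<and> p = (\<lambda>i. \<Sum>v\<in>B. c v * v i)"
proof -
  obtain B where B: "B \<subseteq> T" "fv.independent B" "T \<subseteq> fv.span B"
    using fv.maximal_independent_subset[of T] by blast
  have finB: "finite B" using B(1) T(1) finite_subset by blast
  have pB: "p \<in> fv.span B"
  proof (rule ccontr)
    assume "p \<notin> fv.span B"
    then have ind: "fv.independent (insert p B)" and pnB: "p \<notin> B"
      using B(2) fv.independent_insertI fv.span_base by auto
    obtain g where g: "Vector_Spaces.linear (\<lambda>(c :: 'k) (v :: nat \<Rightarrow> 'k) i. c * v i) (*) g"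
      "\<forall>x\<in>insert p B. g x = (if x = p then 1 else 0)"
      using fvp.linear_independent_extend[OF ind, of "\<lambda>x. if x = p then 1 else 0"] by blast
    interpret g: Vector_Spaces.linear "\<lambda>(c :: 'k) (v :: nat \<Rightarrow> 'k) i. c * v i" "(*)" g by (rule g(1))
    define l where "l = (\<lambda>v. \<Sum>j\<le>N. g (unit_vec j) * v j)"
    have gl: "g v = l v" if "v \<in> vecs N" for v
      by (subst vecs_expand[OF that]) (simp add: g.sum g.scale l_def mult.commute)
    have "l v = 0" if vT: "v \<in> T" for v
    proof -
      have g0: "g x = 0" if "x \<in> fv.span B" for x
        using that
      proof (induction rule: fv.span_induct_alt)
        case base
        show ?case by (rule g.zero)
      next
        case (step c x y)
        have "g x = 0" using g(2) step(1) pnB by auto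
        then have "g ((\<lambda>i. c * x i) + y) = 0" using step(2) by (simp only: g.add g.scale) simp
        then show ?case by (simp add: plus_fun_def)
      qed
      have "v \<in> fv.span B" "v \<in> vecs N" using B(3) T(2) vT by auto
      then show ?thesis using gl[of v] g0[of v] by simp
    qed
    then have "l p = 0" unfolding l_def by (intro sp hm_1I) auto
    then show False using gl[OF p] g(2) by simp
  qed
  obtain c where c: "p = (\<Sum>v\<in>B. (\<lambda>i. c v * v i))"
    using pB unfolding fv.span_finite[OF finB] by blast
  have "card B \<le> N"
  proof -
    obtain L where L: "m = (\<lambda>v. \<Sum>i\<le>N. L i * v i)" using hm_1D[OF m(1)] by blast
    have "\<exists>j\<le>N. L j \<noteq> 0"
    proof (rule ccontr)
      assume "\<not> ?thesis"
      then show False using m(3) by (simp add: L)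
    qed
    then obtain j where j: "j \<le> N" "L j \<noteq> 0" by blast
    have mj: "m (unit_vec j) = L j"
      using j(1) by (simp add: L unit_vec_def if_distrib[of "\<lambda>x. _ * x"] sum.delta cong: if_cong)
    have m0: "m x = 0" if "x \<in> fv.span B" for x
      using that
    proof (induction rule: fv.span_induct_alt)
      case base
      show ?case by (simp add: L)
    next
      case (step c x y)
      have "m x = 0" using m(2) step(1) B(1) by auto
      moreover have "m ((\<lambda>i. c * x i) + y) = c * m x + m y"
      proof -
        have "m ((\<lambda>i. c * x i) + y) = (\<Sum>i\<le>N. L i * (c * x i + y i))"
          by (simp only: L plus_fun_def)
        also have "\<dots> = (\<Sum>i\<le>N. c * (L i * x i) + L i * y i)"
          by (rule sum.cong[OF refl]) (simp only: distrib_left mult.left_commute)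
        also have "\<dots> = c * m x + m y"
          by (simp only: L sum.distrib sum_distrib_left)
        finally show ?thesis .
      qed
      ultimately show ?case using step(2) by (simp add: plus_fun_def)
    qed
    \<comment> \<open>The span lies in the hyperplane m = 0, which misses the j-th unit vector.
      Adding it to B keeps independence, so card B + 1 <= N + 1.\<close>
    have nj: "unit_vec j \<notin> fv.span B" using m0 mj j(2) by auto
    then have ind: "fv.independent (insert (unit_vec j) B)" and njB: "unit_vec j \<notin> B"
      using B(2) fv.independent_insertI fv.span_base by auto
    have "v \<in> fv.span (unit_vec ` {..N})" if "v \<in> vecs N" for v
      by (subst vecs_expand[OF that]) (intro fv.span_sum fv.span_scale fv.span_base, auto)
    moreover have "insert (unit_vec j) B \<subseteq> vecs N" using B(1) T(2) j(1) by (auto simp: vecs_def unit_vec_def)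
    ultimately have "insert (unit_vec j) B \<subseteq> fv.span (unit_vec ` {..N})" by blast
    then have "card (insert (unit_vec j) B) \<le> card (unit_vec ` {..N} :: (nat \<Rightarrow> 'k) set)"
      using fv.independent_span_bound[OF _ ind] by simp
    also have "\<dots> \<le> N + 1" using card_image_le[of "{..N}" "unit_vec :: nat \<Rightarrow> nat \<Rightarrow> 'k"] by simp
    finally show ?thesis using njB finB by simp
  qed
  moreover have "p = (\<lambda>i. \<Sum>v\<in>B. c v * v i)" by (rule ext) (subst c, simp add: sum_fun_apply)
  ultimately show ?thesis using B(1) by blast
qed

section \<open>The bound by N for the rank of every point\<close>

context curve
begin

text \<open>The minors h_j vanish at v0 and have no other common zero in P^N. As p is not on X, the
  linear forms through p have no common zero on X, and two of them without one can be chosen. N >= 1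
  provides an index j \<noteq> k with h_j nonzero.\<close>

lemma pencil_through:
  assumes p: "p \<in> PN N" "p \<notin> X" and v0: "v0 \<in> p"
  shows "\<exists>a b u. pencil N X a b \<and> b u \<noteq> 0 \<and> a v0 = 0 \<and> b v0 = 0"
proof -
  note v = PN_D[OF p(1) v0]
  obtain k where k: "k \<le> N" "v0 k \<noteq> 0" using vec_nonzero_coord[OF v(1,2)] by blast
  define L where "L = {f. hm N (Suc 0) f \<and> f v0 = 0}"
  define h where "h j v = v0 k * v j - v0 j * v k" for j and v :: "nat \<Rightarrow> 'k"
  have hL: "h j \<in> L" if "j \<le> N" for j
    unfolding L_def h_def[abs_def] using that k by (auto intro!: hm_diff hm_scale hm_var)
  obtain j where j: "j \<le> N" "j \<noteq> k" using N_pos k by (cases "k = 0") auto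
  have hj: "h j (unit_vec j) \<noteq> 0" using j k by (simp add: h_def unit_vec_def)
  have "\<exists>a\<in>L. \<forall>w\<in>cone. a w \<noteq> 0 \<or> h j w \<noteq> 0"
  proof (rule base_point_free[OF _ _ hL[OF j(1)] hj])
    show "hm N (Suc 0) f" if "f \<in> L" for f using that by (simp add: L_def)
    show "(\<lambda>v. f v + c * g v) \<in> L" if "f \<in> L" "g \<in> L" for f g c
      using that by (auto simp: L_def intro!: hm_add hm_scale)
    show "\<exists>f\<in>L. f w \<noteq> 0" if w: "w \<in> cone" for w
    proof (rule ccontr)
      assume "\<not> ?thesis"
      then have h0: "h j w = 0" if "j \<le> N" for j using hL[OF that] by blast
      obtain i where i: "i \<le> N" "w i \<noteq> 0" using vec_nonzero_coord[OF cone_vecs[OF w] cone_nonzero[OF w]] by blast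
      then have "w k \<noteq> 0" using h0[OF i(1)] k by (auto simp: h_def)
      then have "pt w = pt v0" using h0 k by (intro pt_eqI[OF cone_vecs[OF w] v(1), of k]) (auto simp: h_def)
      then show False using cone_pt[OF w] p(2) v(3) by simp
    qed
  qed
  then obtain a where a: "a \<in> L" "\<forall>w\<in>cone. a w \<noteq> 0 \<or> h j w \<noteq> 0" by blast
  have "pencil N X a (h j)"
    using a hL[OF j(1)] by unfold_locales (auto simp: L_def)
  moreover have "a v0 = 0" "h j v0 = 0" using a(1) hL[OF j(1)] by (simp_all add: L_def)
  ultimately show ?thesis using hj by (intro exI conjI)
qed

lemma pencil_exists: "\<exists>a b. pencil N X a b"
proof -
  define L where "L = {f :: (nat \<Rightarrow> 'k) \<Rightarrow> 'k. hm N (Suc 0) f}"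
  have x: "(\<lambda>v. v i) \<in> L" if "i \<le> N" for i unfolding L_def using hm_var[OF that] by simp
  have "\<exists>a\<in>L. \<forall>w\<in>cone. a w \<noteq> 0 \<or> w 0 \<noteq> 0"
  proof (rule base_point_free[where b = "\<lambda>v. v 0" and u = "unit_vec 0"])
    show "hm N (Suc 0) f" if "f \<in> L" for f using that by (simp add: L_def)
    show "(\<lambda>v. f v + c * g v) \<in> L" if "f \<in> L" "g \<in> L" for f g c
      using that by (auto simp: L_def intro!: hm_add hm_scale)
    show "(\<lambda>v. v 0) \<in> L" by (rule x) simp
    show "unit_vec 0 0 \<noteq> (0 :: 'k)" by (simp add: unit_vec_def)
    show "\<exists>f\<in>L. f w \<noteq> 0" if w: "w \<in> cone" for w
    proof -
      obtain i where i: "i \<le> N" "w i \<noteq> 0" using vec_nonzero_coord[OF cone_vecs[OF w] cone_nonzero[OF w]] by blast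
      then show ?thesis using bexI[OF _ x[OF i(1)], of "\<lambda>f. f w \<noteq> 0"] by simp
    qed
  qed
  then obtain a where "a \<in> L" "\<forall>w\<in>cone. a w \<noteq> 0 \<or> w 0 \<noteq> 0" by blast
  then have "pencil N X a (\<lambda>v. v 0)" using x[of 0] by unfold_locales (auto simp: L_def)
  then show ?thesis by (intro exI)
qed

lemma span_at_most_N:
  assumes p: "p \<in> PN N"
  shows "\<exists>P\<subseteq>X. finite P \<and> card P \<le> N \<and> p \<in> pspan P"
proof (cases "p \<in> X")
  case True
  obtain v where v: "v \<in> p" using PN_nonempty[OF p] by blast
  then have "p \<in> pspan {p}" unfolding pspan_def
    by (intro CollectI exI[of _ "\<lambda>_. v"] exI[of _ "\<lambda>_. 1"]) auto
  then show ?thesis using True N_pos by (intro exI[of _ "{p}"]) auto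
next
  case False
  obtain v0 where v0: "v0 \<in> p" using PN_nonempty[OF p] by blast
  note v = PN_D[OF p v0]
  obtain a b u where ab: "pencil N X a b" "b u \<noteq> 0" "a v0 = 0" "b v0 = 0"
    using pencil_through[OF p False v0] by blast
  interpret pencil N X a b by (rule ab(1))
  obtain T \<tau> where T: "finite T" "T \<subseteq> C" "\<forall>v\<in>T. a v = \<tau>"
    and sp: "\<forall>l. hm N (Suc 0) l \<longrightarrow> (\<forall>v\<in>T. l v = 0) \<longrightarrow> (\<exists>c. \<forall>v. l v = c * (a v - \<tau> * b v))"
    using fibre_spans[OF ab(2)] by (elim exE conjE) (rule that)
  define m where "m v = a v - \<tau> * b v" for v
  have m: "hm N (Suc 0) m" unfolding m_def[abs_def] by (intro hm_diff hm_scale a b)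
  have TV: "T \<subseteq> vecs N" using T(2) cone_vecs by (auto simp: C_def)
  have "\<exists>u. m u \<noteq> 0"
  proof (rule ccontr)
    assume "\<not> ?thesis"
    then have "poly [:-\<tau>, 1:] (a v) = 0" if "v \<in> C" for v using that by (auto simp: m_def C_def)
    from a_transcendental[OF ab(2) this] show False by simp
  qed
  then obtain u' where u': "m u' \<noteq> 0" by blast
  have mT: "m v = 0" if "v \<in> T" for v using T that by (auto simp: m_def C_def)
  have "\<exists>B c. B \<subseteq> T \<and> card B \<le> N \<and> v0 = (\<lambda>i. \<Sum>v\<in>B. c v * v i)"
  proof (rule span_by_linear_forms[where m = m and u = u'])
    fix l assume "hm N (Suc 0) l" "\<forall>v\<in>T. l v = 0"
    then obtain e where "\<forall>v. l v = e * (a v - \<tau> * b v)" using sp by blast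
    then show "l v0 = 0" using ab(3,4) by simp
  qed (use T(1) TV v(1) m mT u' in auto)
  then obtain B c where B: "B \<subseteq> T" "card B \<le> N" "v0 = (\<lambda>i. \<Sum>v\<in>B. c v * v i)" by blast
  \<comment> \<open>Proportional vectors with b = 1 are equal, so passing from vectors to points
    does not change the number.\<close>
  have inj: "inj_on pt B"
  proof (rule inj_onI)
    fix x y assume xy: "x \<in> B" "y \<in> B" "pt x = pt y"
    then have "x \<in> pt y" using pt_self[of x] by simp
    then obtain e where e: "x = (\<lambda>i. e * y i)" by (auto simp: pt_def)
    have "b x = 1" "b y = 1" using xy B(1) T(2) by (auto simp: C_def)
    then have "e = 1" using hm_homogeneous[OF b, of e y] e by simp
    then show "x = y" using e by simp
  qed
  define r where "r = the_inv_into B pt"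
  have r: "r (pt x) = x" if "x \<in> B" for x unfolding r_def by (rule the_inv_into_f_f[OF inj that])
  have "p \<in> pspan (pt ` B)" unfolding pspan_def
  proof (intro CollectI exI conjI)
    show "\<forall>q\<in>pt ` B. r q \<in> q" using r pt_self by auto
    have "(\<lambda>i. \<Sum>q\<in>pt ` B. c (r q) * r q i) = v0"
      unfolding B(3) using r by (subst sum.reindex[OF inj]) simp
    then show "(\<lambda>i. \<Sum>q\<in>pt ` B. c (r q) * r q i) \<in> p" using v0 by simp
  qed
  moreover have "pt ` B \<subseteq> X" using B(1) T(2) cone_pt by (auto simp: C_def)
  moreover have "finite (pt ` B)" using B(1) T(1) finite_subset by blast
  moreover have "card (pt ` B) \<le> N" using card_image[OF inj] B(2) by simp
  ultimately show ?thesis by blast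
qed

lemma rank_le_N:
  assumes "p \<in> PN N"
  shows "rank N X p \<le> N"
proof -
  obtain P where P: "P \<subseteq> X" "finite P" "card P \<le> N" "p \<in> pspan P" using span_at_most_N[OF assms] by blast
  have "rank N X p \<le> card P" unfolding rank_def by (rule Least_le) (use P in blast)
  then show ?thesis using P(3) by simp
qed

text \<open>The minimum in the definition of rank is attained because points of X span p, by
  \<open>span_at_most_N\<close>.\<close>

lemma rank_spanE:
  assumes "p \<in> PN N"
  obtains P where "P \<subseteq> X" "finite P" "card P = rank N X p" "p \<in> pspan P"
proof -
  have "\<exists>r. \<exists>P. P \<subseteq> X \<and> finite P \<and> card P = r \<and> p \<in> pspan P"
    using span_at_most_N[OF assms] by blast
  from LeastI_ex[OF this] show ?thesis using that unfolding rank_def by blast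
qed

section \<open>Secant varieties and lower bounds for the generic rank\<close>

lemma rank_le_vsum:
  assumes p: "p \<in> PN N" and r: "rank N X p \<le> k"
  shows "\<exists>u. (\<forall>j. u j = (\<lambda>_. 0) \<or> u j \<in> cone) \<and> vsum k u \<in> p"
proof -
  obtain P where P: "P \<subseteq> X" "finite P" "card P = rank N X p" "p \<in> pspan P" using rank_spanE[OF p] by blast
  obtain w c where w: "\<forall>q\<in>P. w q \<in> q" "(\<lambda>i. \<Sum>q\<in>P. c q * w q i) \<in> p" using P(4) by (auto simp: pspan_def)
  obtain f where f: "bij_betw f {..<card P} P"
    using ex_bij_betw_nat_finite[OF P(2)] by (auto simp: atLeast0LessThan)
  \<comment> \<open>Zero vectors stand for the missing points when the rank is below k, and for
    points with coefficient zero, which would leave the cone.\<close>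
  define u where "u j = (if j < card P then (\<lambda>i. c (f j) * w (f j) i) else (\<lambda>_. 0))" for j
  have "u j = (\<lambda>_. 0) \<or> u j \<in> cone" for j
  proof (cases "j < card P \<and> c (f j) \<noteq> 0")
    case True
    then have "f j \<in> P" using f by (auto dest: bij_betwE)
    then have "w (f j) \<in> cone" using w(1) P(1) by (auto simp: cone_def)
    then show ?thesis using True cone_scale by (simp add: u_def)
  qed (auto simp: u_def)
  moreover have "vsum k u = (\<lambda>i. \<Sum>q\<in>P. c q * w q i)"
  proof
    fix i
    have "vsum k u i = (\<Sum>j\<in>{..<card P}. c (f j) * w (f j) i)" unfolding vsum_def
      by (rule sum.mono_neutral_cong_right) (use r P(3) in \<open>auto simp: u_def\<close>)
    also have "\<dots> = (\<Sum>q\<in>P. c q * w q i)" by (rule sum.reindex_bij_betw[OF f])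
    finally show "vsum k u i = (\<Sum>q\<in>P. c q * w q i)" .
  qed
  ultimately show ?thesis using w(2) by (intro exI[of _ u]) simp
qed

text \<open>Vanishing of F at the origin comes from the sum of k zero vectors. It ensures that a
  vector with F \<noteq> 0 is nonzero and so defines a point.\<close>

lemma low_rank_hypersurface:
  fixes \<mu> :: "nat \<Rightarrow> (nat \<Rightarrow> 'k) \<Rightarrow> 'k"
  assumes I: "finite I" "2 * k < card I" and \<mu>: "\<forall>i\<in>I. hm N (Suc 0) (\<mu> i)"
  shows "\<exists>\<delta> F w. hm N \<delta> F \<and> F (\<lambda>_. 0) = 0 \<and> {p \<in> PN N. rank N X p \<le> k} \<subseteq> hzeros N {F} \<and>
    (\<forall>v v'. (\<forall>i\<in>I. \<mu> i v = \<mu> i v') \<longrightarrow> F v = F v') \<and> (\<forall>v. (\<forall>i\<in>I. \<mu> i v = w i) \<longrightarrow> F v \<noteq> 0)"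
proof -
  obtain a b where "pencil N X a b" using pencil_exists by blast
  then interpret pencil N X a b .
  obtain \<delta> F w where F: "hm N \<delta> F" "\<forall>u. (\<forall>j. u j \<in> cone0) \<longrightarrow> F (vsum k u) = 0"
    "\<forall>v v'. (\<forall>i\<in>I. \<mu> i v = \<mu> i v') \<longrightarrow> F v = F v'" "\<forall>v. (\<forall>i\<in>I. \<mu> i v = w i) \<longrightarrow> F v \<noteq> 0"
    using dimension_bound[OF I \<mu>] by (elim exE conjE) (rule that)
  have "F (\<lambda>_. 0) = 0" using F(2)[rule_format, of "\<lambda>_ _. 0"] by (simp add: cone0_def vsum_def)
  moreover have "{p \<in> PN N. rank N X p \<le> k} \<subseteq> hzeros N {F}"
  proof
    fix p assume "p \<in> {p \<in> PN N. rank N X p \<le> k}"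
    then have p: "p \<in> PN N" "rank N X p \<le> k" by auto
    obtain u where u: "\<forall>j. u j = (\<lambda>_. 0) \<or> u j \<in> cone" "vsum k u \<in> p" using rank_le_vsum[OF p] by blast
    have "F (vsum k u) = 0" using F(2) u(1) by (simp add: cone0_def)
    then show "p \<in> hzeros N {F}" using hm_pt[OF p(1) u(2) F(1)] p(1) by (simp add: hzeros_def)
  qed
  ultimately show ?thesis using F by (intro exI[of _ \<delta>] exI[of _ F] exI[of _ w] conjI)
qed

lemma closure_low_rank:
  assumes "hm N \<delta> F" "S \<subseteq> hzeros N {F}"
  shows "zclosure N S \<subseteq> hzeros N {F}"
proof -
  have "zclosed N (hzeros N {F})" by (rule zclosed_hzeros) (use assms(1) in auto)
  then show ?thesis using assms(2) unfolding zclosure_def by blast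
qed

text \<open>If 2 g <= N, the N + 1 coordinates exceed 2 g, so a nonzero form F vanishes on all
  points of rank at most g. These include a dense set, so F would vanish on all of P^N.\<close>

lemma generic_rank_ge:
  assumes "is_generic_rank N X g"
  shows "N + 1 \<le> 2 * g"
proof (rule ccontr)
  assume "\<not> ?thesis"
  then have I: "2 * g < card {..N}" by simp
  have x: "\<forall>i\<in>{..N}. hm N (Suc 0) (\<lambda>v. v i :: 'k)" by (simp add: hm_var)
  obtain \<delta> F w where F: "hm N \<delta> F" "F (\<lambda>_. 0) = 0" "{p \<in> PN N. rank N X p \<le> g} \<subseteq> hzeros N {F}"
    "\<forall>v v'. (\<forall>i\<in>{..N}. v i = v' i) \<longrightarrow> F v = F v'" "\<forall>v. (\<forall>i\<in>{..N}. v i = w i) \<longrightarrow> F v \<noteq> 0"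
    using low_rank_hypersurface[OF finite_atMost I x] by (elim exE conjE) (rule that)
  obtain U where U: "zopen N U" "zclosure N U = PN N" "\<forall>p\<in>U. rank N X p = g"
    using assms by (auto simp: is_generic_rank_def)
  have "U \<subseteq> {p \<in> PN N. rank N X p \<le> g}" using U by (auto simp: zopen_def)
  then have "PN N \<subseteq> hzeros N {F}" using closure_low_rank[OF F(1)] F(3) U(2) by blast
  define v where "v i = (if i \<le> N then w i else 0)" for i
  have Fv: "F v \<noteq> 0" by (rule F(5)[rule_format]) (simp add: v_def)
  then have "v \<noteq> (\<lambda>_. 0)" using F(2) by auto
  then have "pt v \<in> PN N" by (intro PN_pt) (auto simp: vecs_def v_def)
  then have "F v = 0" using \<open>PN N \<subseteq> hzeros N {F}\<close> pt_self by (auto simp: hzeros_def)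
  then show False using Fv by simp
qed

text \<open>If N > 2 k, projection from a point u off the hypersurface f = 0 has N > 2 k
  coordinates, so a nonzero form F in these coordinates vanishes on the secant variety. But every
  line through u meets f = 0, and F is constant along the affine lines in direction u, which is
  absurd where F is nonzero.\<close>

lemma hypersurface_secant:
  assumes "is_hypersurface N (sigma N X k)"
  shows "N \<le> 2 * k"
proof (rule ccontr)
  assume lt: "\<not> ?thesis"
  obtain e c where c: "e \<ge> 1" "hpoly N e c" "c \<noteq> (\<lambda>_. 0)" "sigma N X k = zero_set N {c}"
    using assms by (auto simp: is_hypersurface_def)
  define f where "f = peval N c"
  have f: "hm N e f" unfolding f_def by (rule hpoly_hm[OF c(2)])
  have V: "sigma N X k = hzeros N {f}" by (simp add: c(4) f_def hzeros_def zero_set_def)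
  obtain u where u: "u \<in> vecs N" "f u \<noteq> 0" using hpoly_nonzero[OF c(2,3)] by (auto simp: f_def)
  have "u \<noteq> (\<lambda>_. 0)" using u(2) hm_homogeneous[OF f, of 0 u] c(1) by (auto simp: power_0_left)
  then obtain s where s: "s \<le> N" "u s \<noteq> 0" using vec_nonzero_coord[OF u(1)] by blast
  \<comment> \<open>Coordinates of the projection from u: each \<mu>_i vanishes at u, so all of them
    are constant in direction u.\<close>
  define \<mu> where "\<mu> i v = v i - u i / u s * v s" for i and v :: "nat \<Rightarrow> 'k"
  let ?I = "{..N} - {s}"
  have I: "finite ?I" "2 * k < card ?I" using lt s by auto
  have \<mu>: "\<forall>i\<in>?I. hm N (Suc 0) (\<mu> i)"
    unfolding \<mu>_def[abs_def] using s(1) by (intro ballI hm_diff hm_scale hm_var) auto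
  obtain \<delta> F w where F: "hm N \<delta> F" "F (\<lambda>_. 0) = 0" "{p \<in> PN N. rank N X p \<le> k} \<subseteq> hzeros N {F}"
    "\<forall>v v'. (\<forall>i\<in>?I. \<mu> i v = \<mu> i v') \<longrightarrow> F v = F v'" "\<forall>v. (\<forall>i\<in>?I. \<mu> i v = w i) \<longrightarrow> F v \<noteq> 0"
    using low_rank_hypersurface[OF I \<mu>] by (elim exE conjE) (rule that)
  have sub: "hzeros N {f} \<subseteq> hzeros N {F}"
    using closure_low_rank[OF F(1,3)] V by (simp add: sigma_def)
  \<comment> \<open>With v_s = 0 the correction term drops out and \<mu>_i v = w_i, so v realises
    the prescribed values.\<close>
  define v where "v i = (if i \<in> ?I then w i else 0)" for i
  have Fv: "F v \<noteq> 0" by (rule F(5)[rule_format]) (auto simp: \<mu>_def v_def)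
  obtain P where P: "degree P \<le> e" "coeff P e = f u" "\<And>x. f (\<lambda>i. v i + x * u i) = poly P x"
    using hm_on_line[OF f] by blast
  \<comment> \<open>The coefficient at e >= 1 is f u \<noteq> 0, so the polynomial is not constant
    and the line meets the hypersurface.\<close>
  have "degree P \<ge> 1" using P(2) u(2) c(1) le_degree[of P e] by simp
  then obtain x where x: "poly P x = 0" using ac unfolding alg_closed_field_def by blast
  define v' where "v' = (\<lambda>i. v i + x * u i)"
  have "\<mu> i v' = \<mu> i v" for i
    using s(2) by (simp add: \<mu>_def v'_def distrib_left)
  then have "F v' = F v" using F(4) by blast
  then have Fv': "F v' \<noteq> 0" using Fv by simp
  then have "v' \<noteq> (\<lambda>_. 0)" using F(2) by auto
  moreover have "v' \<in> vecs N" using u(1) by (auto simp: vecs_def v'_def v_def)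
  moreover have "f v' = 0" using P(3)[of x] x by (simp add: v'_def)
  ultimately have "pt v' \<in> hzeros N {f}" using f by (intro pt_in_hzeros) auto
  then have "F v' = 0" using sub pt_self by (auto simp: hzeros_def)
  then show False using Fv' by simp
qed

end

theorem theorem3p7:
  fixes X :: "(nat \<Rightarrow> 'k::field_char_0) set set" and N g m :: nat
  assumes "alg_closed_field TYPE('k)"
    and "proj_curve N X" and "nondegenerate N X"
    and "is_generic_rank N X g" and "is_max_rank N X m"
  shows "m \<le> 2 * g - 1 \<and> (is_hypersurface N (sigma N X (g - 1)) \<longrightarrow> m \<le> 2 * g - 2)"
proof -
  interpret curve N X by unfold_locales (fact assms)+
  obtain p where "p \<in> PN N" "rank N X p = m" using assms(5) by (auto simp: is_max_rank_def)
  then have "m \<le> N" using rank_le_N by blast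
  \<comment> \<open>This also forces g >= 1, so the truncated subtractions in the claim are
    genuine.\<close>
  moreover have "N + 1 \<le> 2 * g" by (rule generic_rank_ge[OF assms(4)])
  moreover have "N \<le> 2 * (g - 1)" if "is_hypersurface N (sigma N X (g - 1))"
    by (rule hypersurface_secant[OF that])
  ultimately show ?thesis by fastforce
qed

end
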